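(* Suppose that a point $P=(a,b)\in\mathcal{C}(K_0)\subset J(K_0)$, i.e., $a,b\in K_0$ and $b^2=f(a)$. Then the following conditions are equivalent. (i) $\alpha_i\in K_0$ and $a-\alpha_i$ is a square in $K_0$ for all $i$ with $1\le i\le 2g+1$. (ii) All $2^{2g}$ elements $\mathfrak{a}\in J(K)$ with $2\mathfrak{a}=P$ actually lie in $J(K_0)$.
   Context: $K$ is an algebraically closed field of characteristic different from $2$, $g\ge 1$ is an integer, $\alpha_1,\dots,\alpha_{2g+1}$ are distinct elements of $K$, and $f(x)=\prod_{i=1}^{2g+1}(x-\alpha_i)$. $K_0$ is a subfield of $K$ such that $f(x)\in K_0[x]$ (the roots $\alpha_i$ need not lie in $K_0$). $\mathcal{C}$ is the smooth projective model of $y^2=f(x)$, a genus $g$ hyperelliptic curve with exactly one infinite point $\infty$. $J$ is the jacobian of $\mathcal{C}$; both $\mathcal{C}$ and $J$ are defined over $K_0$, and $\infty\in\mathcal{C}(K_0)$. $\mathcal{C}$ is identified with its image in $J$ under the embedding $P\mapsto\mathrm{cl}((P)-(\infty))$ (defined over $K_0$), where $\mathrm{cl}$ denotes linear equivalence class. *)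

theory Defs
  imports
    "HOL-Algebra.Algebraic_Closure_Type"
    "HOL-Algebra.Free_Abelian_Groups"
    "HOL-Algebra.Coset"
begin

text \<open>
  Throughout, \<open>K\<close> is the algebraically closed field \<^typ>\<open>'a\<close>, of characteristic different
  from 2, and \<open>f\<close> is a squarefree polynomial over \<open>K\<close> of odd degree. The smooth projective model
  of \<open>y^2 = f(x)\<close> consists of the affine points, all of them smooth, and one point at infinity.
\<close>

datatype 'a point = Affine 'a 'a | Infinity

definition curve :: "'a::field poly \<Rightarrow> 'a point set" where
  "curve f = {Affine a b | a b. b ^ 2 = poly f a} \<union> {Infinity}"

text \<open>
  The pair \<open>(u, v)\<close> stands for the function \<open>u(x) + v(x) y\<close>. Each element of the coordinate
  ring \<open>K[x, y] / (y^2 - f(x))\<close> of the affine curve has a unique representation of this form, and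
  the function field \<open>K(C)\<close> is the field of fractions of this ring.
\<close>

type_synonym 'a regular = "'a poly \<times> 'a poly"

definition reg_one :: "'a::field regular" where
  "reg_one = (1, 0)"

definition reg_mult :: "'a::field poly \<Rightarrow> 'a regular \<Rightarrow> 'a regular \<Rightarrow> 'a regular" where
  "reg_mult f G H =
     (fst G * fst H + f * (snd G * snd H), fst G * snd H + snd G * fst H)"

definition reg_power :: "'a::field poly \<Rightarrow> 'a regular \<Rightarrow> nat \<Rightarrow> 'a regular" where
  "reg_power f G n = (reg_mult f G ^^ n) reg_one"

definition reg_eval :: "'a::field regular \<Rightarrow> 'a \<Rightarrow> 'a \<Rightarrow> 'a" where
  "reg_eval G a b = poly (fst G) a + poly (snd G) a * b"

text \<open>
  A local parameter at \<open>(a, b)\<close> is \<open>x - a\<close> if \<open>b \<noteq> 0\<close>, and \<open>y\<close> if \<open>b = 0\<close>.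
\<close>

definition local_param :: "'a::field \<Rightarrow> 'a \<Rightarrow> 'a regular" where
  "local_param a b = (if b = 0 then (0, 1) else ([:- a, 1:], 0))"

text \<open>
  The order of vanishing of a nonzero \<open>G\<close> in the coordinate ring; the value at \<open>G = 0\<close> is
  irrelevant and never used. At an affine point, with local parameter \<open>t\<close>, it is the \<open>n\<close> for
  which \<open>G\<close> is \<open>t^n\<close> times a unit \<open>H' / H\<close> of the local ring. At infinity \<open>x\<close> has a pole of order
  2 and \<open>y\<close> one of order \<open>deg f\<close>; as \<open>deg f\<close> is odd, the pole orders of \<open>u(x)\<close> and \<open>v(x) y\<close> have
  different parity, and that of the sum is the larger one.
\<close>

fun ord_at :: "'a::field poly \<Rightarrow> 'a point \<Rightarrow> 'a regular \<Rightarrow> int" where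
  "ord_at f (Affine a b) G =
     int (THE n. \<exists>H H'. reg_eval H a b \<noteq> 0 \<and> reg_eval H' a b \<noteq> 0 \<and>
            reg_mult f H G = reg_mult f (reg_power f (local_param a b) n) H')"
| "ord_at f Infinity G =
     - int (if snd G = 0 then 2 * Polynomial.degree (fst G)
            else max (2 * Polynomial.degree (fst G))
                     (2 * Polynomial.degree (snd G) + Polynomial.degree f))"

text \<open>
  Divisors are the elements of the free abelian group on the points; the order of the rational
  function \<open>G / H\<close> at \<open>P\<close> is \<open>ord_at f P G - ord_at f P H\<close>.
\<close>

definition div_degree :: "('a point \<Rightarrow>\<^sub>0 int) \<Rightarrow> int" where
  "div_degree D = (\<Sum>P\<in>Poly_Mapping.keys D. Poly_Mapping.lookup D P)"

definition degree0_divisors :: "'a::field poly \<Rightarrow> ('a point \<Rightarrow>\<^sub>0 int) monoid" where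
  "degree0_divisors f =
     (free_Abelian_group (curve f))
       \<lparr>carrier := {D \<in> carrier (free_Abelian_group (curve f)). div_degree D = 0}\<rparr>"

definition principal_divisors :: "'a::field poly \<Rightarrow> ('a point \<Rightarrow>\<^sub>0 int) set" where
  "principal_divisors f =
     {D \<in> carrier (free_Abelian_group (curve f)).
        \<exists>G H. G \<noteq> (0, 0) \<and> H \<noteq> (0, 0) \<and>
          (\<forall>P\<in>curve f. Poly_Mapping.lookup D P = ord_at f P G - ord_at f P H)}"

text \<open>The group \<open>J(K)\<close>, written multiplicatively as usual for the library's groups.\<close>

definition jacobian :: "'a::field poly \<Rightarrow> ('a point \<Rightarrow>\<^sub>0 int) set monoid" where
  "jacobian f = degree0_divisors f Mod principal_divisors f"

definition cl :: "'a::field poly \<Rightarrow> ('a point \<Rightarrow>\<^sub>0 int) \<Rightarrow> ('a point \<Rightarrow>\<^sub>0 int) set" where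
  "cl f D = principal_divisors f #>\<^bsub>degree0_divisors f\<^esub> D"

definition curve_to_jacobian :: "'a::field poly \<Rightarrow> 'a point \<Rightarrow> ('a point \<Rightarrow>\<^sub>0 int) set" where
  "curve_to_jacobian f P = cl f (frag_of P - frag_of Infinity)"

definition poly_over :: "'a::field set \<Rightarrow> 'a poly \<Rightarrow> bool" where
  "poly_over K0 p \<longleftrightarrow> (\<forall>i. Polynomial.coeff p i \<in> K0)"

definition reg_over :: "'a::field set \<Rightarrow> 'a regular \<Rightarrow> bool" where
  "reg_over K0 G \<longleftrightarrow> poly_over K0 (fst G) \<and> poly_over K0 (snd G)"

text \<open>
  Let \<open>f\<close> have coefficients in the subfield \<open>K0\<close>. A divisor on \<open>C\<close> is defined over \<open>K0\<close> if it is
  the pullback of a divisor on the model \<open>C0\<close> of \<open>C\<close> over \<open>K0\<close>, i.e. if its sheaf \<open>O(-D)\<close> comes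
  from \<open>C0\<close>. On the affine curve this means that the fractional ideal of all functions \<open>\<phi>\<close> with
  \<open>div \<phi> \<ge> D\<close> is generated by functions \<open>\<phi> = G / H\<close> in \<open>K0(C)\<close>, in other words, that at every
  affine point \<open>Q\<close> some such \<open>\<phi>\<close> over \<open>K0\<close> has order exactly \<open>D(Q)\<close>. The coefficient at infinity,
  which is a \<open>K0\<close>-rational point, is unrestricted. Invariance under the automorphisms of \<open>K\<close> over
  \<open>K0\<close> would not do instead, as \<open>K0\<close> may be imperfect.
\<close>

definition divisor_over :: "'a::field poly \<Rightarrow> 'a set \<Rightarrow> ('a point \<Rightarrow>\<^sub>0 int) \<Rightarrow> bool" where
  "divisor_over f K0 D \<longleftrightarrow>
     (\<forall>Q\<in>curve f - {Infinity}. \<exists>G H.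
        reg_over K0 G \<and> reg_over K0 H \<and> G \<noteq> (0, 0) \<and> H \<noteq> (0, 0) \<and>
        (\<forall>P\<in>curve f - {Infinity}. Poly_Mapping.lookup D P \<le> ord_at f P G - ord_at f P H) \<and>
        Poly_Mapping.lookup D Q = ord_at f Q G - ord_at f Q H)"

text \<open>
  \<open>J(K0)\<close> as a subset of \<open>J(K)\<close>. As \<open>C\<close> has a \<open>K0\<close>-rational point, \<open>J(K0)\<close> is the group of
  divisor classes of degree 0 on \<open>C0\<close>.
\<close>

definition jacobian_over :: "'a::field poly \<Rightarrow> 'a set \<Rightarrow> ('a point \<Rightarrow>\<^sub>0 int) set set" where
  "jacobian_over f K0 =
     cl f ` {D \<in> carrier (degree0_divisors f). divisor_over f K0 D}"

end

theory Submission
  imports Defs "HOL-Library.Product_Plus"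
begin

text \<open>
  Let \<open>P = (a, b)\<close>. The halves of \<open>P\<close> are parametrized explicitly, by square roots of the \<open>a - \<alpha>\<^sub>i\<close>,
  and the parametrization is compatible with the field of definition.
  
  \<^bold>\<open>From halves to polynomials.\<close> Let \<open>D\<close> be a divisor of degree 0 with \<open>2 D \<sim> P - \<infinity>\<close>. By the
  inequality of Riemann (\<open>exists_section\<close>), \<open>D \<sim> g \<infinity> - E\<close> with an effective \<open>E\<close> of degree \<open>g\<close>. So
  \<open>2 E + P - (2 g + 1) \<infinity>\<close> is the divisor of a function. Its only pole is at infinity and of odd order
  at most \<open>2 g + 1\<close>, so it is a multiple of \<open>y - V(x)\<close> with \<open>deg V \<le> g\<close>. Its norm shows that
  \<open>f - V\<^sup>2 = (x - a) U\<^sup>2\<close> for some \<open>U\<close>, and \<open>V(a) = b\<close> (\<open>extract_half_poly\<close>). Conversely every such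
  pair \<open>(U, V)\<close> yields a half, the pair with \<open>U\<close> normalized is determined by the half
  (\<open>half_class_inj\<close>), and \<open>E\<close> is the divisor with Mumford representation \<open>(U, V)\<close>.
  
  \<^bold>\<open>From polynomials to square roots.\<close> Put \<open>x = a - t\<^sup>2\<close> and \<open>W(t) = V(a - t\<^sup>2) + t U(a - t\<^sup>2)\<close>. The
  equation for \<open>U\<close> and \<open>V\<close> becomes \<open>W(t) W(- t) = f(a - t\<^sup>2)\<close>, which is the product of the
  \<open>(a - \<alpha>\<^sub>i) - t\<^sup>2\<close>. Hence \<open>W\<close> is the product of the \<open>t + r\<^sub>i\<close> for square roots \<open>r\<^sub>i\<close> of \<open>a - \<alpha>\<^sub>i\<close>, and
  \<open>V(a) = b\<close> says that the product of the \<open>r\<^sub>i\<close> is \<open>b\<close>. Since \<open>U\<close> and \<open>V\<close> come from the odd and the even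
  part of \<open>W\<close>, every choice of square roots with product \<open>b\<close> occurs (\<open>half_roots_surj\<close>). There are
  \<open>2 ^ (2 g)\<close> such choices (\<open>card_root_choices\<close>): all roots but one are free, and the last one is determined.
  
  \<^bold>\<open>Rationality.\<close> If all \<open>\<alpha>\<^sub>i\<close> and \<open>r\<^sub>i\<close> lie in \<open>K0\<close>, then so do the coefficients of \<open>W\<close>, \<open>U\<close> and \<open>V\<close>, and
  the half is represented by a divisor whose ideal is generated by \<open>U\<close> and \<open>y + V\<close>
  (\<open>half_class_over\<close>). Conversely let \<open>D\<close> be defined over \<open>K0\<close>. Functions over \<open>K0\<close> generate its
  sections, so the functions in the construction of \<open>V\<close> can be chosen over \<open>K0\<close> (\<open>descent\<close>). Thus
  \<open>V\<close> has coefficients in \<open>K0\<close> (\<open>half_poly_over\<close>), and so does the even part of \<open>W\<close>; in particular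
  the sum of the \<open>r\<^sub>i\<close> lies in \<open>K0\<close>. Reversing the signs of \<open>r\<^sub>i\<close> and \<open>r\<^sub>j\<close> gives another half, so if all
  halves are rational, then \<open>2 (r\<^sub>i + r\<^sub>j) \<in> K0\<close> for all \<open>i \<noteq> j\<close>. As there are at least three indices,
  all \<open>r\<^sub>i\<close> lie in \<open>K0\<close>, and with them \<open>\<alpha>\<^sub>i = a - r\<^sub>i\<^sup>2\<close>.
\<close>

section \<open>The coordinate ring\<close>

(* Functions are handled as elements of a ring, and orders through the relation has_ord below. *)
declare split_paired_All [simp del] split_paired_Ex [simp del] ord_at.simps [simp del]

definition reg_conj :: "'a::field regular \<Rightarrow> 'a regular" where
  "reg_conj G = (fst G, - snd G)"

definition reg_norm :: "'a::field poly \<Rightarrow> 'a regular \<Rightarrow> 'a poly" where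
  "reg_norm f G = fst G ^ 2 - f * snd G ^ 2"

lemma reg_mult_commute: "reg_mult f G H = reg_mult f H G"
  by (simp add: reg_mult_def algebra_simps)

lemma reg_mult_assoc: "reg_mult f (reg_mult f G H) L = reg_mult f G (reg_mult f H L)"
  by (simp add: reg_mult_def algebra_simps)

lemma reg_mult_left_commute: "reg_mult f G (reg_mult f H L) = reg_mult f H (reg_mult f G L)"
  by (simp add: reg_mult_def algebra_simps)

lemmas reg_mult_ac = reg_mult_assoc reg_mult_commute reg_mult_left_commute

lemma reg_mult_one [simp]: "reg_mult f reg_one G = G" "reg_mult f G reg_one = G"
  by (simp_all add: reg_mult_def reg_one_def)

lemma reg_mult_zero [simp]: "reg_mult f 0 G = 0" "reg_mult f G 0 = 0"
  by (simp_all add: reg_mult_def prod_eq_iff)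

lemma reg_mult_add: "reg_mult f G (H + L) = reg_mult f G H + reg_mult f G L"
  by (simp add: reg_mult_def prod_eq_iff algebra_simps)

lemma reg_mult_diff: "reg_mult f G (H - L) = reg_mult f G H - reg_mult f G L"
  by (simp add: reg_mult_def prod_eq_iff algebra_simps)

lemma reg_power_0 [simp]: "reg_power f G 0 = reg_one"
  by (simp add: reg_power_def)

lemma reg_power_Suc: "reg_power f G (Suc n) = reg_mult f G (reg_power f G n)"
  by (simp add: reg_power_def)

lemma reg_power_add:
  "reg_power f G (m + n) = reg_mult f (reg_power f G m) (reg_power f G n)"
  by (induction m) (simp_all add: reg_power_Suc reg_mult_assoc)

lemma reg_power_mult:
  "reg_power f (reg_mult f G H) n = reg_mult f (reg_power f G n) (reg_power f H n)"
  by (induction n) (simp_all add: reg_power_Suc reg_mult_ac)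

lemma reg_power_poly: "reg_power f (p, 0) n = (p ^ n, 0)"
  by (induction n) (simp_all add: reg_power_Suc reg_mult_def reg_one_def)

lemma reg_mult_poly: "reg_mult f (p, 0) G = (p * fst G, p * snd G)"
  by (simp add: reg_mult_def)

lemma reg_mult_conj: "reg_mult f (reg_conj G) G = (reg_norm f G, 0)"
  by (simp add: reg_mult_def reg_conj_def reg_norm_def power2_eq_square algebra_simps)

lemma reg_conj_mult: "reg_conj (reg_mult f G H) = reg_mult f (reg_conj G) (reg_conj H)"
  by (simp add: reg_mult_def reg_conj_def)

lemma reg_conj_eq_0_iff [simp]: "reg_conj G = 0 \<longleftrightarrow> G = 0"
  by (simp add: reg_conj_def prod_eq_iff)

lemma reg_norm_mult: "reg_norm f (reg_mult f G H) = reg_norm f G * reg_norm f H"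
  by (simp add: reg_mult_def reg_norm_def power2_eq_square algebra_simps)

lemma reg_norm_conj [simp]: "reg_norm f (reg_conj G) = reg_norm f G"
  by (simp add: reg_conj_def reg_norm_def)

lemma reg_eval_mult:
  "b ^ 2 = poly f a \<Longrightarrow> reg_eval (reg_mult f G H) a b = reg_eval G a b * reg_eval H a b"
  unfolding power2_eq_square
  by (drule sym) (simp add: reg_mult_def reg_eval_def algebra_simps)

lemma reg_eval_add [simp]: "reg_eval (G + H) a b = reg_eval G a b + reg_eval H a b"
  by (simp add: reg_eval_def algebra_simps)

lemma reg_eval_diff [simp]: "reg_eval (G - H) a b = reg_eval G a b - reg_eval H a b"
  by (simp add: reg_eval_def algebra_simps)

lemma reg_eval_one [simp]: "reg_eval reg_one a b = 1"
  by (simp add: reg_eval_def reg_one_def)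

lemma reg_eval_zero [simp]: "reg_eval 0 a b = 0"
  by (simp add: reg_eval_def)

lemma reg_eval_poly [simp]: "reg_eval (p, 0) a b = poly p a"
  by (simp add: reg_eval_def)

lemma reg_eval_conj: "reg_eval (reg_conj G) a b = reg_eval G a (- b)"
  by (simp add: reg_eval_def reg_conj_def)

lemma reg_eval_local_param [simp]: "reg_eval (local_param a b) a b = 0"
  by (simp add: reg_eval_def local_param_def)

text \<open>
  The function \<open>u(x) + v(x) y\<close> as a polynomial in a formal parameter of which \<open>x\<close> is the square
  and \<open>y\<close> the power with exponent \<open>deg f\<close>: its degree is the pole order at infinity. So pole
  orders can be handled like degrees of polynomials, including the cancellation of leading
  terms.
\<close>

definition pole_poly :: "nat \<Rightarrow> 'a::field regular \<Rightarrow> 'a poly" where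
  "pole_poly n G = pcompose (fst G) (Polynomial.monom 1 2)
     + Polynomial.monom 1 n * pcompose (snd G) (Polynomial.monom 1 2)"

definition reg_smult :: "'a::field \<Rightarrow> 'a regular \<Rightarrow> 'a regular" where
  "reg_smult c G = (Polynomial.smult c (fst G), Polynomial.smult c (snd G))"

definition pole_order :: "nat \<Rightarrow> 'a::field regular \<Rightarrow> nat" where
  "pole_order n G = Polynomial.degree (pole_poly n G)"

lemma pole_poly_add [simp]: "pole_poly n (G + H) = pole_poly n G + pole_poly n H"
  by (simp add: pole_poly_def pcompose_add algebra_simps)

lemma pole_poly_diff [simp]: "pole_poly n (G - H) = pole_poly n G - pole_poly n H"
  by (simp add: pole_poly_def pcompose_diff algebra_simps)

lemma pole_poly_smult [simp]: "pole_poly n (reg_smult c G) = Polynomial.smult c (pole_poly n G)"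
  by (simp add: pole_poly_def reg_smult_def pcompose_smult smult_add_right)

lemma pole_poly_zero [simp]: "pole_poly n 0 = 0"
  by (simp add: pole_poly_def)

lemma degree_pcompose_square:
  "Polynomial.degree (pcompose p (Polynomial.monom (1::'a::field) 2)) = 2 * Polynomial.degree p"
  by (simp add: degree_pcompose degree_monom_eq)

lemma pcompose_square_eq_0_iff:
  "pcompose p (Polynomial.monom (1::'a::field) 2) = 0 \<longleftrightarrow> p = 0"
  by (subst pcompose_eq_0_iff) (simp_all add: degree_monom_eq)

lemma degree_add_parity:
  assumes "p \<noteq> 0" "q \<noteq> 0" "Polynomial.degree p \<noteq> Polynomial.degree q"
  shows "Polynomial.degree (p + q) = max (Polynomial.degree p) (Polynomial.degree q)"
  using assms by (metis degree_add_eq_left degree_add_eq_right linorder_neqE_nat max.absorb3 max.absorb4)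

lemma pole_order_eq:
  assumes "odd n"
  shows "pole_order n G = (if snd G = 0 then 2 * Polynomial.degree (fst G)
            else max (2 * Polynomial.degree (fst G)) (2 * Polynomial.degree (snd G) + n))"
proof -
  let ?p = "pcompose (fst G) (Polynomial.monom 1 2)"
  let ?q = "Polynomial.monom 1 n * pcompose (snd G) (Polynomial.monom 1 2)"
  have q: "?q \<noteq> 0" "Polynomial.degree ?q = n + 2 * Polynomial.degree (snd G)" if "snd G \<noteq> 0"
    using that pcompose_square_eq_0_iff[of "snd G"]
    by (simp_all add: degree_mult_eq degree_monom_eq degree_pcompose_square)
  show ?thesis
  proof (cases "snd G = 0")
    case True
    then show ?thesis by (simp add: pole_order_def pole_poly_def degree_pcompose_square)
  next
    case False
    show ?thesis
    proof (cases "fst G = 0")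
      case True
      with False q show ?thesis by (simp add: pole_order_def pole_poly_def)
    next
      case fst0: False
      have "Polynomial.degree ?p \<noteq> Polynomial.degree ?q"
        using q[OF False] assms by (simp add: degree_pcompose_square) presburger
      then have "Polynomial.degree (?p + ?q) = max (Polynomial.degree ?p) (Polynomial.degree ?q)"
        using q[OF False] fst0 pcompose_square_eq_0_iff[of "fst G"] by (intro degree_add_parity) auto
      then show ?thesis using False q
        by (simp add: pole_order_def pole_poly_def degree_pcompose_square)
    qed
  qed
qed

lemma pole_poly_eq_0_iff:
  assumes "odd n"
  shows "pole_poly n G = 0 \<longleftrightarrow> G = 0"
proof
  assume 0: "pole_poly n G = 0"
  then have "pole_order n G = 0" by (simp add: pole_order_def)
  then have s: "snd G = 0"
    using assms by (auto simp: pole_order_eq odd_pos split: if_splits)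
  with 0 pcompose_square_eq_0_iff[of "fst G"] have "fst G = 0"
    by (simp add: pole_poly_def)
  with s show "G = 0" by (simp add: prod_eq_iff)
qed auto

text \<open>
  The degrees of \<open>u\<^sup>2\<close> and \<open>f v\<^sup>2\<close> have different parity, so there is no cancellation in the norm.
\<close>

lemma degree_reg_norm:
  assumes "odd (Polynomial.degree f)"
  shows "Polynomial.degree (reg_norm f G) = pole_order (Polynomial.degree f) G"
    and "G \<noteq> 0 \<Longrightarrow> reg_norm f G \<noteq> 0"
proof -
  have f0: "f \<noteq> 0" using assms by auto
  let ?p = "fst G ^ 2" and ?q = "- (f * snd G ^ 2)"
  have p: "Polynomial.degree ?p = 2 * Polynomial.degree (fst G)" by (cases "fst G = 0") (simp_all add: degree_power_eq)
  have q: "Polynomial.degree ?q = Polynomial.degree f + 2 * Polynomial.degree (snd G)" if "snd G \<noteq> 0"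
    using that f0 by (simp add: degree_mult_eq degree_power_eq)
  have N: "reg_norm f G = ?p + ?q" by (simp add: reg_norm_def)
  have neq: "Polynomial.degree ?p \<noteq> Polynomial.degree ?q" if "snd G \<noteq> 0"
    using p q[OF that] assms by simp presburger
  show "Polynomial.degree (reg_norm f G) = pole_order (Polynomial.degree f) G"
  proof (cases "fst G = 0 \<or> snd G = 0")
    case True
    then show ?thesis using N p q assms by (auto simp: pole_order_eq)
  next
    case False
    then have "Polynomial.degree (?p + ?q) = max (Polynomial.degree ?p) (Polynomial.degree ?q)"
      using neq f0 by (intro degree_add_parity) auto
    then show ?thesis using False N p q assms by (simp add: pole_order_eq)
  qed
  show "reg_norm f G \<noteq> 0" if "G \<noteq> 0"
  proof (cases "snd G = 0")
    case True
    with that show ?thesis by (simp add: reg_norm_def prod_eq_iff)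
  next
    case False
    show ?thesis
    proof
      assume "reg_norm f G = 0"
      then have "?p = - ?q" by (simp add: reg_norm_def)
      then have "Polynomial.degree ?p = Polynomial.degree ?q" by simp
      with neq[OF False] show False by simp
    qed
  qed
qed

locale odd_curve =
  fixes f :: "'a::alg_closed_field poly" and g :: nat
  assumes two_neq_0: "(2::'a) \<noteq> 0"
    and degree_f: "Polynomial.degree f = 2 * g + 1"
    and monic_f: "Polynomial.coeff f (2 * g + 1) = 1"
    and order_f: "\<And>c. poly f c = 0 \<Longrightarrow> Polynomial.order c f = 1"
begin

abbreviation rmult :: "'a regular \<Rightarrow> 'a regular \<Rightarrow> 'a regular" (infixl "\<star>" 70) where
  "G \<star> H \<equiv> reg_mult f G H"

definition pole :: "'a regular \<Rightarrow> nat" where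
  "pole G = Polynomial.degree (reg_norm f G)"

abbreviation ppoly :: "'a regular \<Rightarrow> 'a poly" where
  "ppoly G \<equiv> pole_poly (Polynomial.degree f) G"

lemma odd_degree_f: "odd (Polynomial.degree f)"
  by (simp add: degree_f)

lemma f_neq_0: "f \<noteq> 0"
  using degree_f by auto

lemma reg_norm_eq_0_iff [simp]: "reg_norm f G = 0 \<longleftrightarrow> G = 0"
  using degree_reg_norm(2)[OF odd_degree_f, of G] by (auto simp: reg_norm_def)

lemma pole_eq_degree_ppoly: "pole G = Polynomial.degree (ppoly G)"
  using degree_reg_norm(1)[OF odd_degree_f] by (simp add: pole_def pole_order_def)

lemma ppoly_eq_0_iff [simp]: "ppoly G = 0 \<longleftrightarrow> G = 0"
  by (simp add: pole_poly_eq_0_iff odd_degree_f)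

lemma pole_eq:
  "pole G = (if snd G = 0 then 2 * Polynomial.degree (fst G)
     else max (2 * Polynomial.degree (fst G)) (2 * Polynomial.degree (snd G) + Polynomial.degree f))"
  using pole_order_eq[OF odd_degree_f, of G] by (simp add: pole_eq_degree_ppoly pole_order_def)

lemma ord_at_Infinity: "ord_at f Infinity G = - int (pole G)"
  by (simp add: pole_eq ord_at.simps)

lemma reg_mult_eq_0_iff [simp]: "G \<star> H = 0 \<longleftrightarrow> G = 0 \<or> H = 0"
  by (metis reg_norm_eq_0_iff reg_norm_mult mult_eq_0_iff)

lemma reg_mult_cancel: "G \<noteq> 0 \<Longrightarrow> G \<star> H = G \<star> L \<longleftrightarrow> H = L"
  by (metis reg_mult_diff reg_mult_eq_0_iff eq_iff_diff_eq_0)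

lemma pole_mult: "G \<noteq> 0 \<Longrightarrow> H \<noteq> 0 \<Longrightarrow> pole (G \<star> H) = pole G + pole H"
  by (simp add: pole_def reg_norm_mult degree_mult_eq)

end

section \<open>Orders of vanishing at affine points\<close>

context odd_curve
begin

text \<open>
  The condition that defines \<^const>\<open>ord_at\<close> at an affine point. Its solution \<open>n\<close> exists and is
  unique, which makes the definite description accessible.
\<close>

definition has_ord :: "'a \<Rightarrow> 'a \<Rightarrow> 'a regular \<Rightarrow> nat \<Rightarrow> bool" where
  "has_ord a b G n \<longleftrightarrow> (\<exists>H H'. reg_eval H a b \<noteq> 0 \<and> reg_eval H' a b \<noteq> 0 \<and>
     H \<star> G = reg_power f (local_param a b) n \<star> H')"

lemma has_ordI:
  "reg_eval H a b \<noteq> 0 \<Longrightarrow> reg_eval H' a b \<noteq> 0 \<Longrightarrow>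
     H \<star> G = reg_power f (local_param a b) n \<star> H' \<Longrightarrow> has_ord a b G n"
  unfolding has_ord_def by blast

lemma has_ordE:
  assumes "has_ord a b G n"
  obtains H H' where "reg_eval H a b \<noteq> 0" "reg_eval H' a b \<noteq> 0"
     "H \<star> G = reg_power f (local_param a b) n \<star> H'"
  using assms unfolding has_ord_def by blast

lemma reg_one_neq_0: "reg_one \<noteq> (0 :: 'a regular)"
  by (simp add: reg_one_def zero_prod_def)

lemma reg_power_neq_0: "G \<noteq> 0 \<Longrightarrow> reg_power f G n \<noteq> 0"
  by (induction n) (simp_all add: reg_power_Suc reg_one_neq_0)

lemma local_param_neq_0: "local_param a b \<noteq> (0 :: 'a regular)"
  by (simp add: local_param_def prod_eq_iff)

lemma reg_eval_power_local_param:
  assumes "b ^ 2 = poly f a" "n > 0"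
  shows "reg_eval (reg_power f (local_param a b) n) a b = 0"
  using assms by (cases n) (simp_all add: reg_power_Suc reg_eval_mult)

text \<open>
  From two representations with exponents \<open>n < m\<close> the common factor \<open>t ^ n\<close> can be cancelled. Then a
  function that does not vanish at the point equals one that does.
\<close>

lemma has_ord_unique_aux:
  assumes ab: "b ^ 2 = poly f a" and n: "has_ord a b G n" and m: "has_ord a b G m"
  shows "\<not> n < m"
proof
  assume "n < m"
  define t where "t = reg_power f (local_param a b)"
  obtain H H' where H: "reg_eval H a b \<noteq> 0" "reg_eval H' a b \<noteq> 0" "H \<star> G = t n \<star> H'"
    using n unfolding t_def by (rule has_ordE)
  obtain L L' where L: "reg_eval L a b \<noteq> 0" "reg_eval L' a b \<noteq> 0" "L \<star> G = t m \<star> L'"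
    using m unfolding t_def by (rule has_ordE)
  have tm: "t m = t n \<star> t (m - n)"
    using \<open>n < m\<close> by (simp add: t_def flip: reg_power_add)
  have "t n \<star> (L \<star> H') = L \<star> (H \<star> G)"
    unfolding H(3) by (rule reg_mult_left_commute)
  also have "\<dots> = H \<star> (L \<star> G)"
    by (rule reg_mult_left_commute)
  also have "\<dots> = t n \<star> (t (m - n) \<star> (H \<star> L'))"
    unfolding L(3) tm by (simp only: reg_mult_ac)
  finally have "L \<star> H' = t (m - n) \<star> (H \<star> L')"
    using reg_power_neq_0[OF local_param_neq_0[of a b], of n] by (simp add: reg_mult_cancel t_def)
  then have "reg_eval (L \<star> H') a b = 0"
    using ab \<open>n < m\<close> by (simp add: reg_eval_mult t_def reg_eval_power_local_param)
  then show False
    using ab H L by (simp add: reg_eval_mult)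
qed

lemma ord_at_eqI:
  assumes "b ^ 2 = poly f a" "has_ord a b G n"
  shows "ord_at f (Affine a b) G = int n"
proof -
  have "has_ord a b G m \<longleftrightarrow> m = n" for m
    using has_ord_unique_aux[OF assms(1)] assms(2) by (meson linorder_neqE_nat)
  then have "(THE n. has_ord a b G n) = n"
    by simp
  then show ?thesis
    by (simp only: ord_at.simps has_ord_def)
qed

lemma has_ord_mult:
  assumes ab: "b ^ 2 = poly f a" and n: "has_ord a b G n" and m: "has_ord a b G' m"
  shows "has_ord a b (G \<star> G') (n + m)"
proof -
  obtain H H' where H: "reg_eval H a b \<noteq> 0" "reg_eval H' a b \<noteq> 0"
      "H \<star> G = reg_power f (local_param a b) n \<star> H'"
    using n by (rule has_ordE)
  obtain L L' where L: "reg_eval L a b \<noteq> 0" "reg_eval L' a b \<noteq> 0"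
      "L \<star> G' = reg_power f (local_param a b) m \<star> L'"
    using m by (rule has_ordE)
  have "(H \<star> L) \<star> (G \<star> G') = (H \<star> G) \<star> (L \<star> G')"
    by (simp add: reg_mult_ac)
  also have "\<dots> = reg_power f (local_param a b) (n + m) \<star> (H' \<star> L')"
    unfolding H(3) L(3) reg_power_add by (simp only: reg_mult_ac)
  finally show ?thesis
    using ab H L by (intro has_ordI[of "H \<star> L" _ _ "H' \<star> L'"]) (simp_all add: reg_eval_mult)
qed

lemma has_ord_0: "reg_eval G a b \<noteq> 0 \<Longrightarrow> has_ord a b G 0"
  by (rule has_ordI[of reg_one _ _ G]) simp_all

lemma has_ord_power:
  assumes "b ^ 2 = poly f a" "has_ord a b G n"
  shows "has_ord a b (reg_power f G k) (k * n)"
  using assms by (induction k) (simp_all add: reg_power_Suc has_ord_0 has_ord_mult)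

lemma has_ord_local_param: "has_ord a b (local_param a b) 1"
  by (rule has_ordI[of reg_one _ _ reg_one]) (simp_all add: reg_power_Suc)

text \<open>The ramification index of the double cover \<open>(x, y) \<mapsto> x\<close> at a point with ordinate \<open>b\<close>.\<close>

definition ram :: "'a \<Rightarrow> nat" where
  "ram b = (if b = 0 then 2 else 1)"

lemma f_split:
  assumes "poly f a = 0"
  obtains h where "f = [:- a, 1:] * h" "poly h a \<noteq> 0"
proof -
  from assms obtain h where h: "f = [:- a, 1:] * h"
    by (auto simp: poly_eq_0_iff_dvd)
  have "h \<noteq> 0" using h f_neq_0 by auto
  have "Polynomial.order a f = Polynomial.order a [:- a, 1:] + Polynomial.order a h"
    using f_neq_0 unfolding h by (intro order_mult)
  moreover have "Polynomial.order a [:- a, 1:] = 1"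
    using order_power_n_n[of a 1] by simp
  ultimately have "Polynomial.order a h = 0"
    using order_f[OF assms] by linarith
  with \<open>h \<noteq> 0\<close> have "poly h a \<noteq> 0" by (simp add: order_root)
  with h that show thesis by blast
qed

text \<open>
  At a branch point \<open>x - a = y\<^sup>2 / h\<close>, where \<open>f = (x - a) h\<close>.
\<close>

lemma has_ord_linear:
  assumes "b ^ 2 = poly f a"
  shows "has_ord a b ([:- a, 1:], 0) (ram b)"
proof (cases "b = 0")
  case False
  then show ?thesis using has_ord_local_param[of a b] by (simp add: ram_def local_param_def)
next
  case True
  with assms obtain h where h: "f = [:- a, 1:] * h" "poly h a \<noteq> 0"
    using f_split[of a] by auto
  have "(h, 0) \<star> ([:- a, 1:], 0) = (f, 0)"
    unfolding reg_mult_poly fst_conv snd_conv mult_zero_right by (subst h(1)) (simp only: mult.commute)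
  also have "(f, 0) = reg_power f (local_param a b) (ram b) \<star> reg_one"
    using True by (simp add: ram_def local_param_def numeral_2_eq_2 reg_power_Suc reg_mult_def reg_one_def)
  finally have "(h, 0) \<star> ([:- a, 1:], 0) = reg_power f (local_param a b) (ram b) \<star> reg_one" .
  with h True show ?thesis
    by (intro has_ordI[of "(h, 0)" _ _ reg_one]) simp_all
qed

lemma has_ord_poly:
  assumes "b ^ 2 = poly f a" "p \<noteq> 0"
  shows "has_ord a b (p, 0) (ram b * Polynomial.order a p)"
proof -
  obtain q where q: "p = [:- a, 1:] ^ Polynomial.order a p * q" "\<not> [:- a, 1:] dvd q"
    using order_decomp[OF assms(2)] by blast
  have "(p, 0) = reg_power f ([:- a, 1:], 0) (Polynomial.order a p) \<star> (q, 0)"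
    using q(1) by (simp add: reg_power_poly reg_mult_def)
  moreover have "has_ord a b (q, 0) 0"
    using q(2) by (intro has_ord_0) (simp add: poly_eq_0_iff_dvd)
  ultimately show ?thesis
    using has_ord_mult[OF assms(1) has_ord_power[OF assms(1) has_ord_linear[OF assms(1)]], of "(q, 0)" 0]
    by (metis add_0_right mult.commute)
qed

text \<open>
  Let \<open>G = u + v y\<close> vanish at the point, but not have the factor \<open>x - a\<close>. If \<open>b \<noteq> 0\<close>, then the conjugate
  of \<open>G\<close> does not vanish there, and \<open>G\<close> is the norm divided by the conjugate. If \<open>b = 0\<close>, then \<open>u\<close> is
  divisible by \<open>x - a\<close>, hence by \<open>y\<^sup>2\<close> up to a unit, and \<open>G\<close> is \<open>y\<close> times a unit.
\<close>

lemma has_ord_exists_primitive: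
  assumes ab: "b ^ 2 = poly f a" and prim: "poly (fst G) a \<noteq> 0 \<or> poly (snd G) a \<noteq> 0"
  shows "\<exists>n. has_ord a b G n"
proof (cases "reg_eval G a b = 0")
  case False
  then show ?thesis using has_ord_0 by blast
next
  case ev: True
  have G0: "G \<noteq> 0" using prim by auto
  show ?thesis
  proof (cases "b = 0")
    case b: False
    have "reg_eval (reg_conj G) a b \<noteq> 0"
    proof
      assume 0: "reg_eval (reg_conj G) a b = 0"
      have "2 * poly (fst G) a = reg_eval G a b + reg_eval (reg_conj G) a b"
        by (simp add: reg_eval_def reg_conj_def)
      moreover have "2 * (poly (snd G) a * b) = reg_eval G a b - reg_eval (reg_conj G) a b"
        by (simp add: reg_eval_def reg_conj_def)
      ultimately show False using ev 0 prim b two_neq_0 by simp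
    qed
    moreover have "has_ord a b (reg_norm f G, 0) (ram b * Polynomial.order a (reg_norm f G))"
      using G0 by (intro has_ord_poly[OF ab]) simp
    then obtain H H' where H: "reg_eval H a b \<noteq> 0" "reg_eval H' a b \<noteq> 0"
        "H \<star> (reg_norm f G, 0) = reg_power f (local_param a b) (ram b * Polynomial.order a (reg_norm f G)) \<star> H'"
      by (rule has_ordE)
    ultimately have "has_ord a b G (ram b * Polynomial.order a (reg_norm f G))"
      using ab
      by (intro has_ordI[of "H \<star> reg_conj G" _ _ H']) (simp_all add: reg_eval_mult reg_mult_assoc reg_mult_conj)
    then show ?thesis by blast
  next
    case b: True
    with ab obtain h where h: "f = [:- a, 1:] * h" "poly h a \<noteq> 0"
      using f_split[of a] by auto
    from b ev have u: "poly (fst G) a = 0" by (simp add: reg_eval_def)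
    then obtain u2 where u2: "fst G = [:- a, 1:] * u2" by (auto simp: poly_eq_0_iff_dvd)
    have "h * fst G = f * u2"
      by (subst u2, subst h(1)) (simp only: mult_ac)
    then have "(h, 0) \<star> G = (0, 1) \<star> (h * snd G, u2)"
      by (simp add: reg_mult_def)
    also have "(0, 1) = reg_power f (local_param a b) 1"
      using b by (simp add: reg_power_Suc) (simp add: local_param_def)
    finally have "(h, 0) \<star> G = reg_power f (local_param a b) 1 \<star> (h * snd G, u2)" .
    then have "has_ord a b G 1"
      using b h(2) prim u by (intro has_ordI[of "(h, 0)" _ _ "(h * snd G, u2)"]) (simp_all add: reg_eval_def)
    then show ?thesis by blast
  qed
qed

lemma has_ord_exists:
  assumes ab: "b ^ 2 = poly f a" and "G \<noteq> 0"
  shows "\<exists>n. has_ord a b G n"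
  using assms(2)
proof (induction "pole G" arbitrary: G rule: less_induct)
  case less
  show ?case
  proof (cases "poly (fst G) a \<noteq> 0 \<or> poly (snd G) a \<noteq> 0")
    case True
    then show ?thesis using has_ord_exists_primitive[OF ab] by blast
  next
    case False
    then have "[:- a, 1:] dvd fst G" "[:- a, 1:] dvd snd G"
      by (simp_all add: poly_eq_0_iff_dvd)
    then obtain u v where uv: "fst G = [:- a, 1:] * u" "snd G = [:- a, 1:] * v"
      unfolding dvd_def by blast
    have G: "G = ([:- a, 1:], 0) \<star> (u, v)"
      using uv by (simp add: reg_mult_poly prod_eq_iff)
    have uv0: "(u, v) \<noteq> 0" using G less.prems by auto
    have "pole ([:- a, 1:], 0) = 2" by (simp add: pole_eq)
    then have "pole (u, v) < pole G"
      using uv0 unfolding G by (subst pole_mult) (simp_all add: zero_prod_def)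
    with less.hyps uv0 obtain n where "has_ord a b (u, v) n" by blast
    with has_ord_mult[OF ab has_ord_linear[OF ab]] G show ?thesis by metis
  qed
qed

lemma has_ord_ord_at:
  assumes "b ^ 2 = poly f a" "G \<noteq> 0"
  shows "has_ord a b G (nat (ord_at f (Affine a b) G))"
  using has_ord_exists[OF assms] ord_at_eqI[OF assms(1)] by fastforce

lemma ord_at_affine_nonneg:
  assumes "b ^ 2 = poly f a" "G \<noteq> 0"
  shows "ord_at f (Affine a b) G \<ge> 0"
  using has_ord_exists[OF assms] ord_at_eqI[OF assms(1)] by fastforce

lemma curve_iff [simp]: "Affine a b \<in> curve f \<longleftrightarrow> b ^ 2 = poly f a" "Infinity \<in> curve f"
  by (auto simp: curve_def)

lemma ord_at_mult:
  assumes "P \<in> curve f" "G \<noteq> 0" "H \<noteq> 0"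
  shows "ord_at f P (G \<star> H) = ord_at f P G + ord_at f P H"
proof (cases P)
  case (Affine a b)
  with assms have ab: "b ^ 2 = poly f a" by simp
  from has_ord_exists[OF ab] assms obtain n m where "has_ord a b G n" "has_ord a b H m" by metis
  with has_ord_mult[OF ab] show ?thesis
    unfolding Affine by (metis ord_at_eqI[OF ab] of_nat_add)
next
  case Infinity
  show ?thesis
    unfolding Infinity ord_at_Infinity using assms by (simp add: pole_mult)
qed

lemma ord_at_eq_0_iff:
  assumes "b ^ 2 = poly f a" "G \<noteq> 0"
  shows "ord_at f (Affine a b) G = 0 \<longleftrightarrow> reg_eval G a b \<noteq> 0"
proof
  assume "reg_eval G a b \<noteq> 0"
  then show "ord_at f (Affine a b) G = 0"
    using ord_at_eqI[OF assms(1) has_ord_0] by simp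
next
  assume "ord_at f (Affine a b) G = 0"
  then have "has_ord a b G 0" using has_ord_ord_at[OF assms] by simp
  then obtain H H' where H: "reg_eval H a b \<noteq> 0" "reg_eval H' a b \<noteq> 0" "H \<star> G = H'"
    by (elim has_ordE) simp
  then show "reg_eval G a b \<noteq> 0" using reg_eval_mult[OF assms(1), of H G] by auto
qed

lemma ord_at_poly:
  assumes "b ^ 2 = poly f a" "p \<noteq> 0"
  shows "ord_at f (Affine a b) (p, 0) = int (ram b * Polynomial.order a p)"
  using ord_at_eqI[OF assms(1) has_ord_poly[OF assms]] .

lemma ord_at_local_param:
  "b ^ 2 = poly f a \<Longrightarrow> ord_at f (Affine a b) (local_param a b) = 1"
  using ord_at_eqI[OF _ has_ord_local_param] by simp

lemma ord_at_power:
  assumes "P \<in> curve f" "G \<noteq> 0"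
  shows "ord_at f P (reg_power f G n) = int n * ord_at f P G"
proof (induction n)
  case 0
  have "ord_at f P reg_one = ord_at f P reg_one + ord_at f P reg_one"
    using ord_at_mult[OF assms(1), of reg_one reg_one] by (simp add: reg_one_neq_0)
  then show ?case by simp
next
  case (Suc n)
  then show ?case
    using assms by (simp add: reg_power_Suc ord_at_mult reg_power_neq_0 algebra_simps)
qed

lemma reg_conj_one: "reg_conj reg_one = (reg_one :: 'a regular)"
  by (simp add: reg_conj_def reg_one_def)

lemma ord_at_conj:
  assumes ab: "b ^ 2 = poly f a" and G: "G \<noteq> 0"
  shows "ord_at f (Affine a b) (reg_conj G) = ord_at f (Affine a (- b)) G"
proof -
  obtain n where n: "has_ord a (- b) G n" using has_ord_exists[of "- b" a G] assms by auto
  then obtain H H' where H: "reg_eval H a (- b) \<noteq> 0" "reg_eval H' a (- b) \<noteq> 0"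
    "H \<star> G = reg_power f (local_param a (- b)) n \<star> H'" by (rule has_ordE)
  obtain s where s: "reg_conj (local_param a (- b)) = local_param a b \<star> s" "reg_eval s a b \<noteq> 0"
  proof (cases "b = 0")
    case True
    show thesis
      by (rule that[of "(-1, 0)"]) (use True in \<open>simp_all add: reg_conj_def local_param_def reg_mult_def reg_eval_def\<close>)
  next
    case False
    show thesis
      by (rule that[of reg_one]) (use False in \<open>simp_all add: reg_conj_def local_param_def\<close>)
  qed
  have sn: "reg_eval (reg_power f s n) a b \<noteq> 0" for n
    using s(2) ab by (induction n) (simp_all add: reg_power_Suc reg_eval_mult)
  have pw: "reg_conj (reg_power f (local_param a (- b)) n) = reg_power f (local_param a b \<star> s) n" for n
    by (induction n) (simp_all add: reg_power_Suc reg_conj_mult s(1) reg_conj_one)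
  have "reg_conj H \<star> reg_conj G = reg_power f (local_param a b) n \<star> (reg_power f s n \<star> reg_conj H')"
    by (simp add: H(3) reg_conj_mult[symmetric]) (simp add: reg_conj_mult pw reg_power_mult reg_mult_assoc)
  then have "has_ord a b (reg_conj G) n"
    using H sn ab
    by (intro has_ordI[of "reg_conj H" _ _ "reg_power f s n \<star> reg_conj H'"])
       (simp_all add: reg_eval_conj reg_eval_mult)
  with n ab show ?thesis by (simp add: ord_at_eqI)
qed

lemma ord_at_norm:
  assumes ab: "b ^ 2 = poly f a" and G: "G \<noteq> 0"
  shows "ord_at f (Affine a b) G + ord_at f (Affine a (- b)) G =
         int (ram b * Polynomial.order a (reg_norm f G))"
proof -
  have "ord_at f (Affine a b) (reg_conj G \<star> G) = int (ram b * Polynomial.order a (reg_norm f G))"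
    unfolding reg_mult_conj using G by (intro ord_at_poly[OF ab]) simp
  then show ?thesis using assms by (simp add: ord_at_mult ord_at_conj)
qed

text \<open>
  If \<open>H Z = t^k Y\<close> with a unit \<open>H\<close> and a local parameter \<open>t\<close>, then \<open>Z\<close> vanishes to order \<open>k\<close>,
  and to a higher order if \<open>Y\<close> vanishes.
\<close>

lemma ord_at_geI:
  assumes ab: "b ^ 2 = poly f a" and Z: "Z \<noteq> 0" and H: "reg_eval H a b \<noteq> 0"
    and eq: "H \<star> Z = reg_power f (local_param a b) k \<star> Y"
  shows "ord_at f (Affine a b) Z \<ge> int k"
    and "reg_eval Y a b = 0 \<Longrightarrow> ord_at f (Affine a b) Z > int k"
proof -
  have H0: "H \<noteq> 0" using H by auto
  have Y0: "Y \<noteq> 0" using eq Z H0 by auto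
  have "ord_at f (Affine a b) (H \<star> Z) = ord_at f (Affine a b) Z"
    using ab Z H H0 by (simp add: ord_at_mult ord_at_eq_0_iff)
  moreover have "ord_at f (Affine a b) (reg_power f (local_param a b) k \<star> Y) = int k + ord_at f (Affine a b) Y"
    using ab Y0 local_param_neq_0
    by (simp add: ord_at_mult reg_power_neq_0 ord_at_power ord_at_local_param)
  ultimately have *: "ord_at f (Affine a b) Z = int k + ord_at f (Affine a b) Y"
    using eq by simp
  with ord_at_affine_nonneg[OF ab Y0] show "ord_at f (Affine a b) Z \<ge> int k" by simp
  show "ord_at f (Affine a b) Z > int k" if "reg_eval Y a b = 0"
    using that * ord_at_affine_nonneg[OF ab Y0] ord_at_eq_0_iff[OF ab Y0] by simp
qed

lemma ord_geE:
  assumes ab: "b ^ 2 = poly f a" and G: "G = 0 \<or> ord_at f (Affine a b) G \<ge> int k"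
  obtains H H' where "reg_eval H a b \<noteq> 0" "H \<star> G = reg_power f (local_param a b) k \<star> H'"
proof (cases "G = 0")
  case True
  then show ?thesis using that[of reg_one 0] by simp
next
  case False
  define n where "n = nat (ord_at f (Affine a b) G)"
  have n: "n = k + (n - k)" using G False by (simp add: n_def)
  obtain H H' where H: "reg_eval H a b \<noteq> 0" "H \<star> G = reg_power f (local_param a b) n \<star> H'"
    using has_ord_ord_at[OF ab False] unfolding n_def by (rule has_ordE)
  have "H \<star> G = reg_power f (local_param a b) k \<star> (reg_power f (local_param a b) (n - k) \<star> H')"
    unfolding H(2) by (subst n) (simp only: reg_power_add reg_mult_assoc)
  with H that show thesis by blast
qed

lemma ord_at_add:
  assumes ab: "b ^ 2 = poly f a" and ne: "G + G' \<noteq> 0"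
    and G: "G = 0 \<or> ord_at f (Affine a b) G \<ge> int k" and G': "G' = 0 \<or> ord_at f (Affine a b) G' \<ge> int k"
  shows "ord_at f (Affine a b) (G + G') \<ge> int k"
proof -
  obtain H H' where H: "reg_eval H a b \<noteq> 0" "H \<star> G = reg_power f (local_param a b) k \<star> H'"
    using ord_geE[OF ab G] .
  obtain L L' where L: "reg_eval L a b \<noteq> 0" "L \<star> G' = reg_power f (local_param a b) k \<star> L'"
    using ord_geE[OF ab G'] .
  have "(H \<star> L) \<star> (G + G') = L \<star> (H \<star> G) + H \<star> (L \<star> G')"
    by (simp only: reg_mult_add reg_mult_ac)
  also have "\<dots> = reg_power f (local_param a b) k \<star> (L \<star> H' + H \<star> L')"
    unfolding H(2) L(2) by (simp only: reg_mult_add reg_mult_ac)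
  finally have "(H \<star> L) \<star> (G + G') = reg_power f (local_param a b) k \<star> (L \<star> H' + H \<star> L')" .
  with _ show ?thesis
    by (rule ord_at_geI(1)[OF ab ne]) (use ab H L in \<open>simp add: reg_eval_mult\<close>)
qed

lemma reg_smult_alt: "reg_smult c G = ([:c:], 0) \<star> G"
  by (simp add: reg_smult_def reg_mult_poly)

lemma reg_smult_eq_0_iff [simp]: "reg_smult c G = 0 \<longleftrightarrow> c = 0 \<or> G = (0 :: 'a regular)"
  by (auto simp: reg_smult_def prod_eq_iff)

lemma ord_at_const:
  assumes "P \<in> curve f" "c \<noteq> 0"
  shows "ord_at f P ([:c:], 0) = 0"
proof (cases P)
  case (Affine a b)
  then show ?thesis using assms ord_at_eq_0_iff[of b a "([:c:], 0)"] by (simp add: zero_prod_def)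
next
  case Infinity
  then show ?thesis by (simp add: ord_at_Infinity pole_eq)
qed

lemma ord_at_smult:
  "P \<in> curve f \<Longrightarrow> c \<noteq> 0 \<Longrightarrow> G \<noteq> 0 \<Longrightarrow> ord_at f P (reg_smult c G) = ord_at f P G"
  unfolding reg_smult_alt by (simp add: ord_at_mult ord_at_const zero_prod_def)

text \<open>Two functions of the same order have, at the given point, proportional leading terms.\<close>

lemma ord_at_cancel:
  assumes ab: "b ^ 2 = poly f a" and G: "G \<noteq> 0" and G': "G' \<noteq> 0"
    and eq: "ord_at f (Affine a b) G = int k" "ord_at f (Affine a b) G' = int k"
  shows "\<exists>c. c \<noteq> 0 \<and> (G' - reg_smult c G = 0 \<or> ord_at f (Affine a b) (G' - reg_smult c G) > int k)"
proof -
  obtain H H' where H: "reg_eval H a b \<noteq> 0" "reg_eval H' a b \<noteq> 0" "H \<star> G = reg_power f (local_param a b) k \<star> H'"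
    using has_ord_ord_at[OF ab G] eq(1) by (elim has_ordE) simp
  obtain L L' where L: "reg_eval L a b \<noteq> 0" "reg_eval L' a b \<noteq> 0" "L \<star> G' = reg_power f (local_param a b) k \<star> L'"
    using has_ord_ord_at[OF ab G'] eq(2) by (elim has_ordE) simp
  define c where "c = (reg_eval H a b * reg_eval L' a b) / (reg_eval L a b * reg_eval H' a b)"
  have "(H \<star> L) \<star> (G' - reg_smult c G) = H \<star> (L \<star> G') - ([:c:], 0) \<star> (L \<star> (H \<star> G))"
    by (simp only: reg_mult_diff reg_smult_alt reg_mult_ac)
  also have "\<dots> = reg_power f (local_param a b) k \<star> (H \<star> L' - ([:c:], 0) \<star> (L \<star> H'))"
    unfolding H(3) L(3) by (simp only: reg_mult_diff reg_mult_ac)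
  finally have eq: "(H \<star> L) \<star> (G' - reg_smult c G) = reg_power f (local_param a b) k \<star> (H \<star> L' - ([:c:], 0) \<star> (L \<star> H'))" .
  have "reg_eval (H \<star> L' - ([:c:], 0) \<star> (L \<star> H')) a b = 0"
    using ab H L by (simp add: reg_eval_mult c_def)
  then have "G' - reg_smult c G = 0 \<or> ord_at f (Affine a b) (G' - reg_smult c G) > int k"
    using ord_at_geI(2)[OF ab _ _ eq] H L ab by (auto simp: reg_eval_mult)
  moreover have "c \<noteq> 0" using H L by (simp add: c_def)
  ultimately show ?thesis by blast
qed

lemma ord_at_le_imp_local_multiple:
  assumes ab: "b ^ 2 = poly f a" and G: "G \<noteq> 0" and L: "L \<noteq> 0"
    and le: "ord_at f (Affine a b) L \<le> ord_at f (Affine a b) G"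
  shows "\<exists>H H'. reg_eval H a b \<noteq> 0 \<and> H \<star> G = H' \<star> L"
proof -
  define k where "k = nat (ord_at f (Affine a b) L)"
  have "G = 0 \<or> ord_at f (Affine a b) G \<ge> int k"
    using le ord_at_affine_nonneg[OF ab L] by (simp add: k_def)
  then obtain H H' where H: "reg_eval H a b \<noteq> 0" "H \<star> G = reg_power f (local_param a b) k \<star> H'"
    by (rule ord_geE[OF ab])
  obtain M M' where M: "reg_eval M a b \<noteq> 0" "reg_eval M' a b \<noteq> 0" "M \<star> L = reg_power f (local_param a b) k \<star> M'"
    using has_ord_ord_at[OF ab L] unfolding k_def by (elim has_ordE)
  have "(M' \<star> H) \<star> G = H' \<star> (reg_power f (local_param a b) k \<star> M')"
    unfolding reg_mult_assoc H(2) by (simp add: reg_mult_ac)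
  also have "\<dots> = (H' \<star> M) \<star> L"
    by (simp only: M(3)[symmetric] reg_mult_assoc)
  finally show ?thesis using H M ab by (metis reg_eval_mult mult_eq_0_iff)
qed

end

section \<open>Passing from local to global divisibility\<close>

context odd_curve
begin

definition reg_submodule :: "'a regular set \<Rightarrow> bool" where
  "reg_submodule J \<longleftrightarrow> 0 \<in> J \<and> (\<forall>G\<in>J. \<forall>H\<in>J. G + H \<in> J) \<and> (\<forall>G\<in>J. \<forall>H. H \<star> G \<in> J)"

lemma obtain_ordinate:
  obtains d where "d ^ 2 = poly f c"
  using nth_root_exists[of 2 "poly f c"] by auto

lemma poly_reg_norm:
  assumes "d ^ 2 = poly f c"
  shows "poly (reg_norm f G) c = reg_eval G c d * reg_eval G c (- d)"
  using assms[symmetric] by (simp add: reg_norm_def reg_eval_def power2_eq_square algebra_simps)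

text \<open>
  A Nullstellensatz for the affine curve. Let \<open>p\<close> generate the intersection of the ideal with
  \<open>K[x]\<close>. Above a root \<open>c\<close> of \<open>p\<close> lie at most two points, and a suitable sum of elements of
  the ideal vanishes at neither of them; the norm of this sum is a multiple of \<open>p\<close> that does not
  vanish at \<open>c\<close>.
\<close>

lemma ideal_without_zeros:
  assumes J: "reg_submodule J"
    and nz: "\<And>a b. b ^ 2 = poly f a \<Longrightarrow> \<exists>h\<in>J. reg_eval h a b \<noteq> 0"
  shows "reg_one \<in> J"
proof -
  have add: "G + H \<in> J" if "G \<in> J" "H \<in> J" for G H using J that by (auto simp: reg_submodule_def)
  have mul: "H \<star> G \<in> J" if "G \<in> J" for G H using J that by (auto simp: reg_submodule_def)
  have norm: "(reg_norm f h, 0) \<in> J" if "h \<in> J" for h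
    using mul[OF that, of "reg_conj h"] by (simp add: reg_mult_conj)
  define Q where "Q p \<longleftrightarrow> p \<noteq> 0 \<and> (p, 0) \<in> J" for p
  obtain d where d: "d ^ 2 = poly f 0" by (rule obtain_ordinate)
  from nz[OF d] obtain h where h: "h \<in> J" "h \<noteq> 0" by (metis reg_eval_zero)
  then have "Q (reg_norm f h)" using norm by (simp add: Q_def)
  then obtain p where p: "Q p" and min: "\<And>q. Q q \<Longrightarrow> Polynomial.degree p \<le> Polynomial.degree q"
    using ex_has_least_nat[of Q _ Polynomial.degree] by blast
  have dvd: "p dvd q" if q: "(q, 0) \<in> J" for q
  proof (rule ccontr)
    assume ndvd: "\<not> p dvd q"
    have "(q mod p, 0) = (q, 0) + (- (q div p), 0) \<star> (p, 0)"
      by (simp add: reg_mult_def minus_mult_div_eq_mod mult.commute flip: diff_conv_add_uminus)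
    then have "(q mod p, 0) \<in> J" using p q add mul by (simp add: Q_def)
    moreover have "q mod p \<noteq> 0" using ndvd by (simp add: dvd_eq_mod_eq_0)
    ultimately have "Polynomial.degree p \<le> Polynomial.degree (q mod p)" by (intro min) (simp add: Q_def)
    moreover have "Polynomial.degree (q mod p) < Polynomial.degree p"
      using \<open>q mod p \<noteq> 0\<close> p by (intro degree_mod_less') (auto simp: Q_def)
    ultimately show False by simp
  qed
  have "Polynomial.degree p = 0"
  proof (rule ccontr)
    assume "Polynomial.degree p \<noteq> 0"
    then obtain c where c: "poly p c = 0" using alg_closed_imp_poly_has_root by blast
    obtain d where d: "d ^ 2 = poly f c" by (rule obtain_ordinate)
    then have d': "(- d) ^ 2 = poly f c" by simp
    obtain h1 where h1: "h1 \<in> J" "reg_eval h1 c d \<noteq> 0" using nz[OF d] by blast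
    obtain h2 where h2: "h2 \<in> J" "reg_eval h2 c (- d) \<noteq> 0" using nz[OF d'] by blast
    obtain h where h: "h \<in> J" "reg_eval h c d \<noteq> 0" "reg_eval h c (- d) \<noteq> 0"
    proof (cases "reg_eval h1 c (- d) \<noteq> 0")
      case True
      with h1 that show thesis by blast
    next
      case False
      show thesis
      proof (cases "reg_eval h2 c d \<noteq> 0")
        case True
        with h2 that show thesis by blast
      next
        case f2: False
        show thesis
          by (rule that[of "h1 + h2"]) (use h1 h2 False f2 add in auto)
      qed
    qed
    have "poly (reg_norm f h) c \<noteq> 0" using h by (simp add: poly_reg_norm[OF d])
    moreover have "p dvd reg_norm f h" using norm[OF h(1)] by (rule dvd)
    ultimately show False using c by (auto simp: dvd_def)
  qed
  then obtain k where k: "p = [:k:]" by (rule degree_eq_zeroE)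
  have "reg_one = ([:1 / k:], 0) \<star> (p, 0)"
    using p k by (simp add: reg_one_def reg_mult_def Q_def one_pCons)
  moreover have "([:1 / k:], 0) \<star> (p, 0) \<in> J"
    using p unfolding Q_def by (intro mul) simp
  ultimately show ?thesis by simp
qed

text \<open>
  The functions \<open>h\<close> with \<open>h G \<in> J\<close> form an ideal. By the local condition it has no zero, so it
  contains 1.
\<close>

lemma local_global:
  assumes J: "reg_submodule J" and G: "G \<noteq> 0"
    and local: "\<And>a b. b ^ 2 = poly f a \<Longrightarrow>
      \<exists>L\<in>J. L \<noteq> 0 \<and> ord_at f (Affine a b) L \<le> ord_at f (Affine a b) G"
  shows "G \<in> J"
proof -
  have "reg_submodule {h. h \<star> G \<in> J}"
    using J unfolding reg_submodule_def
    by (auto simp: reg_mult_assoc reg_mult_add reg_mult_commute[of f _ G])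
       (metis reg_mult_left_commute)
  moreover have "\<exists>h\<in>{h. h \<star> G \<in> J}. reg_eval h a b \<noteq> 0" if ab: "b ^ 2 = poly f a" for a b
  proof -
    obtain L where L: "L \<in> J" "L \<noteq> 0" "ord_at f (Affine a b) L \<le> ord_at f (Affine a b) G"
      using local[OF ab] by blast
    with ord_at_le_imp_local_multiple[OF ab G] obtain H H' where "reg_eval H a b \<noteq> 0" "H \<star> G = H' \<star> L"
      by blast
    moreover have "H' \<star> L \<in> J" using L J by (simp add: reg_submodule_def)
    ultimately show ?thesis by (intro bexI[of _ H]) simp_all
  qed
  ultimately have "reg_one \<in> {h. h \<star> G \<in> J}" by (rule ideal_without_zeros)
  then show ?thesis by simp
qed

lemma reg_dvd_if_ord_le:
  assumes G: "G \<noteq> 0" and H: "H \<noteq> 0"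
    and le: "\<And>a b. b ^ 2 = poly f a \<Longrightarrow> ord_at f (Affine a b) H \<le> ord_at f (Affine a b) G"
  obtains L where "G = H \<star> L"
proof -
  have "reg_submodule (range (rmult H))"
    unfolding reg_submodule_def
  proof (intro conjI ballI allI)
    show "0 \<in> range (rmult H)" by (rule range_eqI[of _ _ 0]) simp
  next
    fix G L assume "G \<in> range (rmult H)" "L \<in> range (rmult H)"
    then obtain G' L' where "G = H \<star> G'" "L = H \<star> L'" by blast
    then show "G + L \<in> range (rmult H)" by (intro range_eqI[of _ _ "G' + L'"]) (simp add: reg_mult_add)
  next
    fix G L assume "G \<in> range (rmult H)"
    then obtain G' where "G = H \<star> G'" by blast
    then show "L \<star> G \<in> range (rmult H)"
      by (intro range_eqI[of _ _ "L \<star> G'"]) (simp add: reg_mult_left_commute)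
  qed
  moreover have "H \<in> range (rmult H)" by (rule range_eqI[of _ _ reg_one]) simp
  ultimately have "G \<in> range (rmult H)"
    using assms by (intro local_global) blast+
  with that show thesis by blast
qed

end

section \<open>Divisors of functions\<close>

abbreviation mult_at :: "('a point \<Rightarrow>\<^sub>0 int) \<Rightarrow> 'a point \<Rightarrow> int" where
  "mult_at \<equiv> Poly_Mapping.lookup"

lemma div_degree_eq_sum:
  assumes "finite S" "Poly_Mapping.keys D \<subseteq> S"
  shows "div_degree D = (\<Sum>P\<in>S. mult_at D P)"
  unfolding div_degree_def using assms by (intro sum.mono_neutral_left) (auto simp: in_keys_iff)

lemma div_degree_add [simp]: "div_degree (D + E) = div_degree D + div_degree E"
proof -
  let ?S = "Poly_Mapping.keys D \<union> Poly_Mapping.keys E"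
  have "Poly_Mapping.keys (D + E) \<subseteq> ?S" by (rule Poly_Mapping.keys_add)
  then show ?thesis by (simp add: div_degree_eq_sum[of ?S] lookup_add sum.distrib)
qed

lemma keys_minus: "Poly_Mapping.keys (- D) = Poly_Mapping.keys (D :: 'b \<Rightarrow>\<^sub>0 int)"
  by (auto simp: in_keys_iff)

lemma div_degree_uminus [simp]: "div_degree (- D) = - div_degree D"
  by (simp add: div_degree_def sum_negf keys_minus)

lemma div_degree_diff [simp]: "div_degree (D - E) = div_degree D - div_degree E"
  using div_degree_add[of D "- E"] by simp

lemma div_degree_frag_of [simp]: "div_degree (frag_of P) = 1"
  by (simp add: div_degree_def)

lemma div_degree_0 [simp]: "div_degree 0 = 0"
  by (simp add: div_degree_def)

lemma div_degree_frag_cmul [simp]: "div_degree (frag_cmul k D) = k * div_degree D"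
  using keys_cmul[of k D] by (subst div_degree_eq_sum[of "Poly_Mapping.keys D"])
    (simp_all add: div_degree_def sum_distrib_left)

fun point_conj :: "'a::field point \<Rightarrow> 'a point" where
  "point_conj (Affine a b) = Affine a (- b)"
| "point_conj Infinity = Infinity"

lemma point_conj_conj [simp]: "point_conj (point_conj P) = P"
  by (cases P) auto

context odd_curve
begin

text \<open>
  The principal divisor of a function. Only finitely many orders are nonzero, since the norm of
  the function has finitely many roots.
\<close>

definition dv :: "'a regular \<Rightarrow> 'a point \<Rightarrow>\<^sub>0 int" where
  "dv G = Abs_poly_mapping (\<lambda>P. if P \<in> curve f then ord_at f P G else 0)"

lemma finite_ordinates: "finite {d::'a. d ^ 2 = e}"
proof -
  have "{d. d ^ 2 = e} = {d. poly [:- e, 0, 1:] d = 0}"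
    by (auto simp: power2_eq_square algebra_simps)
  then show ?thesis using poly_roots_finite[of "[:- e, 0, 1:]"] by simp
qed

lemma finite_ord_at_neq_0:
  assumes "G \<noteq> 0"
  shows "finite {P \<in> curve f. ord_at f P G \<noteq> 0}"
proof (rule finite_subset)
  show "{P \<in> curve f. ord_at f P G \<noteq> 0} \<subseteq>
    {Infinity} \<union> (\<Union>c\<in>{c. poly (reg_norm f G) c = 0}. Affine c ` {d. d ^ 2 = poly f c})"
  proof
    fix P assume P: "P \<in> {P \<in> curve f. ord_at f P G \<noteq> 0}"
    show "P \<in> {Infinity} \<union> (\<Union>c\<in>{c. poly (reg_norm f G) c = 0}. Affine c ` {d. d ^ 2 = poly f c})"
    proof (cases P)
      case (Affine a b)
      with P have ab: "b ^ 2 = poly f a" and "ord_at f (Affine a b) G \<noteq> 0" by auto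
      then have "poly (reg_norm f G) a = 0"
        using assms by (simp add: ord_at_eq_0_iff poly_reg_norm[OF ab])
      then show ?thesis using Affine ab by blast
    qed auto
  qed
  show "finite ({Infinity} \<union> (\<Union>c\<in>{c. poly (reg_norm f G) c = 0}. Affine c ` {d. d ^ 2 = poly f c}))"
    using assms by (intro finite_UnI finite_UN_I finite_imageI finite_ordinates poly_roots_finite) auto
qed

lemma lookup_dv:
  assumes "G \<noteq> 0"
  shows "mult_at (dv G) P = (if P \<in> curve f then ord_at f P G else 0)"
proof -
  have "{P. (if P \<in> curve f then ord_at f P G else 0) \<noteq> 0} = {P \<in> curve f. ord_at f P G \<noteq> 0}" by auto
  then have "finite {P. (if P \<in> curve f then ord_at f P G else 0) \<noteq> 0}"
    using finite_ord_at_neq_0[OF assms] by simp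
  then show ?thesis unfolding dv_def by (simp add: Abs_poly_mapping_inverse)
qed

lemma keys_dv: "G \<noteq> 0 \<Longrightarrow> Poly_Mapping.keys (dv G) \<subseteq> curve f"
  by (auto simp: in_keys_iff lookup_dv split: if_splits)

lemma dv_mult: "G \<noteq> 0 \<Longrightarrow> H \<noteq> 0 \<Longrightarrow> dv (G \<star> H) = dv G + dv H"
  by (rule poly_mapping_eqI) (simp add: lookup_dv lookup_add ord_at_mult)

lemma lookup_dv_Infinity: "G \<noteq> 0 \<Longrightarrow> mult_at (dv G) Infinity = - int (pole G)"
  by (simp add: lookup_dv ord_at_Infinity)

lemma lookup_dv_nonneg: "G \<noteq> 0 \<Longrightarrow> P \<noteq> Infinity \<Longrightarrow> mult_at (dv G) P \<ge> 0"
  by (cases P) (auto simp: lookup_dv ord_at_affine_nonneg)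

lemma dv_smult: "c \<noteq> 0 \<Longrightarrow> G \<noteq> 0 \<Longrightarrow> dv (reg_smult c G) = dv G"
  by (rule poly_mapping_eqI) (simp add: lookup_dv ord_at_smult)

lemma lookup_dv_conj:
  "G \<noteq> 0 \<Longrightarrow> mult_at (dv (reg_conj G)) P = mult_at (dv G) (point_conj P)"
  by (cases P) (auto simp: lookup_dv ord_at_conj ord_at_Infinity pole_def)

lemma div_degree_dv_conj:
  assumes "G \<noteq> 0"
  shows "div_degree (dv (reg_conj G)) = div_degree (dv G)"
proof -
  have keys: "Poly_Mapping.keys (dv (reg_conj G)) = point_conj ` Poly_Mapping.keys (dv G)"
    using assms by (force simp: in_keys_iff lookup_dv_conj image_iff intro: bexI[of _ "point_conj _"])
  have inj: "inj_on point_conj A" for A :: "'a point set"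
    by (metis inj_on_def point_conj_conj)
  show ?thesis
    unfolding div_degree_def keys sum.reindex[OF inj] using assms by (simp add: lookup_dv_conj)
qed

lemma double_neq: "(d::'a) \<noteq> 0 \<Longrightarrow> d \<noteq> - d"
  using two_neq_0 by (metis add.right_inverse mult_2 mult_eq_0_iff)

lemma dv_linear:
  assumes d: "d ^ 2 = poly f c"
  shows "dv ([:- c, 1:], 0) = frag_of (Affine c d) + frag_of (Affine c (- d)) - frag_cmul 2 (frag_of Infinity)"
proof (rule poly_mapping_eqI)
  fix P
  have ne: "([:- c, 1:], 0) \<noteq> (0 :: 'a regular)" by (simp add: zero_prod_def)
  have o: "Polynomial.order a [:- c, 1:] = (if a = c then 1 else 0)" for a
    using order_power_n_n[of c 1] by (auto intro: order_0I)
  show "mult_at (dv ([:- c, 1:], 0)) P =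
     mult_at (frag_of (Affine c d) + frag_of (Affine c (- d)) - frag_cmul 2 (frag_of Infinity)) P"
  proof (cases P)
    case (Affine a b)
    have b: "b = d \<or> b = - d" if "a = c" "b ^ 2 = poly f a"
      using that d by (metis power2_eq_iff)
    show ?thesis
      using b d double_neq[of d] double_neq[of b] unfolding Affine
      by (auto simp: lookup_dv[OF ne] ord_at_poly o lookup_add lookup_minus ram_def lookup_single when_def)
  next
    case Infinity
    then show ?thesis
      by (simp add: lookup_dv_Infinity[OF ne] lookup_add lookup_minus pole_eq lookup_single)
  qed
qed

lemma dv_const: "c \<noteq> 0 \<Longrightarrow> dv ([:c:], 0) = 0"
  by (rule poly_mapping_eqI) (simp add: lookup_dv ord_at_const zero_prod_def)

lemma div_degree_dv_poly: "p \<noteq> 0 \<Longrightarrow> div_degree (dv (p, 0)) = 0"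
proof (induction "Polynomial.degree p" arbitrary: p)
  case 0
  then obtain c where "p = [:c:]" by (metis degree_eq_zeroE)
  with 0 show ?case by (simp add: dv_const)
next
  case (Suc n)
  then obtain c where "poly p c = 0" using alg_closed_imp_poly_has_root[of p] by auto
  then obtain q where q: "p = [:- c, 1:] * q" by (auto simp: poly_eq_0_iff_dvd)
  with Suc have q0: "q \<noteq> 0" by auto
  have lin: "[:- c, 1:] \<noteq> 0" by simp
  have "Polynomial.degree p = Suc (Polynomial.degree q)"
    unfolding q degree_mult_eq[OF lin q0] by simp
  with Suc q0 have IH: "div_degree (dv (q, 0)) = 0" by simp
  obtain d where d: "d ^ 2 = poly f c" by (rule obtain_ordinate)
  have "(p, 0) = ([:- c, 1:], 0) \<star> (q, 0)" by (simp add: q reg_mult_def)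
  then have "dv (p, 0) = dv ([:- c, 1:], 0) + dv (q, 0)"
    using q0 by (simp add: dv_mult zero_prod_def)
  then show ?case by (simp add: IH dv_linear[OF d])
qed

text \<open>A function and its conjugate have divisors of the same degree, and their product is a polynomial in \<open>x\<close>.\<close>

lemma div_degree_dv:
  assumes "G \<noteq> 0"
  shows "div_degree (dv G) = 0"
proof -
  have "dv (reg_norm f G, 0) = dv (reg_conj G) + dv G"
    using assms by (simp add: dv_mult flip: reg_mult_conj)
  then have "2 * div_degree (dv G) = div_degree (dv (reg_norm f G, 0))"
    using assms by (simp add: div_degree_dv_conj)
  then show ?thesis using assms by (simp add: div_degree_dv_poly)
qed

section \<open>The group of divisor classes\<close>

lemma principal_divisors_eq:
  "principal_divisors f = {dv G - dv H | G H. G \<noteq> 0 \<and> H \<noteq> 0}"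
proof (intro equalityI subsetI)
  fix D assume "D \<in> principal_divisors f"
  then obtain G H where keys: "Poly_Mapping.keys D \<subseteq> curve f" and GH: "G \<noteq> 0" "H \<noteq> 0"
    and ord: "\<And>P. P \<in> curve f \<Longrightarrow> mult_at D P = ord_at f P G - ord_at f P H"
    unfolding principal_divisors_def zero_prod_def[symmetric] by auto
  have "D = dv G - dv H"
  proof (rule poly_mapping_eqI)
    fix P
    show "mult_at D P = mult_at (dv G - dv H) P"
      using keys GH ord by (auto simp: lookup_minus lookup_dv in_keys_iff)
  qed
  with GH show "D \<in> {dv G - dv H | G H. G \<noteq> 0 \<and> H \<noteq> 0}" by blast
next
  fix D assume "D \<in> {dv G - dv H | G H. G \<noteq> 0 \<and> H \<noteq> 0}"
  then obtain G H where GH: "G \<noteq> 0" "H \<noteq> 0" "D = dv G - dv H" by blast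
  have "Poly_Mapping.keys D \<subseteq> curve f"
    unfolding GH(3) using Poly_Mapping.keys_diff[of "dv G" "dv H"] keys_dv[OF GH(1)] keys_dv[OF GH(2)] by blast
  with GH show "D \<in> principal_divisors f"
    unfolding principal_divisors_def zero_prod_def[symmetric]
    by (simp add: lookup_minus lookup_dv) (use GH in blast)
qed

lemma principalI: "G \<noteq> 0 \<Longrightarrow> H \<noteq> 0 \<Longrightarrow> dv G - dv H \<in> principal_divisors f"
  unfolding principal_divisors_eq by blast

lemma principalE:
  assumes "D \<in> principal_divisors f"
  obtains G H where "G \<noteq> 0" "H \<noteq> 0" "D = dv G - dv H"
  using assms unfolding principal_divisors_eq by blast

lemma dv_principal: "G \<noteq> 0 \<Longrightarrow> dv G \<in> principal_divisors f"
  using principalI[of G "([:1:], 0)"] by (simp add: dv_const zero_prod_def)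

lemma principal_uminus:
  "D \<in> principal_divisors f \<Longrightarrow> - D \<in> principal_divisors f"
  by (metis minus_diff_eq principalE principalI)

lemma principal_add:
  assumes "D \<in> principal_divisors f" "E \<in> principal_divisors f"
  shows "D + E \<in> principal_divisors f"
proof -
  from assms obtain G H G' H' where *: "G \<noteq> 0" "H \<noteq> 0" "D = dv G - dv H" "G' \<noteq> 0" "H' \<noteq> 0" "E = dv G' - dv H'"
    by (elim principalE)
  then have "D + E = dv (G \<star> G') - dv (H \<star> H')" by (simp add: dv_mult)
  with * show ?thesis by (simp add: principalI)
qed

lemma principal_diff:
  "D \<in> principal_divisors f \<Longrightarrow> E \<in> principal_divisors f \<Longrightarrow> D - E \<in> principal_divisors f"
  using principal_add[OF _ principal_uminus, of D E] by simp

abbreviation Div0 :: "('a point \<Rightarrow>\<^sub>0 int) set" where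
  "Div0 \<equiv> carrier (degree0_divisors f)"

lemma Div0_iff: "D \<in> Div0 \<longleftrightarrow> Poly_Mapping.keys D \<subseteq> curve f \<and> div_degree D = 0"
  by (simp add: degree0_divisors_def)

lemma degree0_divisors_simps [simp]:
  "x \<otimes>\<^bsub>degree0_divisors f\<^esub> y = x + y" "\<one>\<^bsub>degree0_divisors f\<^esub> = 0"
  by (simp_all add: degree0_divisors_def free_Abelian_group_def)

lemma Div0_add: "D \<in> Div0 \<Longrightarrow> E \<in> Div0 \<Longrightarrow> D + E \<in> Div0"
  using Poly_Mapping.keys_add[of D E] by (auto simp: Div0_iff)

lemma Div0_uminus: "D \<in> Div0 \<Longrightarrow> - D \<in> Div0"
  by (auto simp: Div0_iff keys_minus)

lemma Div0_diff: "D \<in> Div0 \<Longrightarrow> E \<in> Div0 \<Longrightarrow> D - E \<in> Div0"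
  using Div0_add[OF _ Div0_uminus, of D E] by simp

lemma principal_subset: "principal_divisors f \<subseteq> Div0"
proof
  fix D assume "D \<in> principal_divisors f"
  then obtain G H where "G \<noteq> 0" "H \<noteq> 0" "D = dv G - dv H" by (rule principalE)
  then show "D \<in> Div0"
    using Poly_Mapping.keys_diff[of "dv G" "dv H"] keys_dv[of G] keys_dv[of H]
    by (auto simp: Div0_iff div_degree_dv)
qed

lemma dv_Div0: "G \<noteq> 0 \<Longrightarrow> dv G \<in> Div0"
  using principal_subset dv_principal by blast

lemma comm_group_degree0_divisors: "comm_group (degree0_divisors f)"
proof (rule comm_groupI)
  show "\<exists>y\<in>Div0. y \<otimes>\<^bsub>degree0_divisors f\<^esub> x = \<one>\<^bsub>degree0_divisors f\<^esub>" if "x \<in> Div0" for x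
    using that Div0_uminus by (intro bexI[of _ "- x"]) auto
qed (use Div0_add in \<open>auto simp: algebra_simps Div0_iff\<close>)

lemma normal_principal_divisors: "principal_divisors f \<lhd> degree0_divisors f"
proof -
  interpret D: comm_group "degree0_divisors f" by (rule comm_group_degree0_divisors)
  have inv: "inv\<^bsub>degree0_divisors f\<^esub> D = - D" if "D \<in> Div0" for D
    using that Div0_uminus by (intro D.inv_equality) auto
  have "subgroup (principal_divisors f) (degree0_divisors f)"
  proof (rule D.subgroupI)
    have "dv reg_one \<in> principal_divisors f" by (rule dv_principal) (rule reg_one_neq_0)
    then show "principal_divisors f \<noteq> {}" by blast
  qed (use principal_subset principal_add principal_uminus inv in auto)
  then show ?thesis by (rule D.subgroup_imp_normal)
qed

lemma carrier_jacobian: "carrier (jacobian f) = cl f ` Div0"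
  by (auto simp: jacobian_def FactGroup_def RCOSETS_def cl_def)

lemma cl_eq_iff:
  assumes "D \<in> Div0" "E \<in> Div0"
  shows "cl f D = cl f E \<longleftrightarrow> D - E \<in> principal_divisors f"
proof -
  have cl: "cl f D = {p + D |p. p \<in> principal_divisors f}" for D
    by (auto simp: cl_def r_coset_def)
  have 0: "0 \<in> principal_divisors f"
    using principal_diff[of "dv reg_one" "dv reg_one"] dv_principal reg_one_neq_0 by simp
  show ?thesis
  proof
    assume eq: "cl f D = cl f E"
    have "D \<in> cl f D" unfolding cl using 0 by force
    with eq show "D - E \<in> principal_divisors f" unfolding cl by auto
  next
    assume p: "D - E \<in> principal_divisors f"
    show "cl f D = cl f E"
    proof (intro equalityI subsetI)
      fix z assume "z \<in> cl f D"
      then obtain q where q: "q \<in> principal_divisors f" "z = q + D" unfolding cl by blast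
      then have "z = (q + (D - E)) + E" "q + (D - E) \<in> principal_divisors f"
        using principal_add p by simp_all
      then show "z \<in> cl f E" unfolding cl by blast
    next
      fix z assume "z \<in> cl f E"
      then obtain q where q: "q \<in> principal_divisors f" "z = q + E" unfolding cl by blast
      then have "z = (q - (D - E)) + D" "q - (D - E) \<in> principal_divisors f"
        using principal_diff p by simp_all
      then show "z \<in> cl f D" unfolding cl by blast
    qed
  qed
qed

lemma cl_double:
  assumes "D \<in> Div0"
  shows "cl f D [^]\<^bsub>jacobian f\<^esub> (2::nat) = cl f (D + D)"
proof -
  interpret J: group "jacobian f"
    unfolding jacobian_def by (rule normal.factorgroup_is_group[OF normal_principal_divisors])
  have D: "cl f D \<in> carrier (jacobian f)" using assms by (simp add: carrier_jacobian)
  have "cl f D [^]\<^bsub>jacobian f\<^esub> (2::nat) = cl f D \<otimes>\<^bsub>jacobian f\<^esub> cl f D"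
    using D by (simp add: numeral_2_eq_2)
  also have "\<dots> = cl f (D + D)"
    unfolding jacobian_def cl_def FactGroup_def
    using normal.rcos_sum[OF normal_principal_divisors assms assms] by simp
  finally show ?thesis .
qed

end

section \<open>Functions with prescribed zeros\<close>

context odd_curve
begin

text \<open>
  The functions that are regular on the affine curve and vanish there on \<open>A\<close>. The coefficient
  of \<open>A\<close> at infinity imposes no condition; poles there are measured separately by \<^term>\<open>pole\<close>.
\<close>

definition sections :: "('a point \<Rightarrow>\<^sub>0 int) \<Rightarrow> 'a regular set" where
  "sections A = {G. G = 0 \<or> (\<forall>a b. b ^ 2 = poly f a \<longrightarrow>
     mult_at A (Affine a b) \<le> ord_at f (Affine a b) G)}"

definition affine_nonneg :: "('a point \<Rightarrow>\<^sub>0 int) \<Rightarrow> bool" where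
  "affine_nonneg A \<longleftrightarrow> (\<forall>P. P \<noteq> Infinity \<longrightarrow> mult_at A P \<ge> 0)"

lemma sections_submodule:
  assumes "affine_nonneg A"
  shows "reg_submodule (sections A)"
  unfolding reg_submodule_def
proof (intro conjI ballI allI)
  fix G H assume GH: "G \<in> sections A" "H \<in> sections A"
  show "G + H \<in> sections A"
  proof (cases "G + H = 0")
    case False
    have "mult_at A (Affine a b) \<le> ord_at f (Affine a b) (G + H)" if ab: "b ^ 2 = poly f a" for a b
    proof -
      define k where "k = nat (mult_at A (Affine a b))"
      have k: "int k = mult_at A (Affine a b)"
        using assms by (simp add: k_def affine_nonneg_def)
      show ?thesis using GH ab False unfolding sections_def k[symmetric]
        by (intro ord_at_add) (auto simp: k)
    qed
    then show ?thesis by (simp add: sections_def)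
  qed (simp add: sections_def)
next
  fix G H assume "G \<in> sections A"
  then show "H \<star> G \<in> sections A"
    unfolding sections_def by (auto simp: ord_at_mult) (metis add_increasing ord_at_affine_nonneg)
qed (simp add: sections_def)

lemma sections_diff:
  assumes "affine_nonneg A" "G \<in> sections A" "H \<in> sections A"
  shows "G - H \<in> sections A"
proof -
  have eq: "G - H = G + ([:- 1:], 0) \<star> H"
    by (simp add: reg_mult_def prod_eq_iff)
  show ?thesis
    unfolding eq using sections_submodule[OF assms(1)] assms(2,3) by (simp add: reg_submodule_def)
qed

lemma sections_smult:
  assumes "affine_nonneg A" "G \<in> sections A"
  shows "reg_smult c G \<in> sections A"
  using sections_submodule[OF assms(1)] assms by (simp add: reg_submodule_def reg_smult_alt)

text \<open>
  The pole orders at infinity that do not occur among the sections. For \<open>A = 0\<close> these are the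
  Weierstrass gaps \<open>1, 3, \<dots>, 2 g - 1\<close>.
\<close>

definition gaps :: "('a point \<Rightarrow>\<^sub>0 int) \<Rightarrow> nat set" where
  "gaps A = {s. \<forall>G\<in>sections A. G \<noteq> 0 \<longrightarrow> pole G \<noteq> s}"

lemma gaps_0: "gaps 0 \<subseteq> (\<lambda>i. 2 * i + 1) ` {..<g}"
proof
  fix s assume s: "s \<in> gaps 0"
  have sec: "G \<in> sections 0" for G
    by (auto simp: sections_def ord_at_affine_nonneg)
  have "odd s"
  proof
    assume "even s"
    then have "pole (Polynomial.monom 1 (s div 2), 0) = s" by (simp add: pole_eq degree_monom_eq)
    with s sec show False by (auto simp: gaps_def zero_prod_def)
  qed
  then obtain i where i: "s = 2 * i + 1" by (rule oddE)
  have "i < g"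
  proof (rule ccontr)
    assume "\<not> i < g"
    then have "pole (0, Polynomial.monom 1 (i - g)) = s"
      by (simp add: pole_eq degree_monom_eq degree_f i)
    with s sec show False by (auto simp: gaps_def zero_prod_def)
  qed
  with i show "s \<in> (\<lambda>i. 2 * i + 1) ` {..<g}" by simp
qed

lemma pole_diff_less:
  assumes "pole G < pole H"
  shows "pole (H - G) = pole H" "H - G \<noteq> 0"
proof -
  show *: "pole (H - G) = pole H"
    using assms degree_add_eq_left[of "- ppoly G" "ppoly H"] by (simp add: pole_eq_degree_ppoly)
  show "H - G \<noteq> 0" using assms * by auto
qed

lemma pole_smult: "c \<noteq> 0 \<Longrightarrow> pole (reg_smult c G) = pole G"
  by (simp add: pole_eq_degree_ppoly)

text \<open>
  Imposing one more zero costs at most one pole order: of two functions whose orders at the new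
  point are both too small, a linear combination vanishes there to a higher order, and it keeps
  the larger pole order.
\<close>

lemma gaps_add_point:
  assumes A: "affine_nonneg A" and cd: "d ^ 2 = poly f c"
    and s: "s \<in> gaps (A + frag_of (Affine c d)) - gaps A" "s' \<in> gaps (A + frag_of (Affine c d)) - gaps A"
  shows "\<not> s < s'"
proof
  assume "s < s'"
  let ?A = "A + frag_of (Affine c d)"
  define k where "k = nat (mult_at A (Affine c d))"
  have k: "mult_at A (Affine c d) = int k" using A by (simp add: k_def affine_nonneg_def)
  have up: "G \<in> sections ?A" if "G \<in> sections A" "G = 0 \<or> ord_at f (Affine c d) G > int k" for G
    using that k by (auto simp: sections_def lookup_add lookup_single when_def)
  obtain G where G: "G \<in> sections A" "G \<noteq> 0" "pole G = s" using s by (auto simp: gaps_def)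
  obtain G' where G': "G' \<in> sections A" "G' \<noteq> 0" "pole G' = s'" using s by (auto simp: gaps_def)
  have ord: "ord_at f (Affine c d) H = int k" if "H \<in> sections A" "H \<noteq> 0" "pole H \<in> gaps ?A" for H
  proof -
    have "H \<notin> sections ?A" using that by (auto simp: gaps_def)
    with up that have "\<not> ord_at f (Affine c d) H > int k" by blast
    moreover have "ord_at f (Affine c d) H \<ge> int k" using that cd k unfolding sections_def by force
    ultimately show ?thesis by simp
  qed
  obtain e where e: "e \<noteq> 0" "G' - reg_smult e G = 0 \<or> ord_at f (Affine c d) (G' - reg_smult e G) > int k"
    using ord_at_cancel[OF cd G(2) G'(2) ord ord] G G' s by auto
  have "G' - reg_smult e G \<in> sections ?A"
    using e A G G' by (intro up sections_diff sections_smult) auto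
  moreover have "pole (G' - reg_smult e G) = s'" "G' - reg_smult e G \<noteq> 0"
    using pole_diff_less[of "reg_smult e G" G'] e(1) G G' \<open>s < s'\<close> by (simp_all add: pole_smult)
  ultimately show False using s by (auto simp: gaps_def)
qed

lemma effective_degree_0:
  assumes "\<And>P. mult_at A P \<ge> 0" "div_degree A = 0"
  shows "A = 0"
proof (rule poly_mapping_eqI)
  fix P
  have "\<forall>P\<in>Poly_Mapping.keys A. mult_at A P = 0"
    using assms sum_nonneg_eq_0_iff[of "Poly_Mapping.keys A" "mult_at A"]
    by (simp add: div_degree_def)
  then show "mult_at A P = mult_at 0 P" by (auto simp: in_keys_iff)
qed

lemma card_gaps:
  assumes "affine_nonneg A" "Poly_Mapping.keys A \<subseteq> curve f - {Infinity}" "div_degree A = int m"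
  shows "finite (gaps A) \<and> card (gaps A) \<le> g + m"
  using assms
proof (induction m arbitrary: A)
  case 0
  have nonneg: "mult_at A P \<ge> 0" for P
  proof (cases "P = Infinity")
    case True
    then have "P \<notin> Poly_Mapping.keys A" using 0 by blast
    then show ?thesis by (simp add: in_keys_iff)
  qed (use 0 in \<open>simp add: affine_nonneg_def\<close>)
  have "A = 0" using 0 by (intro effective_degree_0) (simp_all add: nonneg)
  then have "gaps A \<subseteq> (\<lambda>i. 2 * i + 1) ` {..<g}" using gaps_0 by simp
  then show ?case using surj_card_le[of "{..<g}" "gaps A"] finite_subset[of "gaps A"] by auto
next
  case (Suc m)
  have "Poly_Mapping.keys A \<noteq> {}" using Suc.prems(3) by (auto simp: div_degree_def)
  then obtain P where P: "P \<in> Poly_Mapping.keys A" by blast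
  then obtain c d where cd: "P = Affine c d" "d ^ 2 = poly f c"
    using Suc.prems(2) by (cases P) auto
  have pos: "mult_at A P > 0"
    using P Suc.prems(1) cd by (auto simp: affine_nonneg_def in_keys_iff order_less_le)
  define B where "B = A - frag_of P"
  have A: "A = B + frag_of (Affine c d)" by (simp add: B_def cd)
  have B: "affine_nonneg B"
    using Suc.prems(1) pos by (auto simp: affine_nonneg_def B_def lookup_minus lookup_single when_def)
  moreover have "Poly_Mapping.keys B \<subseteq> curve f - {Infinity}"
    using Suc.prems(2) P Poly_Mapping.keys_diff[of A "frag_of P"] by (auto simp: B_def)
  moreover have "div_degree B = int m" using Suc.prems(3) by (simp add: B_def)
  ultimately have IH: "finite (gaps B)" "card (gaps B) \<le> g + m" using Suc.IH by blast+
  have "\<exists>s. gaps A - gaps B \<subseteq> {s}"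
  proof (cases "gaps A - gaps B = {}")
    case False
    then obtain s where s: "s \<in> gaps A - gaps B" by blast
    have "s' = s" if "s' \<in> gaps A - gaps B" for s'
      using gaps_add_point[OF B cd(2)] s that unfolding A by (meson linorder_neqE_nat)
    then show ?thesis by blast
  qed auto
  then obtain s where "gaps A \<subseteq> insert s (gaps B)" by blast
  then have "finite (gaps A)" "card (gaps A) \<le> card (insert s (gaps B))"
    using IH by (auto intro: finite_subset card_mono)
  moreover have "card (insert s (gaps B)) \<le> Suc (card (gaps B))" by (rule card_insert_le_m1) simp_all
  ultimately show ?case using IH by simp
qed

text \<open>
  The inequality of Riemann: of the \<open>g + deg A + 1\<close> pole orders up to \<open>g + deg A\<close>, where \<open>A\<close> is the affine
  part of \<open>D\<close>, at most \<open>g + deg A\<close> are gaps.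
\<close>

lemma exists_section:
  assumes "affine_nonneg D" "D \<in> Div0"
  shows "\<exists>G\<in>sections D. G \<noteq> 0 \<and> int (pole G) \<le> int g - mult_at D Infinity"
proof -
  define m where "m = nat (- mult_at D Infinity)"
  define A where "A = D + frag_cmul (- mult_at D Infinity) (frag_of Infinity)"
  have A: "mult_at A P = (if P = Infinity then 0 else mult_at D P)" for P
    by (simp add: A_def lookup_add lookup_single when_def)
  have sec: "sections A = sections D" by (simp add: sections_def A)
  have nn: "affine_nonneg A" using assms by (simp add: affine_nonneg_def A)
  have keys: "Poly_Mapping.keys A \<subseteq> curve f - {Infinity}"
    using assms by (auto simp: in_keys_iff A Div0_iff split: if_splits)
  have deg: "div_degree A = - mult_at D Infinity"
    using assms unfolding A_def by (simp add: Div0_iff del: minus_frag_cmul)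
  moreover have "div_degree A \<ge> 0"
    unfolding div_degree_def using nn keys by (intro sum_nonneg) (auto simp: affine_nonneg_def)
  ultimately have m: "div_degree A = int m" by (simp add: m_def)
  have "\<exists>s\<le>g + m. s \<notin> gaps A"
  proof (rule ccontr)
    assume "\<not> (\<exists>s\<le>g + m. s \<notin> gaps A)"
    then have "{..g + m} \<subseteq> gaps A" by auto
    then have "card {..g + m} \<le> card (gaps A)"
      using card_gaps[OF nn keys m] by (intro card_mono) auto
    then show False using card_gaps[OF nn keys m] by simp
  qed
  then obtain G where "G \<in> sections A" "G \<noteq> 0" "pole G \<le> g + m" by (auto simp: gaps_def)
  moreover have "int (g + m) = int g - mult_at D Infinity" using m deg by simp
  ultimately show ?thesis unfolding sec by (metis of_nat_le_iff)
qed

lemma sections_iff_dv: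
  "G \<noteq> 0 \<Longrightarrow> D \<in> Div0 \<Longrightarrow> G \<in> sections D \<longleftrightarrow> affine_nonneg (dv G - D)"
proof -
  assume G: "G \<noteq> 0" and D: "D \<in> Div0"
  show ?thesis
  proof
    assume sec: "G \<in> sections D"
    show "affine_nonneg (dv G - D)" unfolding affine_nonneg_def
    proof (intro allI impI)
      fix P assume "P \<noteq> (Infinity :: 'a point)"
      then obtain a b where P: "P = Affine a b" by (cases P) auto
      show "0 \<le> mult_at (dv G - D) P"
      proof (cases "b ^ 2 = poly f a")
        case True
        then show ?thesis using sec G P by (auto simp: sections_def lookup_minus lookup_dv)
      next
        case False
        then have "P \<notin> Poly_Mapping.keys D" using D P by (auto simp: Div0_iff)
        then show ?thesis using False G P by (simp add: lookup_minus lookup_dv in_keys_iff)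
      qed
    qed
  next
    assume nn: "affine_nonneg (dv G - D)"
    have "mult_at D (Affine a b) \<le> ord_at f (Affine a b) G" if "b ^ 2 = poly f a" for a b
      using nn G that unfolding affine_nonneg_def
      by (auto simp: lookup_minus lookup_dv dest!: spec[of _ "Affine a b"])
    then show "G \<in> sections D" by (simp add: sections_def)
  qed
qed

lemma affine_nonneg_dv: "G \<noteq> 0 \<Longrightarrow> affine_nonneg (dv G)"
  by (simp add: affine_nonneg_def lookup_dv_nonneg)

text \<open>A rational function without poles on the affine curve is regular.\<close>

lemma reg_quotient:
  assumes G: "G \<noteq> 0" and H: "H \<noteq> 0" and nn: "affine_nonneg (dv G - dv H)"
  obtains L where "L \<noteq> 0" "G = H \<star> L" "dv L = dv G - dv H"
proof -
  have "ord_at f (Affine a b) H \<le> ord_at f (Affine a b) G" if "b ^ 2 = poly f a" for a b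
    using nn G H that unfolding affine_nonneg_def
    by (auto simp: lookup_minus lookup_dv dest!: spec[of _ "Affine a b"])
  then obtain L where L: "G = H \<star> L" using reg_dvd_if_ord_le[OF G H] by blast
  then have "L \<noteq> 0" using G by auto
  then show thesis using that L H by (simp add: dv_mult)
qed

lemma principal_regular:
  assumes "D \<in> principal_divisors f" "affine_nonneg D"
  obtains G where "G \<noteq> 0" "dv G = D"
proof -
  from assms(1) obtain G H where "G \<noteq> 0" "H \<noteq> 0" "D = dv G - dv H" by (rule principalE)
  with assms(2) that show thesis by (metis reg_quotient)
qed

lemma dv_eq_imp_proportional:
  assumes G: "G \<noteq> 0" and H: "H \<noteq> 0" and eq: "dv G = dv H"
  obtains c where "c \<noteq> 0" "G = reg_smult c H"
proof -
  have "affine_nonneg (dv G - dv H)" using eq by (simp add: affine_nonneg_def)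
  with G H obtain L where L: "L \<noteq> 0" "G = H \<star> L" and "dv L = dv G - dv H"
    by (rule reg_quotient)
  with eq have "dv L = 0" by simp
  then have "pole L = 0" using lookup_dv_Infinity[OF L(1)] by simp
  then have s: "snd L = 0" and "Polynomial.degree (fst L) = 0"
    by (auto simp: pole_eq degree_f split: if_splits)
  then obtain c where c: "fst L = [:c:]" by (metis degree_eq_zeroE)
  with s have Lc: "L = ([:c:], 0)" by (simp add: prod_eq_iff)
  then have "c \<noteq> 0" using L(1) by (auto simp: zero_prod_def)
  then show thesis using that L(2) unfolding Lc reg_smult_alt by (simp add: reg_mult_commute)
qed

lemma ord_at_dvd:
  assumes "P \<in> curve f" "P \<noteq> Infinity" "q \<noteq> 0" "p dvd q"
  shows "ord_at f P (p, 0) \<le> ord_at f P (q, 0)"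
proof -
  obtain r where r: "q = p * r" using assms(4) by blast
  have "(q, 0) = (p, 0) \<star> (r, 0)" by (simp add: r reg_mult_def)
  moreover have "ord_at f P (r, 0) \<ge> 0"
    using assms r by (cases P) (auto intro!: ord_at_affine_nonneg simp: zero_prod_def)
  ultimately show ?thesis using assms r by (simp add: ord_at_mult zero_prod_def)
qed

text \<open>
  The negative coefficients on the affine curve can be removed by adding the divisor of a
  product of polynomials in \<open>x\<close>, one for each point. The choice of these polynomials is left
  open, since later they have to be defined over a subfield.
\<close>

lemma shift_affine_nonneg:
  assumes D: "D \<in> Div0"
    and h: "\<And>P. P \<in> Poly_Mapping.keys D - {Infinity} \<Longrightarrow>
      h P \<noteq> 0 \<and> mult_at D P + ord_at f P (h P, 0) \<ge> 0"
  shows "affine_nonneg (D + dv (\<Prod>P\<in>Poly_Mapping.keys D - {Infinity}. h P, 0))"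
proof -
  let ?p = "\<Prod>P\<in>Poly_Mapping.keys D - {Infinity}. h P"
  have p0: "?p \<noteq> 0" using h by (subst prod_zero_iff) auto
  then have p1: "(?p, 0) \<noteq> 0" by (simp add: zero_prod_def)
  have "mult_at D P + mult_at (dv (?p, 0)) P \<ge> 0" if P: "P \<noteq> Infinity" for P
  proof (cases "P \<in> Poly_Mapping.keys D")
    case True
    then have "ord_at f P (h P, 0) \<le> ord_at f P (?p, 0)"
      using P D p0 by (intro ord_at_dvd) (auto simp: Div0_iff intro: dvd_prodI)
    moreover have "P \<in> curve f" using True D by (auto simp: Div0_iff)
    ultimately show ?thesis using h[of P] True P by (auto simp: lookup_dv[OF p1])
  next
    case False
    then show ?thesis using lookup_dv_nonneg[OF p1 P] by (simp add: in_keys_iff)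
  qed
  then show ?thesis by (simp add: affine_nonneg_def lookup_add)
qed

lemma exists_affine_nonneg:
  assumes D: "D \<in> Div0"
  obtains D' where "D' \<in> Div0" "affine_nonneg D'" "cl f D' = cl f D"
proof -
  define h where "h P = (case P of Affine a b \<Rightarrow> [:- a, 1:] ^ nat \<bar>mult_at D P\<bar> | Infinity \<Rightarrow> 1)" for P
  have h0: "h P \<noteq> 0" for P by (cases P) (simp_all add: h_def)
  let ?p = "\<Prod>P\<in>Poly_Mapping.keys D - {Infinity}. h P"
  have nn: "affine_nonneg (D + dv (?p, 0))"
  proof (rule shift_affine_nonneg[OF D])
    fix P assume P: "P \<in> Poly_Mapping.keys D - {Infinity}"
    then obtain a b where ab: "P = Affine a b" "b ^ 2 = poly f a"
      using D by (cases P) (auto simp: Div0_iff)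
    define n where "n = nat \<bar>mult_at D P\<bar>"
    have "ord_at f P (h P, 0) = int (ram b * n)"
      unfolding ab(1) using ord_at_poly[OF ab(2), of "[:- a, 1:] ^ n"]
      by (simp add: h_def n_def ab(1) order_power_n_n)
    also have "\<dots> \<ge> int n" by (simp add: ram_def)
    finally have "mult_at D P + ord_at f P (h P, 0) \<ge> 0" by (simp add: n_def)
    with h0 show "h P \<noteq> 0 \<and> mult_at D P + ord_at f P (h P, 0) \<ge> 0" by blast
  qed
  have p1: "(?p, 0) \<noteq> (0 :: 'a regular)" using h0 by (simp add: zero_prod_def)
  have mem: "D + dv (?p, 0) \<in> Div0" using D dv_Div0[OF p1] by (rule Div0_add)
  then have "cl f (D + dv (?p, 0)) = cl f D"
    using cl_eq_iff[OF mem D] dv_principal[OF p1] by simp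
  with mem nn that show thesis by blast
qed

end

section \<open>The halves of a point\<close>

lemma square_if_even_orders:
  fixes q :: "'a::alg_closed_field poly"
  assumes "q \<noteq> 0" "\<And>c. even (Polynomial.order c q)"
  shows "\<exists>r. q = r ^ 2"
  using assms
proof (induction "Polynomial.degree q" arbitrary: q rule: less_induct)
  case less
  show ?case
  proof (cases "Polynomial.degree q = 0")
    case True
    then obtain k where k: "q = [:k:]" by (rule degree_eq_zeroE)
    obtain e where "e ^ 2 = k" using nth_root_exists[of 2 k] by auto
    then have "q = [:e:] ^ 2" by (simp add: k power2_eq_square)
    then show ?thesis by blast
  next
    case False
    then obtain c where c: "poly q c = 0" using alg_closed_imp_poly_has_root by blast
    have "Polynomial.order c q \<noteq> 0" using c less.prems(1) by (simp add: order_root)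
    then have "2 \<le> Polynomial.order c q"
      using less.prems(2)[of c] by (metis One_nat_def Suc_leI even_Suc gr0I le_neq_implies_less numeral_2_eq_2 odd_one)
    then have "[:- c, 1:] ^ 2 dvd q" by (simp add: order_divides)
    then obtain r where r: "q = [:- c, 1:] ^ 2 * r" by blast
    have r0: "r \<noteq> 0" using r less.prems(1) by auto
    have "Polynomial.degree q = 2 + Polynomial.degree r"
      unfolding r using r0 by (subst degree_mult_eq) (simp_all add: degree_power_eq)
    moreover have "even (Polynomial.order e r)" for e
    proof -
      have "Polynomial.order e q = Polynomial.order e ([:- c, 1:] ^ 2) + Polynomial.order e r"
        unfolding r using r0 by (intro order_mult) simp
      moreover have "Polynomial.order e ([:- c, 1:] ^ 2) = (if e = c then 2 else 0)"
        by (auto simp: order_power_n_n intro: order_0I)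
      ultimately show ?thesis using less.prems(2)[of e] by (auto split: if_splits)
    qed
    ultimately obtain s where "r = s ^ 2" using less.hyps[of r] r0 by auto
    then have "q = ([:- c, 1:] * s) ^ 2" by (simp only: r power_mult_distrib)
    then show ?thesis by blast
  qed
qed

lemma order_linear: "Polynomial.order (e::'a::field) [:- c, 1:] = (if e = c then 1 else 0)"
  using order_power_n_n[of c 1] by (auto intro: order_0I)

lemma order_prod_linear:
  fixes \<alpha> :: "'i \<Rightarrow> 'a::field"
  assumes "finite A" "inj_on \<alpha> A" "poly (\<Prod>i\<in>A. [:- \<alpha> i, 1:]) c = 0"
  shows "Polynomial.order c (\<Prod>i\<in>A. [:- \<alpha> i, 1:]) = 1"
proof -
  from assms obtain k where k: "k \<in> A" "c = \<alpha> k" by (auto simp: poly_prod prod_zero_iff)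
  let ?q = "\<Prod>i\<in>A - {k}. [:- \<alpha> i, 1:]"
  have "c - \<alpha> i \<noteq> 0" if "i \<in> A - {k}" for i using that k assms(2) by (auto simp: inj_on_def)
  then have q: "poly ?q c \<noteq> 0" using assms(1) by (simp add: poly_prod)
  then have q0: "?q \<noteq> 0" by (metis poly_0)
  have "(\<Prod>i\<in>A. [:- \<alpha> i, 1:]) = [:- c, 1:] * ?q" using assms(1) k by (simp only: prod.remove)
  moreover have "Polynomial.order c ([:- c, 1:] * ?q) = Polynomial.order c [:- c, 1:] + Polynomial.order c ?q"
    using q0 by (intro order_mult) (simp del: mult_pCons_left)
  ultimately show ?thesis using q by (simp add: order_linear order_0I)
qed

text \<open>
  The divisor of degree \<open>deg U\<close> with Mumford representation \<open>(U, V)\<close>.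
\<close>

definition half_div :: "'a::field poly \<Rightarrow> 'a poly \<Rightarrow> 'a point \<Rightarrow>\<^sub>0 int" where
  "half_div U V = Abs_poly_mapping (\<lambda>P. case P of
     Affine c d \<Rightarrow> if d = poly V c then int (Polynomial.order c U) else 0 | Infinity \<Rightarrow> 0)"

lemma lookup_half_div:
  assumes "U \<noteq> 0"
  shows "mult_at (half_div U V) (Affine c d) =
           (if d = poly V c then int (Polynomial.order c U) else 0)"
    and "mult_at (half_div U V) Infinity = 0"
proof -
  let ?h = "\<lambda>P. case P of Affine c d \<Rightarrow> if d = poly V c then int (Polynomial.order c U) else 0 | Infinity \<Rightarrow> 0"
  have "{P. ?h P \<noteq> 0} \<subseteq> (\<lambda>c. Affine c (poly V c)) ` {c. poly U c = 0}"
  proof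
    fix P assume "P \<in> {P. ?h P \<noteq> 0}"
    then show "P \<in> (\<lambda>c. Affine c (poly V c)) ` {c. poly U c = 0}"
      using assms by (cases P) (auto simp: order_root split: if_splits)
  qed
  then have "finite {P. ?h P \<noteq> 0}"
    using poly_roots_finite[OF assms] finite_subset by blast
  then have "mult_at (half_div U V) = ?h"
    unfolding half_div_def by (rule Abs_poly_mapping_inverse[OF CollectI])
  then show "mult_at (half_div U V) (Affine c d) =
           (if d = poly V c then int (Polynomial.order c U) else 0)"
    "mult_at (half_div U V) Infinity = 0" by simp_all
qed

context odd_curve
begin

text \<open>
  The pairs \<open>(U, V)\<close> that describe the halves of \<open>(a, b)\<close>. The equation determines \<open>U\<close> up to sign; the
  normalization of its leading coefficient makes \<open>V(a - t\<^sup>2) + t U(a - t\<^sup>2)\<close> monic.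
\<close>

definition half_poly :: "'a \<Rightarrow> 'a \<Rightarrow> 'a poly \<Rightarrow> 'a poly \<Rightarrow> bool" where
  "half_poly a b U V \<longleftrightarrow> f = V ^ 2 + [:- a, 1:] * U ^ 2 \<and> Polynomial.degree V \<le> g \<and>
     poly V a = b \<and> Polynomial.coeff U (Polynomial.degree U) = (-1) ^ g"

definition half_class :: "'a poly \<Rightarrow> 'a poly \<Rightarrow> ('a point \<Rightarrow>\<^sub>0 int) set" where
  "half_class U V = cl f (frag_cmul (int g) (frag_of Infinity) - half_div U V)"

lemma half_polyD:
  assumes "half_poly a b U V"
  shows "f = V ^ 2 + [:- a, 1:] * U ^ 2" "Polynomial.degree V \<le> g" "poly V a = b"
    "Polynomial.coeff U (Polynomial.degree U) = (-1) ^ g"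
  using assms unfolding half_poly_def by blast+

lemma half_poly_U: "half_poly a b U V \<Longrightarrow> U \<noteq> 0"
  using half_polyD(4)[of a b U V] by auto

lemma poly_half_poly: "half_poly a b U V \<Longrightarrow> poly f c = poly V c ^ 2 + (c - a) * poly U c ^ 2"
  by (subst half_polyD(1)) (auto simp: algebra_simps)

lemma half_poly_on_curve: "half_poly a b U V \<Longrightarrow> b ^ 2 = poly f a"
  using poly_half_poly[of a b U V a] half_polyD(3)[of a b U V] by simp

lemma half_poly_conj:
  assumes "half_poly a b U V"
  shows "half_poly a (- b) U (- V)"
  using half_polyD[OF assms] unfolding half_poly_def power2_minus degree_minus poly_minus by blast

lemma half_poly_root:
  assumes "half_poly a b U V" "poly U c = 0" "d ^ 2 = poly f c"
  shows "d = poly V c \<or> d = - poly V c"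
proof -
  have "poly f c = poly V c ^ 2" using assms poly_half_poly[OF assms(1), of c] by simp
  with assms(3) show ?thesis by (metis power2_eq_iff)
qed

text \<open>
  At a branch point on the zero set of \<open>y - V\<close> the polynomial \<open>V^2 - f\<close> has a simple root, like
  \<open>f\<close>; so \<open>U\<close> does not vanish there.
\<close>

lemma half_poly_branch:
  assumes h: "half_poly a b U V" and V: "poly V c = 0" and f: "poly f c = 0"
  shows "poly U c \<noteq> 0" "c = a"
proof -
  have eq: "f = V ^ 2 + [:- a, 1:] * U ^ 2" using h by (rule half_polyD(1))
  have V2: "[:- c, 1:] ^ 2 dvd V ^ 2" using V by (simp add: poly_eq_0_iff_dvd dvd_power_same)
  have nd: "\<not> [:- c, 1:] ^ 2 dvd f"
    using order_f[OF f] f_neq_0 by (simp add: order_divides)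
  show U: "poly U c \<noteq> 0"
  proof
    assume "poly U c = 0"
    then have "[:- c, 1:] ^ 2 dvd U ^ 2" by (simp add: poly_eq_0_iff_dvd dvd_power_same)
    then have "[:- c, 1:] ^ 2 dvd f" using V2 unfolding eq by (intro dvd_add dvd_mult)
    with nd show False by contradiction
  qed
  have "(c - a) * poly U c ^ 2 = 0" using f V poly_half_poly[OF h, of c] by simp
  with U show "c = a" by simp
qed

text \<open>
  On the graph \<open>y = V(x)\<close> the order of \<open>y - V\<close> is the multiplicity of \<open>c\<close> as a root of the norm \<open>V\<^sup>2 - f\<close>:
  for \<open>d \<noteq> 0\<close> because \<open>y - V\<close> does not vanish at the conjugate point, and for \<open>d = 0\<close> because the point is
  its own conjugate, while the multiplicity in \<open>x\<close> counts twice.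
\<close>

lemma ord_at_graph:
  assumes h: "half_poly a b U V" and d: "d ^ 2 = poly f c"
  shows "ord_at f (Affine c d) (- V, 1) =
    (if d = poly V c then 2 * int (Polynomial.order c U) + (if c = a then 1 else 0) else 0)"
proof -
  have eq: "f = V ^ 2 + [:- a, 1:] * U ^ 2" and U: "U \<noteq> 0"
    using half_polyD(1)[OF h] half_poly_U[OF h] by blast+
  have G0: "(- V, 1) \<noteq> (0 :: 'a regular)" by (simp add: zero_prod_def)
  have ev: "reg_eval (- V, 1) c e = e - poly V c" for e by (simp add: reg_eval_def)
  have norm: "reg_norm f (- V, 1) = - ([:- a, 1:] * U ^ 2)"
    unfolding reg_norm_def by (simp add: eq del: mult_pCons_left)
  have "Polynomial.order c ([:- a, 1:] * U ^ 2) = Polynomial.order c [:- a, 1:] + Polynomial.order c (U ^ 2)"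
    using U by (intro order_mult) (simp del: mult_pCons_left)
  also have "Polynomial.order c (U ^ 2) = 2 * Polynomial.order c U"
    using U by (simp add: power2_eq_square order_mult)
  finally have ordN: "Polynomial.order c (reg_norm f (- V, 1)) = 2 * Polynomial.order c U + (if c = a then 1 else 0)"
    unfolding norm order_uminus by (simp add: order_linear)
  show ?thesis
  proof (cases "d = poly V c")
    case False
    then show ?thesis using ord_at_eq_0_iff[OF d G0] ev by simp
  next
    case True
    have "ord_at f (Affine c d) (- V, 1) = int (Polynomial.order c (reg_norm f (- V, 1)))"
    proof (cases "d = 0")
      case d0: True
      then show ?thesis using ord_at_norm[OF d G0] by (simp add: ram_def)
    next
      case d0: False
      then have "reg_eval (- V, 1) c (- d) \<noteq> 0"
        unfolding ev using True double_neq[OF d0] by auto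
      then have "ord_at f (Affine c (- d)) (- V, 1) = 0"
        using ord_at_eq_0_iff[of "- d" c, OF _ G0] d by simp
      then show ?thesis using ord_at_norm[OF d G0] d0 by (simp add: ram_def)
    qed
    then show ?thesis unfolding ordN using True by simp
  qed
qed

lemma keys_half_div:
  assumes h: "half_poly a b U V"
  shows "Poly_Mapping.keys (half_div U V) \<subseteq> curve f"
proof
  fix P assume "P \<in> Poly_Mapping.keys (half_div U V)"
  then have P: "mult_at (half_div U V) P \<noteq> 0" by (simp add: in_keys_iff)
  have U: "U \<noteq> 0" using h by (rule half_poly_U)
  show "P \<in> curve f"
  proof (cases P)
    case (Affine c d)
    with P U have "d = poly V c" "poly U c = 0" by (auto simp: lookup_half_div order_root split: if_splits)
    with Affine show ?thesis by (simp add: poly_half_poly[OF h])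
  qed simp
qed

lemma lookup_half_div_off_curve:
  "half_poly a b U V \<Longrightarrow> P \<notin> curve f \<Longrightarrow> mult_at (half_div U V) P = 0"
  using keys_half_div[of a b U V] by (auto simp: in_keys_iff)

lemma dv_graph:
  assumes h: "half_poly a b U V"
  shows "dv (- V, 1) = frag_cmul 2 (half_div U V) + frag_of (Affine a b) - frag_cmul (int (2 * g + 1)) (frag_of Infinity)"
proof (rule poly_mapping_eqI)
  fix P
  have U: "U \<noteq> 0" using h by (rule half_poly_U)
  have G0: "(- V, 1) \<noteq> (0 :: 'a regular)" by (simp add: zero_prod_def)
  have V: "poly V a = b" "Polynomial.degree V \<le> g" using half_polyD[OF h] by blast+
  show "mult_at (dv (- V, 1)) P = mult_at
    (frag_cmul 2 (half_div U V) + frag_of (Affine a b) - frag_cmul (int (2 * g + 1)) (frag_of Infinity)) P"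
  proof (cases P)
    case (Affine c d)
    show ?thesis
    proof (cases "d ^ 2 = poly f c")
      case True
      then show ?thesis unfolding Affine
        by (auto simp: lookup_dv[OF G0] lookup_add lookup_minus lookup_single when_def
            ord_at_graph[OF h True] lookup_half_div[OF U] V)
    next
      case False
      then have "Affine c d \<notin> curve f" "Affine c d \<noteq> Affine a b"
        using half_poly_on_curve[OF h] by auto
      then show ?thesis unfolding Affine
        by (simp add: lookup_dv[OF G0] lookup_add lookup_minus lookup_single when_def
            lookup_half_div_off_curve[OF h] del: curve_iff)
    qed
  next
    case Infinity
    then show ?thesis using V
      by (simp add: lookup_dv_Infinity[OF G0] lookup_add lookup_minus lookup_single pole_eq degree_f lookup_half_div[OF U])
  qed
qed

lemma degree_half_poly:
  assumes h: "half_poly a b U V"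
  shows "Polynomial.degree U = g"
proof -
  have eq: "f = V ^ 2 + [:- a, 1:] * U ^ 2" and U: "U \<noteq> 0" and V: "Polynomial.degree V \<le> g"
    using half_polyD(1,2)[OF h] half_poly_U[OF h] by blast+
  have "Polynomial.degree (V ^ 2) \<le> 2 * g" using V degree_power_le[of V 2] by linarith
  then have "Polynomial.degree (f - V ^ 2) = 2 * g + 1"
    using degree_add_eq_left[of "- (V ^ 2)" f] by (simp add: degree_f)
  moreover have "f - V ^ 2 = [:- a, 1:] * U ^ 2" by (subst eq) (simp del: mult_pCons_left)
  moreover have "Polynomial.degree ([:- a, 1:] * U ^ 2) = 1 + 2 * Polynomial.degree U"
    using U by (subst degree_mult_eq) (simp_all add: degree_power_eq)
  ultimately show ?thesis by simp
qed

lemma dv_U: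
  assumes h: "half_poly a b U V"
  shows "dv (U, 0) = half_div U V + half_div U (- V) - frag_cmul (int (2 * g)) (frag_of Infinity)"
proof (rule poly_mapping_eqI)
  fix P
  have U: "U \<noteq> 0" using h by (rule half_poly_U)
  then have U0: "(U, 0) \<noteq> (0 :: 'a regular)" by (simp add: zero_prod_def)
  show "mult_at (dv (U, 0)) P = mult_at
    (half_div U V + half_div U (- V) - frag_cmul (int (2 * g)) (frag_of Infinity)) P"
  proof (cases P)
    case (Affine c d)
    show ?thesis
    proof (cases "d ^ 2 = poly f c")
      case True
      have lhs: "mult_at (dv (U, 0)) P = int (ram d * Polynomial.order c U)"
        using True U by (simp add: Affine lookup_dv[OF U0] ord_at_poly)
      have rhs: "mult_at
          (half_div U V + half_div U (- V) - frag_cmul (int (2 * g)) (frag_of Infinity)) P =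
          (if d = poly V c then int (Polynomial.order c U) else 0) +
          (if d = - poly V c then int (Polynomial.order c U) else 0)"
        by (simp add: Affine lookup_add lookup_minus lookup_single lookup_half_div[OF U])
      show ?thesis
      proof (cases "poly U c = 0")
        case False
        then have "Polynomial.order c U = 0" by (rule order_0I)
        then show ?thesis unfolding lhs rhs by simp
      next
        case root: True
        have "d \<noteq> 0"
        proof
          assume "d = 0"
          then have "poly V c = 0" "poly f c = 0" using half_poly_root[OF h root True] True by auto
          with half_poly_branch[OF h] root show False by blast
        qed
        then show ?thesis unfolding lhs rhs
          using half_poly_root[OF h root True] double_neq[of d] by (auto simp: ram_def)
      qed
    next
      case False
      then have "Affine c d \<notin> curve f" by simp
      then show ?thesis unfolding Affine
        by (simp add: lookup_dv[OF U0] lookup_add lookup_minus lookup_single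
            lookup_half_div_off_curve[OF h] lookup_half_div_off_curve[OF half_poly_conj[OF h]] del: curve_iff)
    qed
  next
    case Infinity
    then show ?thesis
      by (simp add: lookup_dv_Infinity[OF U0] lookup_add lookup_minus lookup_single pole_eq
        lookup_half_div[OF U] degree_half_poly[OF h])
  qed
qed

lemma half_class_Div0:
  assumes h: "half_poly a b U V"
  shows "frag_cmul (int g) (frag_of Infinity) - half_div U V \<in> Div0"
proof -
  let ?D = "frag_cmul (int g) (frag_of Infinity) - half_div U V"
  have "div_degree (dv (- V, 1)) = 0" by (rule div_degree_dv) (simp add: zero_prod_def)
  then have "2 * div_degree (half_div U V) + 1 - int (2 * g + 1) = 0"
    unfolding dv_graph[OF h] by (simp del: of_nat_add of_nat_mult)
  then have "div_degree ?D = 0" by simp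
  moreover have "Poly_Mapping.keys ?D \<subseteq> curve f"
    using Poly_Mapping.keys_diff[of "frag_cmul (int g) (frag_of Infinity)" "half_div U V"] keys_half_div[OF h]
      keys_cmul[of "int g" "frag_of (Infinity :: 'a point)"] by auto
  ultimately show ?thesis by (simp add: Div0_iff)
qed

lemma point_Div0: "b ^ 2 = poly f a \<Longrightarrow> frag_of (Affine a b) - frag_of Infinity \<in> Div0"
  using Poly_Mapping.keys_diff[of "frag_of (Affine a b)" "frag_of Infinity"] by (auto simp: Div0_iff)

lemma half_class_double:
  assumes h: "half_poly a b U V"
  shows "half_class U V \<in> carrier (jacobian f)"
    and "half_class U V [^]\<^bsub>jacobian f\<^esub> (2::nat) = curve_to_jacobian f (Affine a b)"
proof -
  let ?D = "frag_cmul (int g) (frag_of Infinity) - half_div U V"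
  have D: "?D \<in> Div0" using h by (rule half_class_Div0)
  then show "half_class U V \<in> carrier (jacobian f)" by (simp add: half_class_def carrier_jacobian)
  have "?D + ?D - (frag_of (Affine a b) - frag_of Infinity) = - dv (- V, 1)"
    unfolding dv_graph[OF h]
    by (rule poly_mapping_eqI) (simp add: lookup_add lookup_minus algebra_simps)
  also have "\<dots> \<in> principal_divisors f"
    by (intro principal_uminus dv_principal) (simp add: zero_prod_def)
  finally have "cl f (?D + ?D) = cl f (frag_of (Affine a b) - frag_of Infinity)"
    using cl_eq_iff Div0_add[OF D D] point_Div0 half_poly_on_curve[OF h] by blast
  then show "half_class U V [^]\<^bsub>jacobian f\<^esub> (2::nat) = curve_to_jacobian f (Affine a b)"
    by (simp add: half_class_def cl_double[OF D] curve_to_jacobian_def)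
qed

text \<open>
  Let \<open>E\<close> and \<open>E'\<close> be the two divisors. If they are equivalent, then \<open>E'\<close> plus the conjugate of \<open>E\<close>,
  minus \<open>2 g \<infinity>\<close>, is the divisor of a function \<open>G\<close>. As its pole has order \<open>2 g\<close>, it is a polynomial in
  \<open>x\<close>. But \<open>G\<^sup>2 (x - a)\<close> has the same divisor as \<open>(y - V') (y + V) = f - V V' + (V - V') y\<close>, hence \<open>V = V'\<close>.
\<close>

lemma half_class_inj:
  assumes h: "half_poly a b U V" and h': "half_poly a b U' V'"
    and eq: "half_class U V = half_class U' V'"
  shows "U = U' \<and> V = V'"
proof -
  let ?E = "half_div U V" and ?E' = "half_div U' V'" and ?I = "frag_of (Infinity :: 'a point)"
  have U: "U \<noteq> 0" "U' \<noteq> 0" using h h' half_poly_U by blast+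
  have U0: "(U, 0) \<noteq> (0 :: 'a regular)" using U by (simp add: zero_prod_def)
  have "?E' - ?E = (frag_cmul (int g) ?I - ?E) - (frag_cmul (int g) ?I - ?E')" by simp
  also have "\<dots> \<in> principal_divisors f"
    using eq cl_eq_iff[OF half_class_Div0[OF h] half_class_Div0[OF h']] by (simp add: half_class_def)
  finally have "?E' - ?E + dv (U, 0) \<in> principal_divisors f"
    by (intro principal_add dv_principal[OF U0])
  also have "?E' - ?E + dv (U, 0) = ?E' + half_div U (- V) - frag_cmul (int (2 * g)) ?I"
    unfolding dv_U[OF h] by simp
  finally have pr: "?E' + half_div U (- V) - frag_cmul (int (2 * g)) ?I \<in> principal_divisors f" .
  have "affine_nonneg (?E' + half_div U (- V) - frag_cmul (int (2 * g)) ?I)"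
    unfolding affine_nonneg_def
  proof (intro allI impI)
    fix P assume "P \<noteq> (Infinity :: 'a point)"
    then show "0 \<le> mult_at (?E' + half_div U (- V) - frag_cmul (int (2 * g)) ?I) P"
      using U by (cases P) (simp_all add: lookup_add lookup_minus lookup_single lookup_half_div)
  qed
  with pr obtain G where G: "G \<noteq> 0" "dv G = ?E' + half_div U (- V) - frag_cmul (int (2 * g)) ?I"
    by (rule principal_regular)
  have "- int (pole G) = - int (2 * g)"
    unfolding lookup_dv_Infinity[OF G(1), symmetric] G(2) using U
    by (simp add: lookup_add lookup_minus lookup_single lookup_half_div)
  then have sG: "snd G = 0" by (auto simp: pole_eq degree_f split: if_splits)
  have lin0: "([:- a, 1:], 0) \<noteq> (0 :: 'a regular)" and y0: "(p, 1) \<noteq> (0 :: 'a regular)" for p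
    by (simp_all add: zero_prod_def)
  have "dv (G \<star> G \<star> ([:- a, 1:], 0)) = dv ((- V', 1) \<star> (V, 1))"
    using dv_graph[OF half_poly_conj[OF h]]
    by (simp add: dv_mult G lin0 y0 dv_linear[OF half_poly_on_curve[OF h]] dv_graph[OF h'] del: of_nat_add of_nat_mult)
      (rule poly_mapping_eqI, simp add: lookup_add lookup_minus)
  then obtain k where k: "k \<noteq> 0" "(- V', 1) \<star> (V, 1) = reg_smult k (G \<star> G \<star> ([:- a, 1:], 0))"
    using dv_eq_imp_proportional[of "(- V', 1) \<star> (V, 1)" "G \<star> G \<star> ([:- a, 1:], 0)"] G lin0 y0 by auto
  from arg_cong[OF k(2), of snd] have V: "V = V'"
    using sG by (simp add: reg_mult_def reg_smult_def)
  have "[:- a, 1:] * U ^ 2 = [:- a, 1:] * U' ^ 2"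
    using half_polyD(1)[OF h] half_polyD(1)[OF h'] V by (metis add_left_cancel)
  then have "U ^ 2 = U' ^ 2" by (simp del: mult_pCons_left)
  then have "U = U' \<or> U = - U'" by (simp add: power2_eq_iff)
  moreover have "U \<noteq> - U'"
  proof
    assume "U = - U'"
    then have "(-1) ^ g = - ((-1) ^ g :: 'a)" using half_polyD(4)[OF h] half_polyD(4)[OF h'] by simp
    then show False using double_neq[of "(-1) ^ g"] by simp
  qed
  ultimately show ?thesis using V by blast
qed

text \<open>
  Let \<open>D\<close> represent a half of \<open>(a, b)\<close>, let \<open>G\<close> vanish on the affine part of \<open>D\<close> and have a pole of order
  at most \<open>g\<close> plus the degree of this part, and let \<open>H\<close> have the divisor \<open>2 D + (a, - b) - \<infinity>\<close>. Then
  \<open>G\<^sup>2 (x - a) / H\<close> is regular with an odd pole order of at most \<open>2 g + 1\<close>. So it has the form \<open>v (y - V)\<close>,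
  and its norm gives \<open>U\<close>.
\<close>

lemma extract_half_poly:
  assumes ab: "b ^ 2 = poly f a" and D: "D \<in> Div0" "affine_nonneg D"
    and G: "G \<noteq> 0" "G \<in> sections D" "int (pole G) \<le> int g - mult_at D Infinity"
    and H: "H \<noteq> 0" "dv H = D + D + frag_of (Affine a (- b)) - frag_of Infinity"
  obtains U V v where "v \<noteq> 0" "half_poly a b U V" "G \<star> G \<star> ([:- a, 1:], 0) = H \<star> reg_smult v (- V, 1)"
    "cl f D = half_class U V"
proof -
  let ?I = "frag_of (Infinity :: 'a point)" and ?x = "([:- a, 1:], 0) :: 'a regular"
  define F where "F = dv G - D"
  have lin0: "?x \<noteq> 0" by (simp add: zero_prod_def)
  have F: "F \<in> Div0" using Div0_diff dv_Div0 G D unfolding F_def by blast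
  have Fnn: "affine_nonneg F" using sections_iff_dv[OF G(1) D(1)] G(2) by (simp add: F_def)
  have eqL: "dv (G \<star> G \<star> ?x) - dv H = frag_cmul 2 F + frag_of (Affine a b) - ?I"
    by (rule poly_mapping_eqI) (simp add: dv_mult G lin0 dv_linear[OF ab] H F_def lookup_add lookup_minus)
  have "affine_nonneg (dv (G \<star> G \<star> ?x) - dv H)"
    using Fnn unfolding eqL affine_nonneg_def
    by (auto simp: lookup_add lookup_minus lookup_single when_def)
  then obtain L where L: "L \<noteq> 0" "G \<star> G \<star> ?x = H \<star> L" and "dv L = dv (G \<star> G \<star> ?x) - dv H"
    using reg_quotient[of "G \<star> G \<star> ?x" H] G lin0 H by (metis reg_mult_eq_0_iff)
  with eqL have dvL: "dv L = frag_cmul 2 F + frag_of (Affine a b) - ?I" by simp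
  have F_inf: "mult_at F Infinity \<ge> - int g"
    using G(3) by (simp add: F_def lookup_minus lookup_dv_Infinity[OF G(1)])
  (* The pole order of L is odd, and the bound on the pole of G leaves only 2 g + 1. *)
  have poleL: "int (pole L) = 1 - 2 * mult_at F Infinity"
    using lookup_dv_Infinity[OF L(1)] unfolding dvL by (simp add: lookup_add lookup_minus lookup_single)
  then have "odd (pole L)" by presburger
  then have sL: "snd L \<noteq> 0" by (auto simp: pole_eq)
  then have pl: "pole L = max (2 * Polynomial.degree (fst L)) (2 * Polynomial.degree (snd L) + (2 * g + 1))"
    by (simp add: pole_eq degree_f)
  have "pole L \<le> 2 * g + 1" using poleL F_inf by linarith
  then have ds: "Polynomial.degree (snd L) = 0" and df: "Polynomial.degree (fst L) \<le> g"
    and F_inf': "mult_at F Infinity = - int g"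
    using pl poleL by auto
  from ds obtain v where v: "snd L = [:v:]" by (rule degree_eq_zeroE)
  with sL have v0: "v \<noteq> 0" by auto
  define V where "V = Polynomial.smult (- 1 / v) (fst L)"
  have LV: "L = reg_smult v (- V, 1)"
    using v v0 by (simp add: reg_smult_def V_def prod_eq_iff)
  have y0: "(- V, 1) \<noteq> (0 :: 'a regular)" by (simp add: zero_prod_def)
  have dvV: "dv (- V, 1) = frag_cmul 2 F + frag_of (Affine a b) - ?I"
    using dvL dv_smult[OF v0 y0] by (simp add: LV)
  have ordV: "ord_at f (Affine c d) (- V, 1) =
      2 * mult_at F (Affine c d) + (if c = a \<and> d = b then 1 else 0)" if "d ^ 2 = poly f c" for c d
    using that lookup_dv[OF y0, of "Affine c d"] unfolding dvV
    by (auto simp: lookup_add lookup_minus lookup_single when_def split: if_splits)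
  have Va: "poly V a = b"
  proof -
    have "ord_at f (Affine a b) (- V, 1) \<noteq> 0"
      using Fnn unfolding ordV[OF ab] affine_nonneg_def by (auto dest!: spec[of _ "Affine a b"])
    then show ?thesis using ord_at_eq_0_iff[OF ab y0] by (simp add: reg_eval_def)
  qed
  have dV: "Polynomial.degree V \<le> g" using df by (simp add: V_def)
  define N where "N = f - V ^ 2"
  have N: "reg_norm f (- V, 1) = - N" by (simp add: N_def reg_norm_def)
  have N0: "N \<noteq> 0" using y0 reg_norm_eq_0_iff[of "(- V, 1)"] unfolding N by simp
  (* Apart from a contribution 1 at (a, b), the zeros of y - V have even order. *)
  have ordN: "even (Polynomial.order c N) \<longleftrightarrow> c \<noteq> a" for c
  proof -
    obtain d where d: "d ^ 2 = poly f c" by (rule obtain_ordinate)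
    have d': "(- d) ^ 2 = poly f c" using d by simp
    have sum: "int (ram d * Polynomial.order c N) =
      2 * (mult_at F (Affine c d) + mult_at F (Affine c (- d)))
       + (if c = a \<and> d = b then 1 else 0) + (if c = a \<and> - d = b then 1 else 0)"
      using ord_at_norm[OF d y0] unfolding ordV[OF d] ordV[OF d'] N order_uminus by simp
    have sq: "d = b \<or> - d = b" if "c = a" using that d ab by (metis minus_minus power2_eq_iff)
    show ?thesis
    proof (cases "d = 0")
      case True
      then have "int (Polynomial.order c N) = 2 * mult_at F (Affine c d) + (if c = a then 1 else 0)"
        using sum sq by (auto simp: ram_def split: if_splits)
      then show ?thesis by (auto split: if_splits) presburger+
    next
      case False
      then have "int (Polynomial.order c N) =
        2 * (mult_at F (Affine c d) + mult_at F (Affine c (- d))) + (if c = a then 1 else 0)"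
        using sum sq double_neq[OF False] by (auto simp: ram_def split: if_splits)
      then show ?thesis by (auto split: if_splits) presburger+
    qed
  qed
  have "poly N a = 0" using ab Va by (simp add: N_def)
  then obtain q where q: "N = [:- a, 1:] * q" by (auto simp: poly_eq_0_iff_dvd)
  have q0: "q \<noteq> 0" using q N0 by auto
  have "even (Polynomial.order c q)" for c
  proof -
    have "Polynomial.order c N = Polynomial.order c [:- a, 1:] + Polynomial.order c q"
      unfolding q using N0 by (intro order_mult) (simp only: q not_False_eq_True)
    then show ?thesis using ordN[of c] by (auto simp: order_linear split: if_splits)
  qed
  with q0 obtain W where W: "q = W ^ 2" using square_if_even_orders by blast
  have W0: "W \<noteq> 0" using W q0 by auto
  have "Polynomial.degree (V ^ 2) \<le> 2 * g" using dV degree_power_le[of V 2] by linarith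
  then have "Polynomial.degree N = 2 * g + 1" "Polynomial.coeff N (2 * g + 1) = 1"
    using degree_add_eq_left[of "- (V ^ 2)" f] monic_f by (simp_all add: N_def degree_f coeff_eq_0)
  then have "lead_coeff N = 1" by simp
  moreover have "lead_coeff N = lead_coeff W ^ 2"
    unfolding q W lead_coeff_mult lead_coeff_power by simp
  ultimately have lW: "lead_coeff W ^ 2 = 1" by simp
  (* The leading coefficient of W is 1 or -1, so U is W or - W. *)
  define U where "U = Polynomial.smult ((-1) ^ g * lead_coeff W) W"
  have "lead_coeff U = (-1) ^ g * (lead_coeff W ^ 2)" by (simp add: U_def power2_eq_square)
  then have lU: "lead_coeff U = (-1) ^ g" by (simp add: lW)
  have "U ^ 2 = Polynomial.smult (((-1) ^ g * lead_coeff W) ^ 2) (W ^ 2)"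
    by (simp add: U_def power2_eq_square)
  also have "((-1) ^ g * lead_coeff W) ^ 2 = 1"
    unfolding power_mult_distrib lW by (simp flip: power_mult)
  finally have U2: "U ^ 2 = W ^ 2" by simp
  have "f = V ^ 2 + [:- a, 1:] * U ^ 2"
    using q W U2 by (simp add: N_def algebra_simps del: mult_pCons_left)
  with dV Va lU have h: "half_poly a b U V" unfolding half_poly_def by blast
  have U0: "U \<noteq> 0" using h by (rule half_poly_U)
  have "frag_cmul 2 F = frag_cmul 2 (half_div U V - frag_cmul (int g) ?I)"
    using dvV unfolding dv_graph[OF h] frag_cmul_distrib2
    by (intro poly_mapping_eqI) (auto simp: poly_mapping_eq_iff lookup_add lookup_minus fun_eq_iff lookup_single algebra_simps)
  then have "F = half_div U V - frag_cmul (int g) ?I"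
    by (intro poly_mapping_eqI) (auto simp: poly_mapping_eq_iff fun_eq_iff)
  then have "D - (frag_cmul (int g) ?I - half_div U V) = D + F"
    by (intro poly_mapping_eqI) (simp add: lookup_add lookup_minus)
  then have "D - (frag_cmul (int g) ?I - half_div U V) = dv G"
    by (simp add: F_def)
  then have "cl f D = half_class U V"
    using cl_eq_iff[OF D(1) half_class_Div0[OF h]] dv_principal[OF G(1)] by (simp add: half_class_def)
  with v0 h L(2) LV that show thesis by blast
qed

text \<open>
  The divisor \<open>2 D - (a, b) + \<infinity>\<close> is principal, and \<open>(a, b) + (a, - b) - 2 \<infinity>\<close> is the divisor of \<open>x - a\<close>.
\<close>

lemma half_relation:
  assumes ab: "b ^ 2 = poly f a" and D: "D \<in> Div0" "affine_nonneg D"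
    and half: "cl f D [^]\<^bsub>jacobian f\<^esub> (2::nat) = curve_to_jacobian f (Affine a b)"
  obtains H where "H \<noteq> 0" "dv H = D + D + frag_of (Affine a (- b)) - frag_of Infinity"
proof -
  have "D + D - (frag_of (Affine a b) - frag_of Infinity) \<in> principal_divisors f"
    using half cl_eq_iff[OF Div0_add[OF D(1) D(1)] point_Div0[OF ab]]
    by (simp add: cl_double[OF D(1)] curve_to_jacobian_def)
  then have "D + D - (frag_of (Affine a b) - frag_of Infinity) + dv ([:- a, 1:], 0) \<in> principal_divisors f"
    by (rule principal_add) (simp add: dv_principal zero_prod_def)
  also have "D + D - (frag_of (Affine a b) - frag_of Infinity) + dv ([:- a, 1:], 0) =
      D + D + frag_of (Affine a (- b)) - frag_of Infinity"
    unfolding dv_linear[OF ab] by (rule poly_mapping_eqI) (simp add: lookup_add lookup_minus)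
  finally have "D + D + frag_of (Affine a (- b)) - frag_of Infinity \<in> principal_divisors f" .
  moreover have "affine_nonneg (D + D + frag_of (Affine a (- b)) - frag_of Infinity)"
    using D(2) unfolding affine_nonneg_def by (auto simp: lookup_add lookup_minus lookup_single when_def)
  ultimately show thesis using that by (rule principal_regular)
qed

lemma half_class_surj:
  assumes ab: "b ^ 2 = poly f a" and c: "\<aa> \<in> carrier (jacobian f)"
    and half: "\<aa> [^]\<^bsub>jacobian f\<^esub> (2::nat) = curve_to_jacobian f (Affine a b)"
  obtains U V where "half_poly a b U V" "\<aa> = half_class U V"
proof -
  from c obtain D0 where "D0 \<in> Div0" "\<aa> = cl f D0" by (auto simp: carrier_jacobian)
  then obtain D where D: "D \<in> Div0" "affine_nonneg D" "\<aa> = cl f D" by (metis exists_affine_nonneg)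
  obtain H where H: "H \<noteq> 0" "dv H = D + D + frag_of (Affine a (- b)) - frag_of Infinity"
    using half_relation[OF ab D(1,2)] half D(3) by blast
  obtain G where G: "G \<in> sections D" "G \<noteq> 0" "int (pole G) \<le> int g - mult_at D Infinity"
    using exists_section[OF D(2,1)] by blast
  show thesis
    using extract_half_poly[OF ab D(1,2) G(2,1,3) H] D(3) that by metis
qed

end

section \<open>Halves and square roots\<close>

text \<open>Each polynomial has an even and an odd part.\<close>

lemma pole_poly_surj:
  assumes "poly_over K0 (p :: 'a::field poly)" "0 \<in> K0"
  shows "\<exists>G. reg_over K0 G \<and> p = pole_poly 1 G"
  using assms(1)
proof (induction p)
  case 0
  show ?case by (rule exI[of _ 0]) (simp add: reg_over_def poly_over_def assms(2))
next
  case (pCons c p)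
  have "c \<in> K0" "poly_over K0 p"
    using spec[OF pCons.prems[unfolded poly_over_def], of 0]
      spec[OF pCons.prems[unfolded poly_over_def], of "Suc _"] by (simp_all add: poly_over_def)
  with pCons obtain G where G: "reg_over K0 G" "p = pole_poly 1 G" by blast
  have "pCons c p = [:c:] + [:0, 1:] * p" by simp
  also have "\<dots> = pole_poly 1 (pCons c (snd G), fst G)"
    unfolding G(2) by (simp add: pole_poly_def pcompose_pCons monom_Suc numeral_2_eq_2 algebra_simps)
  finally have "pCons c p = pole_poly 1 (pCons c (snd G), fst G)" .
  moreover have "reg_over K0 (pCons c (snd G), fst G)"
    using G(1) \<open>c \<in> K0\<close> by (auto simp: reg_over_def poly_over_def coeff_pCons split: nat.splits)
  ultimately show ?case by blast
qed

lemma coeff_prod_linear: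
  assumes "finite A"
  shows "Polynomial.coeff (\<Prod>i\<in>A. [:r i, e:]) (card A) = (e::'a::field) ^ card A \<and>
    (\<forall>n. card A = Suc n \<longrightarrow> Polynomial.coeff (\<Prod>i\<in>A. [:r i, e:]) n = e ^ n * (\<Sum>i\<in>A. r i))"
  using assms
proof (induction A rule: finite_induct)
  case (insert x A)
  let ?p = "\<Prod>i\<in>A. [:r i, e:]"
  have "Polynomial.degree ?p \<le> (\<Sum>i\<in>A. Polynomial.degree [:r i, e:])" by (rule degree_prod_sum_le[OF insert.hyps(1), unfolded o_def])
  also have "\<dots> \<le> (\<Sum>i\<in>A. 1)" by (rule sum_mono) simp
  finally have deg: "Polynomial.degree ?p \<le> card A" by simp
  have ins: "(\<Prod>i\<in>insert x A. [:r i, e:]) = Polynomial.smult (r x) ?p + pCons 0 (Polynomial.smult e ?p)"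
    using insert.hyps by simp
  show ?case
  proof (intro conjI allI impI)
    show "Polynomial.coeff (\<Prod>i\<in>insert x A. [:r i, e:]) (card (insert x A)) = e ^ card (insert x A)"
      unfolding ins using insert deg by (simp add: coeff_eq_0)
    fix n assume "card (insert x A) = Suc n"
    then have n: "card A = n" using insert.hyps by simp
    show "Polynomial.coeff (\<Prod>i\<in>insert x A. [:r i, e:]) n = e ^ n * (\<Sum>i\<in>insert x A. r i)"
    proof (cases n)
      case 0
      with n insert.hyps have "A = {}" by simp
      with 0 show ?thesis unfolding ins by simp
    next
      case (Suc m)
      then show ?thesis
        unfolding ins using insert n by (simp add: algebra_simps)
    qed
  qed
qed auto

text \<open>
  \<open>V(a - t\<^sup>2) + t U(a - t\<^sup>2)\<close>, written as a polynomial in \<open>t\<close> with prescribed even and odd part, so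
  that \<open>U\<close> and \<open>V\<close> can be recovered from it.
\<close>

definition half_W :: "'a::field \<Rightarrow> 'a poly \<Rightarrow> 'a poly \<Rightarrow> 'a poly" where
  "half_W a U V = pole_poly 1 (pcompose V [:a, - 1:], pcompose U [:a, - 1:])"

lemma poly_half_W: "poly (half_W a U V) t = poly V (a - t ^ 2) + t * poly U (a - t ^ 2)"
  by (simp add: half_W_def pole_poly_def poly_pcompose poly_monom)

lemma pcompose_reflect_inj: "pcompose p [:a, - 1:] = pcompose q [:a, - 1:] \<longleftrightarrow> p = (q :: 'a::field poly)"
  by (subst eq_iff_diff_eq_0, subst pcompose_diff[symmetric], subst pcompose_eq_0_iff) simp_all

lemma pcompose_reflect_reflect: "pcompose (pcompose p [:a, - 1:]) [:a, - 1:] = (p :: 'a::field poly)"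
  unfolding pcompose_assoc[symmetric] by (simp add: pcompose_pCons)

lemma half_W_inj:
  assumes "half_W a U V = half_W a U' V'"
  shows "U = U' \<and> V = V'"
proof -
  have "pole_poly 1 ((pcompose V [:a, - 1:], pcompose U [:a, - 1:]) - (pcompose V' [:a, - 1:], pcompose U' [:a, - 1:])) = 0"
    using assms unfolding pole_poly_diff half_W_def by simp
  then have "(pcompose V [:a, - 1:], pcompose U [:a, - 1:]) = (pcompose V' [:a, - 1:], pcompose U' [:a, - 1:])"
    unfolding pole_poly_eq_0_iff[OF odd_one] by (simp only: right_minus_eq)
  then show ?thesis by (simp add: pcompose_reflect_inj)
qed

lemma poly_over_pcompose:
  assumes K0: "0 \<in> K0" "\<And>x y. x \<in> K0 \<Longrightarrow> y \<in> K0 \<Longrightarrow> x + y \<in> K0" "\<And>x y. x \<in> K0 \<Longrightarrow> y \<in> K0 \<Longrightarrow> x * y \<in> K0"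
    and p: "poly_over K0 p" and q: "poly_over K0 q"
  shows "poly_over K0 (pcompose p q)"
  using coeff_pcompose_semiring_closed[OF K0, of p q] p q unfolding poly_over_def by blast

lemma half_W_surj:
  assumes K0: "0 \<in> K0" "\<And>x y. x \<in> K0 \<Longrightarrow> y \<in> K0 \<Longrightarrow> x + y \<in> K0" "\<And>x y. x \<in> K0 \<Longrightarrow> y \<in> K0 \<Longrightarrow> x * y \<in> K0"
    and a: "a \<in> K0" "- 1 \<in> K0" and p: "poly_over K0 p"
  obtains U V where "p = half_W a U V" "poly_over K0 U" "poly_over K0 V"
proof -
  obtain G where G: "reg_over K0 G" "p = pole_poly 1 G" using pole_poly_surj[OF p] K0(1) by blast
  have s: "poly_over K0 [:a, - 1:]"
    using a K0(1) by (auto simp: poly_over_def coeff_pCons split: nat.splits)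
  show thesis
  proof
    show "p = half_W a (pcompose (snd G) [:a, - 1:]) (pcompose (fst G) [:a, - 1:])"
      by (simp add: G(2) half_W_def pcompose_reflect_reflect)
    show "poly_over K0 (pcompose (snd G) [:a, - 1:])" "poly_over K0 (pcompose (fst G) [:a, - 1:])"
      using poly_over_pcompose[OF K0 _ s] G(1) by (simp_all add: reg_over_def)
  qed
qed

lemma degree_half_W:
  "Polynomial.degree (half_W a U V) = (if U = 0 then 2 * Polynomial.degree V
     else max (2 * Polynomial.degree V) (2 * Polynomial.degree U + 1))"
  using pole_order_eq[of 1 "(pcompose V [:a, - 1:], pcompose U [:a, - 1:])"] pcompose_eq_0_iff[of "[:a, - 1:]" U]
  by (simp add: half_W_def pole_order_def degree_pcompose)

lemma half_W_alt:
  "half_W a U V = pcompose V [:a, 0, - 1:] + [:0, 1:] * pcompose U [:a, 0, - 1:]"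
  by (simp add: half_W_def pole_poly_def pcompose_assoc[symmetric] pcompose_pCons monom_Suc numeral_2_eq_2)

lemma lead_coeff_half_W:
  assumes "U \<noteq> 0" "Polynomial.degree V \<le> Polynomial.degree U"
  shows "lead_coeff (half_W a U V) = lead_coeff U * (-1) ^ Polynomial.degree U"
proof -
  let ?s = "[:a, 0, - 1:]"
  have "pcompose U ?s \<noteq> 0" using assms by (subst pcompose_eq_0_iff) simp_all
  then have "Polynomial.degree (pcompose V ?s) < Polynomial.degree ([:0, 1:] * pcompose U ?s)"
    using assms by (subst degree_mult_eq) (simp_all add: degree_pcompose)
  then have "lead_coeff (half_W a U V) = lead_coeff ([:0, 1:] * pcompose U ?s)"
    unfolding half_W_alt by (rule lead_coeff_add_le)
  also have "\<dots> = lead_coeff U * (-1) ^ Polynomial.degree U"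
    unfolding lead_coeff_mult by (subst lead_coeff_comp) simp_all
  finally show ?thesis .
qed

lemma half_W_reflect:
  "pcompose (half_W a U V) [:0, - 1:] = pcompose V [:a, 0, - 1:] - [:0, 1:] * pcompose U [:a, 0, - 1:]"
  unfolding half_W_alt pcompose_add pcompose_mult pcompose_assoc[symmetric]
  by (simp add: pcompose_pCons)

lemma half_W_norm:
  "half_W a U V * pcompose (half_W a U V) [:0, - 1:] = pcompose (V ^ 2 + [:- a, 1:] * U ^ 2) [:a, 0, - 1:]"
proof -
  have "pcompose [:- a, 1:] [:a, 0, - 1:] = - ([:0, 1:] * [:0, 1:])"
    by (simp add: pcompose_pCons)
  moreover have eq: "(v + t * u) * (v - t * u) = v * v + - (t * t) * (u * u)" for t u v :: "'a poly"
    by (simp add: algebra_simps)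
  ultimately show ?thesis
    unfolding half_W_reflect unfolding half_W_alt pcompose_add pcompose_mult power2_eq_square
    by (simp only: eq)
qed

lemma card_square_roots:
  assumes "(2::'a::alg_closed_field) \<noteq> 0" "e \<noteq> (0::'a)"
  shows "card {z. z ^ 2 = e} = 2"
proof -
  obtain d where d: "d ^ 2 = e" using nth_root_exists[of 2 e] by auto
  have "d \<noteq> - d"
    using d assms by (metis add.right_inverse mult_2 mult_eq_0_iff power2_eq_square)
  moreover have "{z. z ^ 2 = e} = {d, - d}"
    using d by (auto simp: power2_eq_iff)
  ultimately show ?thesis by simp
qed

locale split_odd_curve = odd_curve f g for f :: "'a::alg_closed_field poly" and g :: nat +
  fixes \<alpha> :: "'i \<Rightarrow> 'a" and Idx :: "'i set"
  assumes finite_Idx [simp]: "finite Idx"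
    and card_Idx: "card Idx = 2 * g + 1"
    and f_prod: "f = (\<Prod>i\<in>Idx. [:- \<alpha> i, 1:])"
    and inj_\<alpha>: "inj_on \<alpha> Idx"
begin

lemma poly_f: "poly f c = (\<Prod>i\<in>Idx. c - \<alpha> i)"
  by (subst f_prod) (simp only: poly_prod, simp)

lemma poly_f_\<alpha>: "i \<in> Idx \<Longrightarrow> poly f (\<alpha> i) = 0"
  unfolding poly_f by (rule prod_zero) auto

definition root_choices :: "'a \<Rightarrow> 'a \<Rightarrow> ('i \<Rightarrow> 'a) set" where
  "root_choices a b = {r \<in> \<Pi>\<^sub>E i\<in>Idx. {z. z ^ 2 = a - \<alpha> i}. (\<Prod>i\<in>Idx. r i) = b}"

lemma half_poly_U_\<alpha>:
  assumes h: "half_poly a b U V" and i: "i \<in> Idx"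
  shows "poly U (\<alpha> i) \<noteq> 0"
proof
  assume U: "poly U (\<alpha> i) = 0"
  then have "poly V (\<alpha> i) = 0" using poly_half_poly[OF h, of "\<alpha> i"] poly_f_\<alpha>[OF i] by simp
  with half_poly_branch(1)[OF h _ poly_f_\<alpha>[OF i]] U show False by blast
qed

text \<open>
  At \<open>x = a - t^2\<close> the polynomial \<open>f = V^2 + (x - a) U^2\<close> factors as \<open>W(t) W(- t)\<close> with
  \<open>W(t) = V + t U\<close>. The values \<open>r\<^sub>i\<close> below are the negatives of the roots of \<open>W\<close>, one for each \<open>i\<close>.
\<close>

definition half_roots :: "'a poly \<Rightarrow> 'a poly \<Rightarrow> 'i \<Rightarrow> 'a" where
  "half_roots U V = (\<lambda>i\<in>Idx. poly V (\<alpha> i) / poly U (\<alpha> i))"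

lemma half_roots_square:
  assumes h: "half_poly a b U V" and i: "i \<in> Idx"
  shows "half_roots U V i ^ 2 = a - \<alpha> i"
proof -
  have "poly V (\<alpha> i) ^ 2 = (a - \<alpha> i) * poly U (\<alpha> i) ^ 2"
    using poly_half_poly[OF h, of "\<alpha> i"] poly_f_\<alpha>[OF i] by (simp add: algebra_simps)
  then show ?thesis
    using half_poly_U_\<alpha>[OF h i] i by (simp add: half_roots_def power_divide)
qed

lemma inj_square_roots:
  assumes "\<And>i. i \<in> Idx \<Longrightarrow> r i ^ 2 = a - \<alpha> i"
  shows "inj_on r Idx"
  using inj_\<alpha> assms unfolding inj_on_def by (metis diff_diff_eq2 diff_add_cancel add_diff_cancel_left')

lemma prod_square_roots:
  assumes "\<And>i. i \<in> Idx \<Longrightarrow> r i ^ 2 = a - \<alpha> i"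
  shows "(\<Prod>i\<in>Idx. [:r i, 1:]) * (\<Prod>i\<in>Idx. [:r i, - 1:]) = pcompose f [:a, 0, - 1:]"
proof -
  have "[:r i, 1:] * [:r i, - 1:] = pcompose [:- \<alpha> i, 1:] [:a, 0, - 1:]" if "i \<in> Idx" for i
    using assms[OF that] by (simp add: pcompose_pCons power2_eq_square)
  then show ?thesis
    unfolding prod.distrib[symmetric] by (subst f_prod) (simp only: pcompose_prod cong: prod.cong)
qed

lemma half_W_eq_prod:
  assumes h: "half_poly a b U V"
  shows "half_W a U V = (\<Prod>i\<in>Idx. [:half_roots U V i, 1:])"
proof (rule poly_eqI_degree_lead_coeff)
  let ?r = "half_roots U V"
  note D = half_polyD[OF h] half_poly_U[OF h] degree_half_poly[OF h]
  show deg: "Polynomial.degree (half_W a U V) \<le> 2 * g + 1"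
    using D by (simp add: degree_half_W)
  have deg': "Polynomial.degree (half_W a U V) = 2 * g + 1"
    using D by (simp add: degree_half_W)
  have "lead_coeff (half_W a U V) = 1"
    using D by (subst lead_coeff_half_W) (simp_all flip: power_mult_distrib)
  then show "Polynomial.coeff (half_W a U V) (2 * g + 1) = Polynomial.coeff (\<Prod>i\<in>Idx. [:?r i, 1:]) (2 * g + 1)"
    using coeff_prod_linear[of Idx ?r 1] unfolding deg' card_Idx by simp
  show "Polynomial.degree (\<Prod>i\<in>Idx. [:?r i, 1:]) \<le> 2 * g + 1"
    using degree_prod_sum_le[of Idx "\<lambda>i. [:?r i, 1:]"] by (simp add: o_def card_Idx)
  have "inj_on (\<lambda>i. - ?r i) Idx"
    using inj_square_roots[of ?r a] half_roots_square[OF h] by (simp add: inj_on_def)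
  then show "2 * g + 1 \<le> card ((\<lambda>i. - ?r i) ` Idx)" by (simp add: card_image card_Idx)
  fix z assume "z \<in> (\<lambda>i. - ?r i) ` Idx"
  then obtain i where i: "i \<in> Idx" "z = - ?r i" by blast
  have "poly (half_W a U V) z = 0"
    using half_roots_square[OF h i(1)] half_poly_U_\<alpha>[OF h i(1)] i
    by (simp add: poly_half_W half_roots_def)
  moreover have "poly (\<Prod>i\<in>Idx. [:?r i, 1:]) z = 0"
    unfolding poly_prod using i by (intro prod_zero) auto
  ultimately show "poly (half_W a U V) z = poly (\<Prod>i\<in>Idx. [:?r i, 1:]) z" by simp
qed

lemma half_roots_root_choices:
  assumes h: "half_poly a b U V"
  shows "half_roots U V \<in> root_choices a b"
proof -
  have "b = poly (half_W a U V) 0" using half_polyD(3)[OF h] by (simp add: poly_half_W)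
  also have "\<dots> = (\<Prod>i\<in>Idx. half_roots U V i)" unfolding half_W_eq_prod[OF h] poly_prod by simp
  finally show ?thesis
    using half_roots_square[OF h] by (auto simp: root_choices_def half_roots_def)
qed

lemma half_roots_surj:
  assumes r: "r \<in> root_choices a b"
  obtains U V where "half_poly a b U V" "half_roots U V = r"
proof -
  have sq: "\<And>i. i \<in> Idx \<Longrightarrow> r i ^ 2 = a - \<alpha> i" and ext: "r \<in> extensional Idx" and pr: "(\<Prod>i\<in>Idx. r i) = b"
    using r by (auto simp: root_choices_def PiE_def)
  obtain U V where W: "(\<Prod>i\<in>Idx. [:r i, 1:]) = half_W a U V"
    by (rule half_W_surj[of UNIV a]) (simp_all add: poly_over_def)
  have degW: "Polynomial.degree (half_W a U V) = 2 * g + 1" "lead_coeff (half_W a U V) = 1"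
  proof -
    have "Polynomial.degree (half_W a U V) \<le> 2 * g + 1"
      using degree_prod_sum_le[of Idx "\<lambda>i. [:r i, 1:]"] unfolding W[symmetric] by (simp add: o_def card_Idx)
    moreover have c: "Polynomial.coeff (half_W a U V) (2 * g + 1) = 1"
      using coeff_prod_linear[of Idx r 1] unfolding W[symmetric] card_Idx by simp
    then have "2 * g + 1 \<le> Polynomial.degree (half_W a U V)" by (intro le_degree) simp
    ultimately show "Polynomial.degree (half_W a U V) = 2 * g + 1" by simp
    with c show "lead_coeff (half_W a U V) = 1" by simp
  qed
  have "U \<noteq> 0" using degW(1) unfolding degree_half_W by (auto split: if_splits) presburger
  with degW(1) have "max (2 * Polynomial.degree V) (2 * Polynomial.degree U + 1) = 2 * g + 1"
    by (simp add: degree_half_W)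
  then have deg: "Polynomial.degree U = g" "Polynomial.degree V \<le> g"
    unfolding max_def by (presburger, presburger)
  have "lead_coeff U * (-1) ^ g = 1"
    using lead_coeff_half_W[OF \<open>U \<noteq> 0\<close>, of V a] deg degW(2) by simp
  then have lead: "lead_coeff U = (-1) ^ g"
    by (cases "even g") (simp_all, metis minus_minus)
  have "pcompose (half_W a U V) [:0, - 1:] = (\<Prod>i\<in>Idx. [:r i, - 1:])"
    unfolding W[symmetric] pcompose_prod by (simp add: pcompose_pCons)
  then have "pcompose (V ^ 2 + [:- a, 1:] * U ^ 2) [:a, 0, - 1:] = pcompose f [:a, 0, - 1:]"
    using half_W_norm[of a U V] prod_square_roots[of r a, OF sq] by (simp only: W)
  then have "pcompose (V ^ 2 + [:- a, 1:] * U ^ 2 - f) [:a, 0, - 1:] = 0"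
    by (simp only: pcompose_diff diff_self)
  then have "V ^ 2 + [:- a, 1:] * U ^ 2 - f = 0"
    by (subst (asm) pcompose_eq_0_iff) simp_all
  then have feq: "f = V ^ 2 + [:- a, 1:] * U ^ 2" by (simp del: mult_pCons_left)
  have "poly V a = poly (half_W a U V) 0" by (simp add: poly_half_W)
  also have "\<dots> = b" unfolding W[symmetric] poly_prod using pr by simp
  finally have h: "half_poly a b U V" using feq deg(2) lead unfolding half_poly_def by blast
  have "half_roots U V = r"
  proof (rule extensionalityI[OF _ ext])
    show "half_roots U V \<in> extensional Idx" by (simp add: half_roots_def)
    fix i assume i: "i \<in> Idx"
    have "poly (half_W a U V) (- r i) = 0"
      unfolding W[symmetric] poly_prod using i by (intro prod_zero) auto
    then have "poly V (\<alpha> i) = r i * poly U (\<alpha> i)" using sq[OF i] by (simp add: poly_half_W)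
    then show "half_roots U V i = r i" using half_poly_U_\<alpha>[OF h i] i by (simp add: half_roots_def)
  qed
  with h that show thesis by blast
qed

lemma half_roots_inj:
  assumes "half_poly a b U V" "half_poly a b U' V'" "half_roots U V = half_roots U' V'"
  shows "U = U' \<and> V = V'"
  using half_W_eq_prod[OF assms(1)] half_W_eq_prod[OF assms(2)] assms(3) half_W_inj by metis

text \<open>
  All square roots but one can be chosen freely, and the last one is then determined by the
  product. If \<open>b = 0\<close>, it has to be the root \<open>0\<close>.
\<close>

lemma card_root_choices:
  assumes ab: "b ^ 2 = poly f a"
  shows "card (root_choices a b) = 2 ^ (2 * g)"
proof -
  obtain k where k: "k \<in> Idx" "\<And>i. i \<in> Idx - {k} \<Longrightarrow> a \<noteq> \<alpha> i"
  proof (cases "\<exists>i\<in>Idx. a = \<alpha> i")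
    case True
    then obtain k where "k \<in> Idx" "a = \<alpha> k" by blast
    then have "a \<noteq> \<alpha> i" if "i \<in> Idx - {k}" for i
      using inj_onD[OF inj_\<alpha>, of i k] that by blast
    with \<open>k \<in> Idx\<close> that show thesis by blast
  next
    case False
    moreover have "Idx \<noteq> {}" using card_Idx by auto
    ultimately show thesis using that by blast
  qed
  let ?S = "\<lambda>i. {z. z ^ 2 = a - \<alpha> i}"
  let ?A = "\<Pi>\<^sub>E i\<in>Idx - {k}. ?S i"
  have prod_k: "(\<Prod>i\<in>Idx. s i) = s k * (\<Prod>i\<in>Idx - {k}. s i)" for s :: "'i \<Rightarrow> 'a"
    using k(1) by (subst prod.remove[of _ k]) auto
  have ne: "(\<Prod>i\<in>Idx - {k}. s i) \<noteq> 0" if "\<And>i. i \<in> Idx - {k} \<Longrightarrow> s i \<in> ?S i" for s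
  proof -
    have "s i \<noteq> 0" if "i \<in> Idx - {k}" for i
      using k(2)[OF that] \<open>\<And>i. i \<in> Idx - {k} \<Longrightarrow> s i \<in> ?S i\<close>[OF that] by auto
    then show ?thesis by simp
  qed
  have "bij_betw (\<lambda>r. restrict r (Idx - {k})) (root_choices a b) ?A"
  proof (rule bij_betwI[where g = "\<lambda>s. s(k := b / (\<Prod>i\<in>Idx - {k}. s i))"])
    show "(\<lambda>r. restrict r (Idx - {k})) \<in> root_choices a b \<rightarrow> ?A"
    proof
      fix r assume "r \<in> root_choices a b"
      then have "r \<in> (\<Pi>\<^sub>E i\<in>Idx. ?S i)" by (simp add: root_choices_def)
      then show "restrict r (Idx - {k}) \<in> ?A" unfolding restrict_PiE_iff by (blast dest: PiE_mem)
    qed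
  next
    show "(\<lambda>s. s(k := b / (\<Prod>i\<in>Idx - {k}. s i))) \<in> ?A \<rightarrow> root_choices a b"
    proof
      fix s assume s: "s \<in> ?A"
      let ?q = "\<Prod>i\<in>Idx - {k}. s i" and ?t = "s(k := b / (\<Prod>i\<in>Idx - {k}. s i))"
      have q: "?q \<noteq> 0" using s by (intro ne) auto
      have "?q ^ 2 = (\<Prod>i\<in>Idx - {k}. a - \<alpha> i)"
        unfolding prod_power_distrib using s by (intro prod.cong) auto
      then have "b ^ 2 = (a - \<alpha> k) * ?q ^ 2" using ab prod_k[of "\<lambda>i. a - \<alpha> i"] by (simp add: poly_f)
      then have "(b / ?q) ^ 2 = a - \<alpha> k" using q by (simp add: power_divide)
      then have "?t \<in> (\<Pi>\<^sub>E i\<in>Idx. ?S i)"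
        using s k(1) by (auto simp: PiE_def Pi_def extensional_def)
      moreover have "(\<Prod>i\<in>Idx - {k}. ?t i) = ?q" by (rule prod.cong) auto
      then have "(\<Prod>i\<in>Idx. ?t i) = b" using q by (subst prod_k) simp
      ultimately show "?t \<in> root_choices a b" by (simp add: root_choices_def)
    qed
  next
    fix r assume r: "r \<in> root_choices a b"
    let ?s = "restrict r (Idx - {k})"
    have eq: "(\<Prod>i\<in>Idx - {k}. ?s i) = (\<Prod>i\<in>Idx - {k}. r i)" by (rule prod.cong) auto
    have "(\<Prod>i\<in>Idx - {k}. r i) \<noteq> 0" using r by (intro ne) (auto simp: root_choices_def)
    moreover have "b = r k * (\<Prod>i\<in>Idx - {k}. r i)" using r prod_k[of r] by (simp add: root_choices_def)
    ultimately have "b / (\<Prod>i\<in>Idx - {k}. ?s i) = r k" unfolding eq by simp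
    then show "?s(k := b / (\<Prod>i\<in>Idx - {k}. ?s i)) = r"
      using r k(1) by (auto simp: fun_eq_iff root_choices_def PiE_def extensional_def)
  next
    fix s assume "s \<in> ?A"
    then show "restrict (s(k := b / (\<Prod>i\<in>Idx - {k}. s i))) (Idx - {k}) = s"
      by (auto simp: fun_eq_iff PiE_def extensional_def)
  qed
  then have "card (root_choices a b) = card ?A" by (rule bij_betw_same_card)
  also have "\<dots> = (\<Prod>i\<in>Idx - {k}. card (?S i))" by (rule card_PiE) simp
  also have "\<dots> = (\<Prod>i\<in>Idx - {k}. 2)"
    using k(2) by (intro prod.cong card_square_roots two_neq_0) auto
  also have "\<dots> = 2 ^ (2 * g)" using k(1) by (simp add: card_Idx)
  finally show ?thesis .
qed

text \<open>Both the halves of \<open>(a, b)\<close> and the choices of square roots correspond to the half polynomials.\<close>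

lemma card_halves:
  assumes ab: "b ^ 2 = poly f a"
  shows "card {\<aa> \<in> carrier (jacobian f). \<aa> [^]\<^bsub>jacobian f\<^esub> (2::nat) = curve_to_jacobian f (Affine a b)}
           = 2 ^ (2 * g)"
proof -
  let ?H = "{(U, V). half_poly a b U V}"
  have roots: "bij_betw (\<lambda>(U, V). half_roots U V) ?H (root_choices a b)"
    unfolding bij_betw_def
  proof
    show "inj_on (\<lambda>(U, V). half_roots U V) ?H"
    proof (rule inj_onI, clarify)
      fix U V U' V' assume "half_poly a b U V" "half_poly a b U' V'" "half_roots U V = half_roots U' V'"
      then show "U = U' \<and> V = V'" by (rule half_roots_inj)
    qed
    show "(\<lambda>(U, V). half_roots U V) ` ?H = root_choices a b"
    proof (intro equalityI subsetI)
      fix z assume "z \<in> (\<lambda>(U, V). half_roots U V) ` ?H"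
      then show "z \<in> root_choices a b"
        by (auto simp: half_roots_root_choices)
    next
      fix z assume z: "z \<in> root_choices a b"
      obtain U V where "half_poly a b U V" "half_roots U V = z"
        using z by (rule half_roots_surj)
      then show "z \<in> (\<lambda>(U, V). half_roots U V) ` ?H" by auto
    qed
  qed
  have halves: "bij_betw (\<lambda>(U, V). half_class U V) ?H
      {\<aa> \<in> carrier (jacobian f). \<aa> [^]\<^bsub>jacobian f\<^esub> (2::nat) = curve_to_jacobian f (Affine a b)}"
    unfolding bij_betw_def
  proof
    show "inj_on (\<lambda>(U, V). half_class U V) ?H"
    proof (rule inj_onI, clarify)
      fix U V U' V' assume "half_poly a b U V" "half_poly a b U' V'" "half_class U V = half_class U' V'"
      then show "U = U' \<and> V = V'" by (rule half_class_inj)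
    qed
    show "(\<lambda>(U, V). half_class U V) ` ?H = {\<aa> \<in> carrier (jacobian f). \<aa> [^]\<^bsub>jacobian f\<^esub> (2::nat) = curve_to_jacobian f (Affine a b)}"
    proof (intro equalityI subsetI)
      fix z assume "z \<in> (\<lambda>(U, V). half_class U V) ` ?H"
      then show "z \<in> {\<aa> \<in> carrier (jacobian f). \<aa> [^]\<^bsub>jacobian f\<^esub> (2::nat) = curve_to_jacobian f (Affine a b)}"
      proof -
        obtain U V where "half_poly a b U V" "z = half_class U V"
          using \<open>z \<in> (\<lambda>(U, V). half_class U V) ` ?H\<close> by auto
        then show ?thesis using half_class_double[of a b U V] by simp
      qed
    next
      fix z assume z: "z \<in> {\<aa> \<in> carrier (jacobian f). \<aa> [^]\<^bsub>jacobian f\<^esub> (2::nat) = curve_to_jacobian f (Affine a b)}"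
      have "z \<in> carrier (jacobian f)" "z [^]\<^bsub>jacobian f\<^esub> (2::nat) = curve_to_jacobian f (Affine a b)"
        using z by simp_all
      then obtain U V where "half_poly a b U V" "z = half_class U V"
        by (rule half_class_surj[OF ab])
      then show "z \<in> (\<lambda>(U, V). half_class U V) ` ?H" by auto
    qed
  qed
  show ?thesis
    using bij_betw_same_card[OF roots] bij_betw_same_card[OF halves] card_root_choices[OF ab] by simp
qed

end

section \<open>Polynomials and functions over a subfield\<close>

locale subfield_set =
  fixes K0 :: "'a::field set"
  assumes zero_closed [simp]: "0 \<in> K0" and one_closed [simp]: "1 \<in> K0"
    and add_closed: "x \<in> K0 \<Longrightarrow> y \<in> K0 \<Longrightarrow> x + y \<in> K0"
    and mult_closed: "x \<in> K0 \<Longrightarrow> y \<in> K0 \<Longrightarrow> x * y \<in> K0"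
    and minus_closed: "x \<in> K0 \<Longrightarrow> - x \<in> K0"
    and inverse_closed: "x \<in> K0 \<Longrightarrow> inverse x \<in> K0"
begin

lemma diff_closed: "x \<in> K0 \<Longrightarrow> y \<in> K0 \<Longrightarrow> x - y \<in> K0"
  using add_closed[OF _ minus_closed, of x y] by simp

lemma divide_closed: "x \<in> K0 \<Longrightarrow> y \<in> K0 \<Longrightarrow> x / y \<in> K0"
  by (simp add: divide_inverse mult_closed inverse_closed)

lemma double_closed_imp: "(2::'a) \<noteq> 0 \<Longrightarrow> 2 * x \<in> K0 \<Longrightarrow> x \<in> K0"
  using divide_closed[of "2 * x" "1 + 1"] add_closed[of 1 1] by simp

lemma poly_over_0 [simp]: "poly_over K0 0"
  by (simp add: poly_over_def)

lemma poly_over_pCons [simp]: "poly_over K0 (pCons c p) \<longleftrightarrow> c \<in> K0 \<and> poly_over K0 p"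
  by (auto simp: poly_over_def coeff_pCons split: nat.splits)

lemma poly_over_1 [simp]: "poly_over K0 1"
  by (simp add: one_pCons)

lemma poly_over_add: "poly_over K0 p \<Longrightarrow> poly_over K0 q \<Longrightarrow> poly_over K0 (p + q)"
  by (simp add: poly_over_def add_closed)

lemma poly_over_diff: "poly_over K0 p \<Longrightarrow> poly_over K0 q \<Longrightarrow> poly_over K0 (p - q)"
  by (simp add: poly_over_def diff_closed)

lemma poly_over_minus: "poly_over K0 p \<Longrightarrow> poly_over K0 (- p)"
  by (simp add: poly_over_def minus_closed)

lemma poly_over_smult: "c \<in> K0 \<Longrightarrow> poly_over K0 p \<Longrightarrow> poly_over K0 (Polynomial.smult c p)"
  by (simp add: poly_over_def mult_closed)

lemma poly_over_mult: "poly_over K0 p \<Longrightarrow> poly_over K0 q \<Longrightarrow> poly_over K0 (p * q)"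
  unfolding poly_over_def
  using coeff_mult_semiring_closed[of K0 p q] add_closed mult_closed by simp

lemma poly_over_comp: "poly_over K0 p \<Longrightarrow> poly_over K0 q \<Longrightarrow> poly_over K0 (pcompose p q)"
  using poly_over_pcompose[of K0 p q] add_closed mult_closed by simp

lemma poly_over_power: "poly_over K0 p \<Longrightarrow> poly_over K0 (p ^ n)"
  by (induction n) (simp_all add: poly_over_mult)

lemma poly_over_prod: "(\<And>i. i \<in> A \<Longrightarrow> poly_over K0 (p i)) \<Longrightarrow> poly_over K0 (\<Prod>i\<in>A. p i)"
  by (induction A rule: infinite_finite_induct) (simp_all add: poly_over_mult)

lemma poly_over_monom: "c \<in> K0 \<Longrightarrow> poly_over K0 (Polynomial.monom c n)"
  by (simp add: poly_over_def coeff_monom)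

lemma poly_over_cancel:
  assumes "p \<noteq> 0" "poly_over K0 p" "poly_over K0 (p * q)"
  shows "poly_over K0 q"
  using assms(3)
proof (induction "Polynomial.degree q" arbitrary: q rule: less_induct)
  case less
  show ?case
  proof (cases "q = 0")
    case False
    define l where "l = Polynomial.monom (lead_coeff q) (Polynomial.degree q)"
    have "lead_coeff (p * q) \<in> K0" "lead_coeff p \<in> K0"
      using less.prems assms(2) by (simp_all only: poly_over_def)
    then have "lead_coeff q \<in> K0"
      using divide_closed[of "lead_coeff (p * q)" "lead_coeff p"] assms(1) by (simp add: lead_coeff_mult)
    then have l: "poly_over K0 l" unfolding l_def by (rule poly_over_monom)
    have "p * (q - l) = p * q - p * l" by (simp add: algebra_simps)
    then have over: "poly_over K0 (p * (q - l))"
      using less.prems l assms(2) by (simp add: poly_over_diff poly_over_mult)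
    have "poly_over K0 (q - l)"
    proof (cases "q - l = 0")
      case ne: False
      have "Polynomial.degree (q - l) \<le> Polynomial.degree q"
        by (rule degree_diff_le) (simp_all add: l_def degree_monom_le)
      moreover have "Polynomial.coeff (q - l) (Polynomial.degree q) = 0" by (simp add: l_def)
      ultimately have "Polynomial.degree (q - l) < Polynomial.degree q"
        using ne by (metis leading_coeff_0_iff le_neq_implies_less)
      with over show ?thesis by (rule less.hyps[rotated])
    qed (simp only: poly_over_0)
    then show ?thesis using poly_over_add[OF _ l, of "q - l"] by simp
  qed simp
qed

lemma reg_over_one [simp]: "reg_over K0 reg_one"
  by (simp add: reg_over_def reg_one_def)

lemma reg_over_poly [simp]: "reg_over K0 (p, 0) \<longleftrightarrow> poly_over K0 p"
  by (simp add: reg_over_def)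

lemma reg_over_diff: "reg_over K0 G \<Longrightarrow> reg_over K0 H \<Longrightarrow> reg_over K0 (G - H)"
  by (simp add: reg_over_def poly_over_diff)

lemma reg_over_smult: "c \<in> K0 \<Longrightarrow> reg_over K0 G \<Longrightarrow> reg_over K0 (reg_smult c G)"
  by (simp add: reg_over_def reg_smult_def poly_over_smult)

lemma reg_over_conj: "reg_over K0 G \<Longrightarrow> reg_over K0 (reg_conj G)"
  by (simp add: reg_over_def reg_conj_def poly_over_minus)

lemma reg_over_mult:
  "poly_over K0 f \<Longrightarrow> reg_over K0 G \<Longrightarrow> reg_over K0 H \<Longrightarrow> reg_over K0 (reg_mult f G H)"
  by (simp add: reg_over_def reg_mult_def poly_over_add poly_over_mult)

lemma poly_over_norm: "poly_over K0 f \<Longrightarrow> reg_over K0 G \<Longrightarrow> poly_over K0 (reg_norm f G)"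
  by (simp add: reg_over_def reg_norm_def poly_over_diff poly_over_mult poly_over_power)

lemma poly_over_pole_poly: "reg_over K0 G \<Longrightarrow> poly_over K0 (pole_poly n G)"
  by (simp add: reg_over_def pole_poly_def poly_over_add poly_over_mult poly_over_comp poly_over_monom)

end

lemma subfield_set_subfield:
  assumes "subfield K0 (ring_of_type_algebra :: 'a::field ring)"
  shows "subfield_set K0"
proof -
  let ?R = "ring_of_type_algebra :: 'a ring"
  interpret R: ring ?R by (rule ring_from_type_algebra)
  note ring = subringE[OF subfieldE(1)[OF assms]]
  have [simp]: "carrier ?R = UNIV" "\<zero>\<^bsub>?R\<^esub> = 0" "\<one>\<^bsub>?R\<^esub> = 1" "x \<otimes>\<^bsub>?R\<^esub> y = x * y" "x \<oplus>\<^bsub>?R\<^esub> y = x + y" for x y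
    by (simp_all add: ring_of_type_algebra_def)
  have neg: "\<ominus>\<^bsub>?R\<^esub> x = - x" for x by (rule R.minus_equality) simp_all
  show ?thesis
  proof
    show "0 \<in> K0" "1 \<in> K0" using ring(2,3) by simp_all
    show "x + y \<in> K0" if "x \<in> K0" "y \<in> K0" for x y using ring(7)[OF that] by simp
    show "x * y \<in> K0" if "x \<in> K0" "y \<in> K0" for x y using ring(6)[OF that] by simp
    show "- x \<in> K0" if "x \<in> K0" for x using ring(5)[OF that] neg by simp
    show "inverse x \<in> K0" if "x \<in> K0" for x
    proof (cases "x = 0")
      case False
      then show ?thesis
        using R.subfield_m_inv_simprule[OF assms, of x "inverse x"] that ring(3) by simp
    qed (use that in simp)
  qed
qed

lemma reg_smult_diff: "reg_smult c (G - H) = reg_smult c G - reg_smult c H"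
  by (simp add: reg_smult_def prod_eq_iff smult_diff_right)

lemma reg_smult_smult: "reg_smult c (reg_smult d G) = reg_smult (c * d) G"
  by (simp add: reg_smult_def)

lemma reg_smult_add_left: "reg_smult (c + d) G = reg_smult c G + reg_smult d G"
  by (simp add: reg_smult_def prod_eq_iff smult_add_left)

text \<open>
  The linear span with coefficients in the large field; the set \<open>S\<close> will consist of functions over
  the subfield.
\<close>

inductive_set kspan :: "'a::field regular set \<Rightarrow> 'a regular set" for S where
  zero: "0 \<in> kspan S"
| step: "G \<in> S \<Longrightarrow> Z \<in> kspan S \<Longrightarrow> reg_smult c G + Z \<in> kspan S"

lemma kspan_mono: "Z \<in> kspan S \<Longrightarrow> S \<subseteq> T \<Longrightarrow> Z \<in> kspan T"
  by (induction rule: kspan.induct) (auto intro: kspan.intros)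

lemma kspan_base: "G \<in> S \<Longrightarrow> G \<in> kspan S"
  using kspan.step[of G S 0 1] kspan.zero[of S] by (simp add: reg_smult_def)

lemma kspan_add: "Y \<in> kspan S \<Longrightarrow> Z \<in> kspan S \<Longrightarrow> Y + Z \<in> kspan S"
  by (induction rule: kspan.induct) (auto simp: add.assoc intro: kspan.intros)

lemma kspan_mult:
  assumes "\<And>G. G \<in> S \<Longrightarrow> reg_mult f H G \<in> S" "Z \<in> kspan S"
  shows "reg_mult f H Z \<in> kspan S"
  using assms(2)
proof (induction rule: kspan.induct)
  case (step G Z c)
  have "reg_mult f H (reg_smult c G + Z) = reg_smult c (reg_mult f H G) + reg_mult f H Z"
    by (simp add: reg_mult_def reg_smult_def prod_eq_iff algebra_simps smult_add_right)
  then show ?case using step assms(1) by (simp add: kspan.step)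
qed (simp add: kspan.zero)

lemma kspan_smult: "Z \<in> kspan S \<Longrightarrow> reg_smult c Z \<in> kspan S"
proof (induction rule: kspan.induct)
  case (step G Z d)
  have "reg_smult c (reg_smult d G + Z) = reg_smult (c * d) G + reg_smult c Z"
    by (simp add: reg_smult_def prod_eq_iff smult_add_right)
  then show ?case using step by (simp add: kspan.step)
qed (simp add: reg_smult_def kspan.zero flip: zero_prod_def)

text \<open>
  The coordinate ring is generated over the field by \<open>x\<close> and \<open>y\<close>, which are defined over every subfield.
\<close>

lemma kspan_submodule:
  assumes x: "\<And>G. G \<in> S \<Longrightarrow> reg_mult f ([:0, 1:], 0) G \<in> S" and y: "\<And>G. G \<in> S \<Longrightarrow> reg_mult f (0, 1) G \<in> S"
    and Z: "Z \<in> kspan S"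
  shows "reg_mult f H Z \<in> kspan S"
proof -
  have poly: "reg_mult f (p, 0) Y \<in> kspan S" if Y: "Y \<in> kspan S" for p Y
    using Y
  proof (induction p arbitrary: Y)
    case 0
    then show ?case using reg_mult_zero(1)[of f Y] kspan.zero[of S] by (simp add: zero_prod_def)
  next
    case (pCons c p)
    have "reg_mult f (pCons c p, 0) Y = reg_smult c Y + reg_mult f ([:0, 1:], 0) (reg_mult f (p, 0) Y)"
      by (simp add: reg_mult_def reg_smult_def prod_eq_iff algebra_simps)
    also have "\<dots> \<in> kspan S"
      using pCons by (intro kspan_add kspan_smult kspan_mult[OF x])
    finally show ?case .
  qed
  have "reg_mult f H Z = reg_mult f (fst H, 0) Z + reg_mult f (snd H, 0) (reg_mult f (0, 1) Z)"
    by (simp add: reg_mult_def prod_eq_iff algebra_simps)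
  also have "\<dots> \<in> kspan S"
    using Z by (intro kspan_add poly kspan_mult[OF y])
  finally show ?thesis .
qed

section \<open>Descent to the subfield\<close>

locale odd_curve_over = odd_curve f g + subfield_set K0
  for f :: "'a::alg_closed_field poly" and g :: nat and K0 :: "'a set" +
  assumes f_over: "poly_over K0 f"
begin

definition sections_over :: "('a point \<Rightarrow>\<^sub>0 int) \<Rightarrow> 'a regular set" where
  "sections_over A = {G \<in> sections A. reg_over K0 G}"

text \<open>
  For a divisor that is nonnegative on the affine curve, being defined over \<open>K0\<close> means that its
  ideal is locally generated by regular functions over \<open>K0\<close>, without denominators.
\<close>

definition generated_over :: "('a point \<Rightarrow>\<^sub>0 int) \<Rightarrow> bool" where
  "generated_over A \<longleftrightarrow> (\<forall>a b. b ^ 2 = poly f a \<longrightarrow>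
     (\<exists>G\<in>sections_over A. G \<noteq> 0 \<and> ord_at f (Affine a b) G = mult_at A (Affine a b)))"

lemma reg_over_cancel:
  assumes H: "H \<noteq> 0" "reg_over K0 H" and HL: "reg_over K0 (H \<star> L)"
  shows "reg_over K0 L"
proof -
  have "(reg_norm f H, 0) \<star> L = reg_conj H \<star> (H \<star> L)"
    by (simp only: reg_mult_assoc[symmetric] reg_mult_conj)
  then have "reg_over K0 ((reg_norm f H, 0) \<star> L)"
    using reg_over_mult[OF f_over reg_over_conj[OF H(2)] HL] by simp
  then show ?thesis
    using poly_over_cancel[of "reg_norm f H"] H poly_over_norm[OF f_over H(2)]
    by (simp add: reg_mult_poly reg_over_def)
qed

lemma sections_over_diff:
  "affine_nonneg A \<Longrightarrow> G \<in> sections_over A \<Longrightarrow> H \<in> sections_over A \<Longrightarrow> G - H \<in> sections_over A"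
  by (simp add: sections_over_def sections_diff reg_over_diff)

lemma sections_over_smult:
  "affine_nonneg A \<Longrightarrow> c \<in> K0 \<Longrightarrow> G \<in> sections_over A \<Longrightarrow> reg_smult c G \<in> sections_over A"
  by (simp add: sections_over_def sections_smult reg_over_smult)

lemma sections_over_mult:
  "affine_nonneg A \<Longrightarrow> reg_over K0 H \<Longrightarrow> G \<in> sections_over A \<Longrightarrow> H \<star> G \<in> sections_over A"
  using sections_submodule[of A] by (simp add: sections_over_def reg_submodule_def reg_over_mult[OF f_over])

lemma kspan_sections_over_submodule:
  assumes "affine_nonneg A"
  shows "reg_submodule (kspan (sections_over A))"
  unfolding reg_submodule_def
proof (intro conjI ballI allI)
  show "0 \<in> kspan (sections_over A)" by (rule kspan.zero)
next
  fix G H assume "G \<in> kspan (sections_over A)"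
  then show "H \<star> G \<in> kspan (sections_over A)"
    by (intro kspan_submodule sections_over_mult assms) (simp_all add: reg_over_def)
qed (rule kspan_add)

text \<open>
  Linear algebra over \<open>K0\<close>: by elimination, generators over \<open>K0\<close> can be given distinct pole orders,
  and then a \<open>K\<close>-linear combination has the pole order of one of them.
\<close>

lemma pole_order_kspan_bounded:
  assumes A: "affine_nonneg A" and Z: "Z \<in> kspan {G \<in> sections_over A. G = 0 \<or> pole G < N}" "Z \<noteq> 0"
  shows "\<exists>G\<in>sections_over A. G \<noteq> 0 \<and> pole G = pole Z"
  using Z
proof (induction N arbitrary: Z)
  case 0
  have "Y = 0" if "Y \<in> kspan {G \<in> sections_over A. G = 0 \<or> pole G < 0}" for Y
    using that by (induction rule: kspan.induct) auto
  with 0 show ?case by blast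
next
  case (Suc N)
  let ?T = "\<lambda>N. {G \<in> sections_over A. G = 0 \<or> pole G < N}"
  have small: "Y = 0 \<or> pole Y < N" if "Y \<in> kspan (?T N)" for Y
    using that
  proof (induction rule: kspan.induct)
    case (step G Z c)
    have *: "Polynomial.degree (ppoly H) < N" if "H = 0 \<or> pole H < N" "N > 0" for H
      using that by (auto simp: pole_eq_degree_ppoly)
    show ?case
    proof (cases "N = 0")
      case False
      then have "Polynomial.degree (ppoly (reg_smult c G) + ppoly Z) < N"
        using *[of G] *[of Z] step by (intro degree_add_less) (auto intro: le_less_trans[OF degree_smult_le])
      then show ?thesis by (simp add: pole_eq_degree_ppoly)
    next
      case True
      with step show ?thesis by auto
    qed
  qed simp
  show ?case
  proof (cases "\<exists>G1\<in>sections_over A. G1 \<noteq> 0 \<and> pole G1 = N")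
    case False
    then have "?T (Suc N) = ?T N" by (auto simp: less_Suc_eq)
    with Suc show ?thesis by simp
  next
    case True
    then obtain G1 where G1: "G1 \<in> sections_over A" "G1 \<noteq> 0" "pole G1 = N" by blast
    have lc: "Polynomial.coeff (ppoly G) i \<in> K0" if "G \<in> sections_over A" for G i
      using poly_over_pole_poly[of G] that by (simp add: sections_over_def poly_over_def)
    have "\<exists>c. \<exists>Y\<in>kspan (?T N). Z = reg_smult c G1 + Y" if "Z \<in> kspan (?T (Suc N))" for Z
      using that
    proof (induction rule: kspan.induct)
      case zero
      show ?case by (intro exI[of _ 0] bexI[of _ 0] kspan.zero) (simp add: reg_smult_def zero_prod_def)
    next
      case (step G Z c)
      then obtain e Y where Y: "Y \<in> kspan (?T N)" "Z = reg_smult e G1 + Y" by blast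
      show ?case
      proof (cases "G = 0 \<or> pole G < N")
        case True
        with step have "G \<in> ?T N" by simp
        then have "reg_smult c G + Y \<in> kspan (?T N)" using Y(1) by (rule kspan.step)
        moreover have "reg_smult c G + Z = reg_smult e G1 + (reg_smult c G + Y)"
          using Y(2) by (simp add: algebra_simps)
        ultimately show ?thesis by (intro exI[of _ e] bexI[of _ "reg_smult c G + Y"])
      next
        case False
        with step have G: "G \<in> sections_over A" "G \<noteq> 0" "pole G = N" by auto
        define k where "k = lead_coeff (ppoly G) / lead_coeff (ppoly G1)"
        have k: "k \<in> K0" unfolding k_def using lc[OF G(1)] lc[OF G1(1)] by (rule divide_closed)
        let ?D = "G - reg_smult k G1"
        have "?D \<in> sections_over A" using A G G1 k by (intro sections_over_diff sections_over_smult)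
        moreover have "?D = 0 \<or> pole ?D < N"
        proof (cases "?D = 0")
          case ne: False
          have "Polynomial.degree (ppoly ?D) \<le> N"
            using G(3) G1(3) degree_smult_le[of k "ppoly G1"]
            by (simp only: pole_poly_diff pole_poly_smult) (rule degree_diff_le, auto simp: pole_eq_degree_ppoly)
          moreover have "Polynomial.coeff (ppoly G1) N \<noteq> 0"
            using G1(2) unfolding G1(3)[symmetric] pole_eq_degree_ppoly by simp
          then have "Polynomial.coeff (ppoly ?D) N = 0"
            using G(3) G1(3) by (simp add: k_def pole_eq_degree_ppoly)
          moreover have "Polynomial.coeff (ppoly ?D) (Polynomial.degree (ppoly ?D)) \<noteq> 0"
            using ne by (simp only: leading_coeff_0_iff ppoly_eq_0_iff not_False_eq_True)
          ultimately have "pole ?D < N"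
            unfolding pole_eq_degree_ppoly by (cases "Polynomial.degree (ppoly ?D) = N") (simp, linarith)
          then show ?thesis ..
        qed simp
        ultimately have "reg_smult c ?D + Y \<in> kspan (?T N)" using Y(1) by (intro kspan.step) simp_all
        moreover have "reg_smult c G + Z = reg_smult (c * k + e) G1 + (reg_smult c ?D + Y)"
          unfolding Y(2) reg_smult_diff reg_smult_smult reg_smult_add_left by (simp only: algebra_simps)
        ultimately show ?thesis by (intro exI[of _ "c * k + e"] bexI[of _ "reg_smult c ?D + Y"])
      qed
    qed
    with Suc.prems obtain c Y where Y: "Y \<in> kspan (?T N)" "Z = reg_smult c G1 + Y" by blast
    show ?thesis
    proof (cases "c = 0")
      case True
      then have "Z = Y" using Y(2) by simp
      with Suc.IH[OF Y(1)] Suc.prems(2) show ?thesis by simp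
    next
      case c: False
      have "pole Z = N"
      proof (cases "Y = 0")
        case True
        then have "Z = reg_smult c G1" using Y(2) by simp
        then show ?thesis using pole_smult[OF c, of G1] G1(3) by (simp only:)
      next
        case False
        then have "pole Y < N" using small[OF Y(1)] by blast
        then have "Polynomial.degree (ppoly Y) < Polynomial.degree (ppoly (reg_smult c G1))"
          using pole_smult[OF c, of G1] G1(3) by (simp only: pole_eq_degree_ppoly)
        then have "pole Z = pole (reg_smult c G1)"
          unfolding Y(2) pole_eq_degree_ppoly pole_poly_add by (rule degree_add_eq_left)
        then show ?thesis using pole_smult[OF c, of G1] G1(3) by (simp only:)
      qed
      with G1 show ?thesis by (intro bexI[of _ G1]) (simp_all only: simp_thms)
    qed
  qed
qed

lemma kspan_bounded:
  assumes "Z \<in> kspan S"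
  shows "\<exists>N. Z \<in> kspan {G \<in> S. G = 0 \<or> pole G < N}"
  using assms
proof (induction rule: kspan.induct)
  case zero
  show ?case by (intro exI kspan.zero)
next
  case (step G Z c)
  then obtain N where N: "Z \<in> kspan {G \<in> S. G = 0 \<or> pole G < N}" by blast
  let ?M = "max N (Suc (pole G))"
  have "Z \<in> kspan {G \<in> S. G = 0 \<or> pole G < ?M}" using N by (rule kspan_mono) auto
  moreover have "G \<in> {G \<in> S. G = 0 \<or> pole G < ?M}" using step by (simp add: less_max_iff_disj)
  ultimately have "reg_smult c G + Z \<in> kspan {G \<in> S. G = 0 \<or> pole G < ?M}" by (intro kspan.step)
  then show ?case by blast
qed

lemma generated_overE:
  assumes "generated_over A" "b ^ 2 = poly f a"
  obtains G where "G \<in> sections_over A" "G \<noteq> 0" "ord_at f (Affine a b) G = mult_at A (Affine a b)"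
proof -
  from assms(1)[unfolded generated_over_def, rule_format, OF assms(2)]
  obtain G where "G \<in> sections_over A" "G \<noteq> 0 \<and> ord_at f (Affine a b) G = mult_at A (Affine a b)"
    by (rule bexE)
  then show thesis using that[of G] by simp
qed

text \<open>
  If a divisor is defined over \<open>K0\<close>, its sections over \<open>K0\<close> generate the module of all sections,
  as they do so locally at each point.
\<close>

lemma descent:
  assumes A: "affine_nonneg A" and gen: "generated_over A" and G: "G \<in> sections A" "G \<noteq> 0"
  obtains G0 where "G0 \<in> sections A" "reg_over K0 G0" "G0 \<noteq> 0" "pole G0 = pole G"
proof -
  have "G \<in> kspan (sections_over A)"
  proof (rule local_global[OF kspan_sections_over_submodule[OF A] G(2)])
    fix a b assume ab: "b ^ 2 = poly f a"
    with gen obtain L where L: "L \<in> sections_over A" "L \<noteq> 0"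
        "ord_at f (Affine a b) L = mult_at A (Affine a b)"
      by (rule generated_overE)
    have "mult_at A (Affine a b) \<le> ord_at f (Affine a b) G"
      using G ab by (simp add: sections_def)
    then have "ord_at f (Affine a b) L \<le> ord_at f (Affine a b) G" unfolding L(3) .
    with L(2) show "\<exists>L\<in>kspan (sections_over A). L \<noteq> 0 \<and> ord_at f (Affine a b) L \<le> ord_at f (Affine a b) G"
      by (intro bexI[OF _ kspan_base[OF L(1)]] conjI)
  qed
  from kspan_bounded[OF this]
  obtain N where "G \<in> kspan {G \<in> sections_over A. G = 0 \<or> pole G < N}" by (rule exE)
  from pole_order_kspan_bounded[OF A this G(2)]
  obtain G0 where "G0 \<in> sections_over A" "G0 \<noteq> 0 \<and> pole G0 = pole G" by (rule bexE)
  then show thesis using that[of G0] by (simp add: sections_over_def)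
qed

lemma generated_over_add:
  assumes "generated_over A" "generated_over B"
  shows "generated_over (A + B)"
  unfolding generated_over_def
proof (intro allI impI)
  fix a b assume ab: "b ^ 2 = poly f a"
  obtain G where G: "G \<in> sections_over A" "G \<noteq> 0" "ord_at f (Affine a b) G = mult_at A (Affine a b)"
    using assms(1) ab by (rule generated_overE)
  obtain H where H: "H \<in> sections_over B" "H \<noteq> 0" "ord_at f (Affine a b) H = mult_at B (Affine a b)"
    using assms(2) ab by (rule generated_overE)
  have "G \<star> H \<in> sections_over (A + B)"
    using G H reg_over_mult[OF f_over]
    by (auto simp: sections_over_def sections_def ord_at_mult lookup_add intro: add_mono)
  moreover have "ord_at f (Affine a b) (G \<star> H) = mult_at (A + B) (Affine a b)"
    using ab G H by (simp add: ord_at_mult lookup_add)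
  ultimately show "\<exists>G\<in>sections_over (A + B). G \<noteq> 0 \<and> ord_at f (Affine a b) G = mult_at (A + B) (Affine a b)"
    using G H by (intro bexI[of _ "G \<star> H"]) simp_all
qed

text \<open>The maximal ideal of a point over \<open>K0\<close> is generated by \<open>x - a\<close> and \<open>y - b\<close>.\<close>

lemma generated_over_point:
  assumes "a \<in> K0" "b \<in> K0" "b ^ 2 = poly f a"
  shows "generated_over (frag_of (Affine a b) - frag_of Infinity)"
  unfolding generated_over_def
proof (intro allI impI)
  let ?A = "frag_of (Affine a b) - frag_of (Infinity :: 'a point)"
  fix c d assume cd: "d ^ 2 = poly f c"
  have look: "mult_at ?A (Affine c' d') = (if c' = a \<and> d' = b then 1 else 0)" for c' d'
    by (auto simp: lookup_minus lookup_single when_def)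
  have sec: "G \<in> sections_over ?A" if "reg_over K0 G" "reg_eval G a b = 0" "G \<noteq> 0" for G
  proof -
    have "(if c' = a \<and> d' = b then 1 else 0) \<le> ord_at f (Affine c' d') G" if "d' ^ 2 = poly f c'" for c' d'
      using ord_at_affine_nonneg[OF that \<open>G \<noteq> 0\<close>] ord_at_eq_0_iff[OF that \<open>G \<noteq> 0\<close>] \<open>reg_eval G a b = 0\<close> by auto
    then show ?thesis using that(1) unfolding sections_over_def sections_def look by simp
  qed
  have "\<exists>G. reg_over K0 G \<and> reg_eval G a b = 0 \<and> G \<noteq> 0 \<and> ord_at f (Affine c d) G = (if c = a \<and> d = b then 1 else 0)"
  proof (cases "c = a \<and> d = b")
    case True
    moreover have "reg_over K0 (local_param a b)"
      using assms by (simp add: minus_closed local_param_def reg_over_def)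
    ultimately show ?thesis
      using ord_at_local_param[OF cd] local_param_neq_0[of a b] by (intro exI[of _ "local_param a b"]) simp
  next
    case ne: False
    have "\<exists>G. reg_over K0 G \<and> reg_eval G a b = 0 \<and> reg_eval G c d \<noteq> 0"
    proof (cases "c = a")
      case True
      with ne show ?thesis
        using assms by (intro exI[of _ "([:- b:], 1)"]) (simp add: reg_over_def reg_eval_def minus_closed)
    next
      case False
      then show ?thesis
        using assms by (intro exI[of _ "([:- a, 1:], 0)"]) (simp add: minus_closed)
    qed
    then obtain G where G: "reg_over K0 G" "reg_eval G a b = 0" "reg_eval G c d \<noteq> 0" by blast
    then have "G \<noteq> 0" by (metis reg_eval_zero)
    then show ?thesis using ord_at_eq_0_iff[OF cd, of G] G ne by (intro exI[of _ G]) auto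
  qed
  then obtain G where "reg_over K0 G" "reg_eval G a b = 0" "G \<noteq> 0"
    "ord_at f (Affine c d) G = (if c = a \<and> d = b then 1 else 0)" by blast
  then show "\<exists>G\<in>sections_over ?A. G \<noteq> 0 \<and> ord_at f (Affine c d) G = mult_at ?A (Affine c d)"
    unfolding look by (intro bexI[of _ G] sec conjI)
qed

text \<open>
  A rational divisor is made nonnegative by adding the divisors of the norms of the denominators
  of its local generators. These norms are polynomials over \<open>K0\<close>, so the new divisor is rational
  too, and its local generators are regular.
\<close>

lemma exists_generated_over:
  assumes "\<aa> \<in> jacobian_over f K0"
  obtains D where "D \<in> Div0" "affine_nonneg D" "generated_over D" "\<aa> = cl f D"
proof -
  obtain E where E: "E \<in> Div0" "divisor_over f K0 E" "\<aa> = cl f E"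
    using assms by (auto simp: jacobian_over_def)
  define gen where "gen Q G H \<longleftrightarrow> reg_over K0 G \<and> reg_over K0 H \<and> G \<noteq> 0 \<and> H \<noteq> 0 \<and>
        (\<forall>P\<in>curve f - {Infinity}. mult_at E P \<le> ord_at f P G - ord_at f P H) \<and>
        mult_at E Q = ord_at f Q G - ord_at f Q H" for Q G H
  have "\<exists>G H. gen Q G H" if "Q \<in> curve f - {Infinity}" for Q
    using E(2) that unfolding divisor_over_def gen_def zero_prod_def[symmetric] by blast
  then obtain num den where gen: "\<And>Q. Q \<in> curve f - {Infinity} \<Longrightarrow> gen Q (num Q) (den Q)" by metis
  have keys: "Poly_Mapping.keys E \<subseteq> curve f" using E(1) by (simp add: Div0_iff)
  define h where "h Q = reg_norm f (den Q)" for Q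
  define p where "p = (\<Prod>P\<in>Poly_Mapping.keys E - {Infinity}. h P)"
  have nn: "affine_nonneg (E + dv (p, 0))"
    unfolding p_def
  proof (rule shift_affine_nonneg[OF E(1)])
    fix P assume P: "P \<in> Poly_Mapping.keys E - {Infinity}"
    then have g: "gen P (num P) (den P)" and c: "P \<in> curve f" using gen keys by auto
    obtain a b where ab: "P = Affine a b" "b ^ 2 = poly f a" using P c by (cases P) auto
    have ne: "num P \<noteq> 0" "den P \<noteq> 0" using g by (simp_all add: gen_def)
    have "ord_at f P (h P, 0) = ord_at f P (reg_conj (den P)) + ord_at f P (den P)"
      unfolding h_def reg_mult_conj[symmetric] using ne c by (simp add: ord_at_mult)
    moreover have "ord_at f P (reg_conj (den P)) \<ge> 0" "ord_at f P (num P) \<ge> 0"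
      using ne ord_at_affine_nonneg[OF ab(2)] by (simp_all add: ab(1))
    ultimately show "h P \<noteq> 0 \<and> mult_at E P + ord_at f P (h P, 0) \<ge> 0"
      using g ne by (simp add: gen_def h_def)
  qed
  have p_over: "poly_over K0 p"
    unfolding p_def h_def
    using gen keys by (intro poly_over_prod poly_over_norm[OF f_over]) (auto simp: gen_def)
  have p0: "(p, 0) \<noteq> (0 :: 'a regular)"
    using gen keys by (auto simp: p_def h_def zero_prod_def gen_def)
  define D where "D = E + dv (p, 0)"
  have D: "D \<in> Div0" unfolding D_def using E(1) dv_Div0[OF p0] by (rule Div0_add)
  moreover have "affine_nonneg D" using nn by (simp add: D_def)
  moreover have "generated_over D"
    unfolding generated_over_def
  proof (intro allI impI)
    fix a b assume ab: "b ^ 2 = poly f a"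
    let ?Q = "Affine a b"
    have g: "gen ?Q (num ?Q) (den ?Q)" using gen ab by simp
    let ?G = "num ?Q" and ?H = "den ?Q"
    have GH: "?G \<noteq> 0" "?H \<noteq> 0" "reg_over K0 ?G" "reg_over K0 ?H" using g by (simp_all add: gen_def)
    have le: "mult_at D P \<le> mult_at (dv ((p, 0) \<star> ?G) - dv ?H) P" if "P \<noteq> Infinity" for P
    proof (cases "P \<in> curve f")
      case True
      then have "mult_at E P \<le> ord_at f P ?G - ord_at f P ?H" using g that by (simp add: gen_def)
      then show ?thesis using True GH p0
        by (simp add: D_def lookup_add lookup_minus lookup_dv ord_at_mult)
    next
      case False
      then have "P \<notin> Poly_Mapping.keys E" using keys by blast
      then show ?thesis using False GH p0
        by (simp add: D_def lookup_add lookup_minus lookup_dv in_keys_iff)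
    qed
    then have "affine_nonneg (dv ((p, 0) \<star> ?G) - dv ?H)"
      using \<open>affine_nonneg D\<close> unfolding affine_nonneg_def by (meson order_trans)
    moreover have "(p, 0) \<star> ?G \<noteq> 0" using p0 GH by simp
    ultimately obtain L where L: "L \<noteq> 0" "(p, 0) \<star> ?G = ?H \<star> L" "dv L = dv ((p, 0) \<star> ?G) - dv ?H"
      using reg_quotient[of "(p, 0) \<star> ?G" ?H] GH by blast
    have "reg_over K0 ((p, 0) \<star> ?G)" using reg_over_mult[OF f_over _ GH(3)] p_over by simp
    then have "reg_over K0 L" using reg_over_cancel[OF GH(2,4)] L(2) by simp
    moreover have "L \<in> sections D"
      using sections_iff_dv[OF L(1) D] le unfolding affine_nonneg_def L(3)[symmetric] by (simp add: lookup_minus)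
    moreover have "ord_at f ?Q L = mult_at D ?Q"
    proof -
      have "ord_at f ?Q L = mult_at (dv L) ?Q" using ab L(1) by (simp add: lookup_dv)
      also have "\<dots> = mult_at D ?Q"
        using g ab p0 GH unfolding L(3) by (simp add: D_def lookup_add lookup_minus lookup_dv ord_at_mult gen_def)
      finally show ?thesis .
    qed
    ultimately show "\<exists>G\<in>sections_over D. G \<noteq> 0 \<and> ord_at f ?Q G = mult_at D ?Q"
      using L(1) by (intro bexI[of _ L]) (simp_all add: sections_over_def)
  qed
  moreover have "cl f D = cl f E"
    using cl_eq_iff[OF D E(1)] dv_principal[OF p0] by (simp add: D_def)
  ultimately show thesis using that E(3) by metis
qed

text \<open>
  The functions \<open>G\<close> and \<open>H\<close> from which \<open>y - V\<close> is constructed can be replaced by functions over \<open>K0\<close> with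
  the same pole orders. For \<open>H\<close> this fixes the divisor: the new function vanishes at least on
  \<open>2 D + (a, - b)\<close>, and its pole order leaves no room for further zeros. The quotient
  \<open>G\<^sup>2 (x - a) / H\<close>, a multiple of \<open>y - V\<close>, is then defined over \<open>K0\<close>.
\<close>

lemma half_poly_over:
  assumes ab: "a \<in> K0" "b \<in> K0" and h: "half_poly a b U V" and rat: "half_class U V \<in> jacobian_over f K0"
  shows "poly_over K0 V"
proof -
  note P = half_poly_on_curve[OF h]
  obtain D where D: "D \<in> Div0" "affine_nonneg D" "generated_over D" "half_class U V = cl f D"
    using exists_generated_over[OF rat] .
  obtain H where H: "H \<noteq> 0" "dv H = D + D + frag_of (Affine a (- b)) - frag_of Infinity"
    using half_class_double(2)[OF h] unfolding D(4) by (rule half_relation[OF P D(1,2)])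
  let ?E = "D + D + (frag_of (Affine a (- b)) - frag_of (Infinity :: 'a point))"
  have dvH: "dv H = ?E" using H(2) by simp
  have E: "?E \<in> Div0" "affine_nonneg ?E" unfolding dvH[symmetric] by (rule dv_Div0[OF H(1)], rule affine_nonneg_dv[OF H(1)])
  have "generated_over ?E"
    using D(3) generated_over_point[of a "- b"] ab P by (intro generated_over_add) (simp_all add: minus_closed)
  moreover have "H \<in> sections ?E"
    using sections_iff_dv[OF H(1) E(1)] by (simp add: dvH affine_nonneg_def)
  ultimately obtain H0 where H0: "H0 \<in> sections ?E" "reg_over K0 H0" "H0 \<noteq> 0" "pole H0 = pole H"
    using H(1) by (rule descent[OF E(2)])
  have "dv H0 = ?E"
  proof -
    have F: "dv H0 - ?E \<in> Div0" using Div0_diff[OF dv_Div0[OF H0(3)] E(1)] .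
    have inf: "mult_at (dv H0 - ?E) Infinity = 0"
      unfolding dvH[symmetric] using H0(4) by (simp add: lookup_minus lookup_dv_Infinity H0(3) H(1))
    have nn: "affine_nonneg (dv H0 - ?E)" using sections_iff_dv[OF H0(3) E(1)] H0(1) by simp
    have "mult_at (dv H0 - ?E) P \<ge> 0" for P
      using nn inf by (cases "P = Infinity") (simp_all add: affine_nonneg_def)
    then have "dv H0 - ?E = 0" using F by (intro effective_degree_0) (simp_all add: Div0_iff)
    then show ?thesis by simp
  qed
  then have dvH0: "dv H0 = D + D + frag_of (Affine a (- b)) - frag_of Infinity" by simp
  obtain G where G: "G \<in> sections D" "G \<noteq> 0" "int (pole G) \<le> int g - mult_at D Infinity"
    using exists_section[OF D(2,1)] by blast
  obtain G0 where G0: "G0 \<in> sections D" "reg_over K0 G0" "G0 \<noteq> 0" "pole G0 = pole G"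
    using descent[OF D(2,3) G(1,2)] .
  have "int (pole G0) \<le> int g - mult_at D Infinity" unfolding G0(4) by (rule G(3))
  then obtain U' V' v where V': "v \<noteq> 0" "half_poly a b U' V'"
      "G0 \<star> G0 \<star> ([:- a, 1:], 0) = H0 \<star> reg_smult v (- V', 1)" "cl f D = half_class U' V'"
    using H0(3) dvH0 by (rule extract_half_poly[OF P D(1,2) G0(3,1)])
  have "V' = V" using half_class_inj[OF h V'(2)] D(4) V'(4) by simp
  have "reg_over K0 (H0 \<star> reg_smult v (- V', 1))"
    unfolding V'(3)[symmetric] using G0(2) ab by (intro reg_over_mult f_over) (simp_all add: minus_closed)
  then have over: "reg_over K0 (reg_smult v (- V', 1))" by (rule reg_over_cancel[OF H0(3,2)])
  then have v: "v \<in> K0" and vV: "poly_over K0 (Polynomial.smult v V')"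
    using poly_over_minus[of "- Polynomial.smult v V'"]
    by (simp_all add: reg_over_def reg_smult_def one_pCons)
  have "V' = Polynomial.smult (inverse v) (Polynomial.smult v V')" using V'(1) by simp
  then have "poly_over K0 V'" using poly_over_smult[OF inverse_closed[OF v] vV] by simp
  then show ?thesis using \<open>V' = V\<close> by simp
qed

text \<open>
  The class is represented by the divisor with Mumford representation \<open>(U, - V)\<close> minus \<open>g \<infinity>\<close>, since the
  divisors with representations \<open>(U, V)\<close> and \<open>(U, - V)\<close> add up to the zeros of \<open>U\<close>. Its ideal is generated
  by \<open>U\<close> and \<open>y + V\<close>: at a zero of \<open>y + V\<close> the order of \<open>U\<close> is the right one, and elsewhere \<open>y + V\<close> is a unit.
\<close>

lemma half_class_over:
  assumes h: "half_poly a b U V" and over: "poly_over K0 U" "poly_over K0 V"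
  shows "half_class U V \<in> jacobian_over f K0"
proof -
  let ?I = "frag_of (Infinity :: 'a point)"
  let ?D = "half_div U (- V) - frag_cmul (int g) ?I"
  note h' = half_poly_conj[OF h]
  have U: "U \<noteq> 0" using h by (rule half_poly_U)
  have U0: "(U, 0) \<noteq> (0 :: 'a regular)" and y0: "(V, 1) \<noteq> (0 :: 'a regular)" using U by (simp_all add: zero_prod_def)
  have D: "?D \<in> Div0" using Div0_uminus[OF half_class_Div0[OF h']] by simp
  have "?D - (frag_cmul (int g) ?I - half_div U V) = dv (U, 0)"
    unfolding dv_U[OF h] by (rule poly_mapping_eqI) (simp add: lookup_add lookup_minus algebra_simps)
  then have cl: "half_class U V = cl f ?D"
    using cl_eq_iff[OF D half_class_Div0[OF h]] dv_principal[OF U0] by (simp add: half_class_def)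
  have "divisor_over f K0 ?D"
    unfolding divisor_over_def zero_prod_def[symmetric]
  proof
    fix Q assume "Q \<in> curve f - {Infinity}"
    then obtain c d where Q: "Q = Affine c d" "d ^ 2 = poly f c" by (cases Q) auto
    have look: "mult_at ?D (Affine c d) = (if d = - poly V c then int (Polynomial.order c U) else 0)" for c d
      using U by (simp add: lookup_minus lookup_half_div lookup_single)
    have oU: "ord_at f (Affine c d) (U, 0) = mult_at ?D (Affine c d) +
       (if d = poly V c then int (Polynomial.order c U) else 0)" if "d ^ 2 = poly f c" for c d
      using lookup_dv[OF U0, of "Affine c d"] that U unfolding dv_U[OF h]
      by (simp add: lookup_add lookup_minus lookup_half_div lookup_single)
    have oy: "ord_at f (Affine c d) (V, 1) = 2 * mult_at ?D (Affine c d) +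
       (if d = - poly V c \<and> c = a then 1 else 0)" if "d ^ 2 = poly f c" for c d
      using ord_at_graph[OF h' that] by (simp add: look)
    have le: "mult_at ?D P \<le> ord_at f P (U, 0)" "mult_at ?D P \<le> ord_at f P (V, 1)"
      if P: "P \<in> curve f - {Infinity}" for P
    proof -
      from P obtain c d where P: "P = Affine c d" "d ^ 2 = poly f c" by (cases P) auto
      show "mult_at ?D P \<le> ord_at f P (U, 0)" "mult_at ?D P \<le> ord_at f P (V, 1)"
        unfolding P(1) oU[OF P(2)] oy[OF P(2)] by (simp_all add: look)
    qed
    have one: "ord_at f P reg_one = 0" if "P \<in> curve f" for P
      using ord_at_const[OF that, of 1] by (simp add: reg_one_def one_pCons)
    show "\<exists>G H. reg_over K0 G \<and> reg_over K0 H \<and> G \<noteq> 0 \<and> H \<noteq> 0 \<and>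
        (\<forall>P\<in>curve f - {Infinity}. mult_at ?D P \<le> ord_at f P G - ord_at f P H) \<and>
        mult_at ?D Q = ord_at f Q G - ord_at f Q H"
    proof (cases "d = - poly V c")
      case True
      have "poly U c \<noteq> 0" if "d = poly V c"
      proof -
        have "poly V c = 0" using that True double_neq[of "poly V c"] by auto
        then show ?thesis using half_poly_branch(1)[OF h] Q(2) True by simp
      qed
      then have "(if d = poly V c then int (Polynomial.order c U) else 0) = 0" by (auto simp: order_0I)
      then have "mult_at ?D Q = ord_at f Q (U, 0)" unfolding Q(1) oU[OF Q(2)] by simp
      then show ?thesis
        using le(1) U0 over Q by (intro exI[of _ "(U, 0)"] exI[of _ reg_one]) (auto simp: one reg_one_neq_0)
    next
      case False
      then have "mult_at ?D Q = ord_at f Q (V, 1)" unfolding Q(1) oy[OF Q(2)] by (simp add: look)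
      moreover have "reg_over K0 (V, 1)" using over by (simp add: reg_over_def)
      ultimately show ?thesis
        using le(2) y0 Q by (intro exI[of _ "(V, 1)"] exI[of _ reg_one]) (auto simp: one reg_one_neq_0)
    qed
  qed
  with D show ?thesis unfolding cl jacobian_over_def by blast
qed

end

section \<open>Division by two over the subfield\<close>

locale split_odd_curve_over = odd_curve_over f g K0 + split_odd_curve f g \<alpha> Idx
  for f :: "'a::alg_closed_field poly" and g :: nat and K0 :: "'a set" and \<alpha> :: "'i \<Rightarrow> 'a" and Idx :: "'i set"
begin

text \<open>
  The polynomial \<open>W(t) + W(- t) = 2 V(a - t\<^sup>2)\<close> has the coefficient \<open>2 (\<Sum>i. r\<^sub>i)\<close> at \<open>t ^ (2 g)\<close>.
\<close>

lemma sum_roots_over: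
  assumes a: "a \<in> K0" and h: "half_poly a b U V" and V: "poly_over K0 V"
  shows "(\<Sum>i\<in>Idx. half_roots U V i) \<in> K0"
proof -
  let ?r = "half_roots U V"
  have refl: "pcompose (half_W a U V) [:0, - 1:] = (\<Prod>i\<in>Idx. [:?r i, - 1:])"
    unfolding half_W_eq_prod[OF h] pcompose_prod by (simp add: pcompose_pCons)
  have "half_W a U V + pcompose (half_W a U V) [:0, - 1:] =
      pcompose V [:a, 0, - 1:] + pcompose V [:a, 0, - 1:]"
    unfolding half_W_reflect unfolding half_W_alt by simp
  then have "Polynomial.coeff (half_W a U V + pcompose (half_W a U V) [:0, - 1:]) (2 * g) =
      2 * Polynomial.coeff (pcompose V [:a, 0, - 1:]) (2 * g)" by (simp only: coeff_add mult_2)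
  moreover have "Polynomial.coeff (half_W a U V) (2 * g) = (\<Sum>i\<in>Idx. ?r i)"
    using coeff_prod_linear[of Idx ?r 1] card_Idx unfolding half_W_eq_prod[OF h] by simp
  moreover have "Polynomial.coeff (pcompose (half_W a U V) [:0, - 1:]) (2 * g) = (\<Sum>i\<in>Idx. ?r i)"
    using coeff_prod_linear[of Idx ?r "-1"] card_Idx unfolding refl by simp
  ultimately have "2 * (\<Sum>i\<in>Idx. ?r i) = 2 * Polynomial.coeff (pcompose V [:a, 0, - 1:]) (2 * g)"
    by simp
  then have "(\<Sum>i\<in>Idx. ?r i) = Polynomial.coeff (pcompose V [:a, 0, - 1:]) (2 * g)"
    using two_neq_0 by simp
  moreover have "poly_over K0 (pcompose V [:a, 0, - 1:])"
    using a V by (intro poly_over_comp) (simp_all add: minus_closed)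
  ultimately show ?thesis by (simp add: poly_over_def)
qed

lemma flip_two_signs:
  assumes r: "r \<in> root_choices a b" and ij: "i \<in> Idx" "j \<in> Idx" "i \<noteq> j"
  shows "r(i := - r i, j := - r j) \<in> root_choices a b"
    and "(\<Sum>k\<in>Idx. r k) - (\<Sum>k\<in>Idx. (r(i := - r i, j := - r j)) k) = 2 * (r i + r j)"
proof -
  let ?s = "r(i := - r i, j := - r j)"
  have I: "Idx = insert i (insert j (Idx - {i, j}))" using ij by auto
  have rest: "(\<Prod>k\<in>Idx - {i, j}. ?s k) = (\<Prod>k\<in>Idx - {i, j}. r k)"
    "(\<Sum>k\<in>Idx - {i, j}. ?s k) = (\<Sum>k\<in>Idx - {i, j}. r k)" by (auto intro: prod.cong sum.cong)
  have split: "(\<Prod>k\<in>Idx. t k) = t i * (t j * (\<Prod>k\<in>Idx - {i, j}. t k))"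
    "(\<Sum>k\<in>Idx. t k) = t i + (t j + (\<Sum>k\<in>Idx - {i, j}. t k))" for t :: "'i \<Rightarrow> 'a"
    by (subst I, use ij in simp)+
  have "(\<Prod>k\<in>Idx. ?s k) = (\<Prod>k\<in>Idx. r k)" unfolding split rest using ij by simp
  moreover have "?s \<in> (\<Pi>\<^sub>E i\<in>Idx. {z. z ^ 2 = a - \<alpha> i})"
    using r ij by (auto simp: root_choices_def PiE_def Pi_def extensional_def)
  ultimately show "?s \<in> root_choices a b" using r by (simp add: root_choices_def)
  show "(\<Sum>k\<in>Idx. r k) - (\<Sum>k\<in>Idx. ?s k) = 2 * (r i + r j)"
    unfolding split rest using ij by (simp add: algebra_simps)
qed

theorem halves_over_iff:
  assumes g: "g \<ge> 1" and a: "a \<in> K0" and b: "b \<in> K0" and ab: "b ^ 2 = poly f a"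
  shows "(\<forall>i\<in>Idx. \<alpha> i \<in> K0 \<and> (\<exists>c\<in>K0. a - \<alpha> i = c ^ 2)) \<longleftrightarrow>
    (\<forall>\<aa>\<in>carrier (jacobian f).
       \<aa> [^]\<^bsub>jacobian f\<^esub> (2::nat) = curve_to_jacobian f (Affine a b) \<longrightarrow> \<aa> \<in> jacobian_over f K0)"
proof
  assume L: "\<forall>i\<in>Idx. \<alpha> i \<in> K0 \<and> (\<exists>c\<in>K0. a - \<alpha> i = c ^ 2)"
  show "\<forall>\<aa>\<in>carrier (jacobian f).
       \<aa> [^]\<^bsub>jacobian f\<^esub> (2::nat) = curve_to_jacobian f (Affine a b) \<longrightarrow> \<aa> \<in> jacobian_over f K0"
  proof (intro ballI impI)
    fix \<aa> assume "\<aa> \<in> carrier (jacobian f)" "\<aa> [^]\<^bsub>jacobian f\<^esub> (2::nat) = curve_to_jacobian f (Affine a b)"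
    then obtain U V where h: "half_poly a b U V" and eq: "\<aa> = half_class U V"
      by (rule half_class_surj[OF ab])
    have r: "half_roots U V i \<in> K0" if i: "i \<in> Idx" for i
    proof -
      obtain c where c: "c \<in> K0" "a - \<alpha> i = c ^ 2" using L i by blast
      then have "half_roots U V i = c \<or> half_roots U V i = - c"
        using half_roots_square[OF h i] by (metis power2_eq_iff)
      with c minus_closed show ?thesis by auto
    qed
    have "poly_over K0 (half_W a U V)"
      unfolding half_W_eq_prod[OF h] using r by (intro poly_over_prod) simp
    then obtain U' V' where "half_W a U V = half_W a U' V'" "poly_over K0 U'" "poly_over K0 V'"
      using half_W_surj[of K0 a "half_W a U V"] add_closed mult_closed minus_closed a by auto
    then have "poly_over K0 U" "poly_over K0 V" using half_W_inj by metis+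
    with h show "\<aa> \<in> jacobian_over f K0" unfolding eq by (rule half_class_over)
  qed
next
  assume R: "\<forall>\<aa>\<in>carrier (jacobian f).
       \<aa> [^]\<^bsub>jacobian f\<^esub> (2::nat) = curve_to_jacobian f (Affine a b) \<longrightarrow> \<aa> \<in> jacobian_over f K0"
  have sum: "(\<Sum>i\<in>Idx. r i) \<in> K0" if r: "r \<in> root_choices a b" for r
  proof -
    obtain U V where h: "half_poly a b U V" "half_roots U V = r" using half_roots_surj[OF r] .
    have "half_class U V \<in> jacobian_over f K0" using R half_class_double[OF h(1)] by blast
    then have "poly_over K0 V" using half_poly_over[OF a b h(1)] by blast
    then show ?thesis using sum_roots_over[OF a h(1)] h(2) by simp
  qed
  (* The sums over r and over r with two signs reversed differ by 2 (r i + r j). *)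
  have "card (root_choices a b) \<noteq> 0" using card_root_choices[OF ab] by simp
  then obtain r where r: "r \<in> root_choices a b" by fastforce
  have pair: "r i + r j \<in> K0" if "i \<in> Idx" "j \<in> Idx" "i \<noteq> j" for i j
  proof -
    have "2 * (r i + r j) \<in> K0"
      using diff_closed[OF sum[OF r] sum[OF flip_two_signs(1)[OF r that]]] flip_two_signs(2)[OF r that] by simp
    then show ?thesis by (rule double_closed_imp[OF two_neq_0])
  qed
  show "\<forall>i\<in>Idx. \<alpha> i \<in> K0 \<and> (\<exists>c\<in>K0. a - \<alpha> i = c ^ 2)"
  proof
    fix i assume i: "i \<in> Idx"
    (* Here g \<ge> 1 enters: r i is isolated with the help of two further indices. *)
    have "2 \<le> card (Idx - {i})" using i g card_Idx by simp
    then obtain j k where jk: "j \<in> Idx - {i}" "k \<in> Idx - {i}" "j \<noteq> k"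
      by (auto simp: card_le_Suc_iff numeral_2_eq_2)
    have "2 * r i = (r i + r j) + (r i + r k) - (r j + r k)" by simp
    also have "\<dots> \<in> K0" using pair i jk by (intro diff_closed add_closed[of "r i + r j"]) auto
    finally have ri: "r i \<in> K0" by (rule double_closed_imp[OF two_neq_0])
    have "r i \<in> {z. z ^ 2 = a - \<alpha> i}" using r i unfolding root_choices_def by (blast dest: PiE_mem)
    then have sq: "a - \<alpha> i = r i ^ 2" by simp
    then have "\<alpha> i = a - r i * r i" by (simp add: power2_eq_square algebra_simps)
    then have "\<alpha> i \<in> K0" using a ri by (simp add: diff_closed mult_closed)
    with sq ri show "\<alpha> i \<in> K0 \<and> (\<exists>c\<in>K0. a - \<alpha> i = c ^ 2)" by blast
  qed
qed

end

theorem theorem4p5: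
  fixes K0 :: "'a::alg_closed_field set"
    and \<alpha> :: "nat \<Rightarrow> 'a" and f :: "'a poly" and g :: nat and a b :: 'a
  assumes char: "CHAR('a) \<noteq> 2"
    and K0: "subfield K0 (ring_of_type_algebra :: 'a ring)"
    and g: "g \<ge> 1"
    and distinct: "inj_on \<alpha> {1..2 * g + 1}"
    and f: "f = (\<Prod>i = 1..2 * g + 1. [:- \<alpha> i, 1:])"
    and f_over: "poly_over K0 f"
    and P: "a \<in> K0" "b \<in> K0" "b ^ 2 = poly f a"
  shows "card {\<aa> \<in> carrier (jacobian f). \<aa> [^]\<^bsub>jacobian f\<^esub> (2::nat) = curve_to_jacobian f (Affine a b)}
           = 2 ^ (2 * g) \<and>
         ((\<forall>i\<in>{1..2 * g + 1}. \<alpha> i \<in> K0 \<and> (\<exists>c\<in>K0. a - \<alpha> i = c ^ 2)) \<longleftrightarrow>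
          (\<forall>\<aa>\<in>carrier (jacobian f).
             \<aa> [^]\<^bsub>jacobian f\<^esub> (2::nat) = curve_to_jacobian f (Affine a b) \<longrightarrow> \<aa> \<in> jacobian_over f K0))"
proof -
  have two: "(2::'a) \<noteq> 0"
  proof
    assume "(2::'a) = 0"
    then have "CHAR('a) dvd 2" using of_nat_eq_0_iff_char_dvd[of 2, where 'a = 'a] by simp
    then have "CHAR('a) = 1 \<or> CHAR('a) = 2" by (meson prime_nat_iff two_is_prime_nat)
    with char show False by simp
  qed
  have coeff_f: "Polynomial.coeff f (2 * g + 1) = 1"
    using coeff_prod_linear[of "{1..2 * g + 1}" "\<lambda>i. - \<alpha> i" 1] by (simp add: f)
  have "Polynomial.degree f \<le> 2 * g + 1"
    using degree_prod_sum_le[of "{1..2 * g + 1}" "\<lambda>i. [:- \<alpha> i, 1:]"] by (simp add: f o_def)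
  then have degree_f: "Polynomial.degree f = 2 * g + 1"
    using coeff_f by (intro antisym le_degree) simp_all
  interpret subfield_set K0 using K0 by (rule subfield_set_subfield)
  interpret split_odd_curve_over f g K0 \<alpha> "{1..2 * g + 1}"
  proof
    show "Polynomial.order c f = 1" if "poly f c = 0" for c
      using that distinct unfolding f by (intro order_prod_linear) simp_all
  qed (use two degree_f coeff_f f_over f distinct in simp_all)
  show ?thesis
    using card_halves[OF P(3)] halves_over_iff[OF g P] by blast
qed

end
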